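(* Let $\theta\ge4$ be an integer, let $\mathcal C=\mathcal C(I,A,(\rho_i)_{i\in I},(C^a)_{a\in A})$ be a connected Cartan scheme with $I=\{1,2,\dots,\theta\}$ and $|A|=3$, and let $\mathcal R=\mathcal R(\mathcal C,(R^a)_{a\in A})$ be a finite irreducible root system of type $\mathcal C$. Then $\mathcal R$ is standard, and the common Cartan matrix $C$ is indecomposable and of type $B_4$, $C_4$, $D_4$ or $F_4$. Moreover, after a suitable permutation of $I$ and enumeration $A=\{x,y,z\}$, the maps $\rho_i$ are as follows: if $C$ is of type $B_4$ or $C_4$, then $\rho_1,\rho_3$ interchange $x,y$ and fix $z$, $\rho_2$ interchanges $y,z$ and fixes $x$, and $\rho_4=\mathrm{id}$; if $C$ is of type $D_4$, then $\rho_1,\rho_3,\rho_4$ interchange $x,y$ and fix $z$, and $\rho_2$ interchanges $y,z$ and fixes $x$; if $C$ is of type $F_4$, then $\rho_1$ interchanges $x,y$ and fixes $z$, $\rho_2$ interchanges $y,z$ and fixes $x$, and $\rho_3=\rho_4=\mathrm{id}$.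
   Context: Let $I$ be a nonempty finite set and $\{\alpha_i\mid i\in I\}$ the standard basis of $\mathbb Z^I$; $\mathbb N_0=\{0,1,2,\dots\}$. A generalized Cartan matrix is $C=(c_{ij})_{i,j\in I}\in\mathbb Z^{I\times I}$ with $c_{ii}=2$, $c_{jk}\le0$ for $j\ne k$, and $c_{ij}=0\Rightarrow c_{ji}=0$. A Cartan scheme $\mathcal C=\mathcal C(I,A,(\rho_i)_{i\in I},(C^a)_{a\in A})$ consists of a nonempty set $A$, maps $\rho_i:A\to A$ and generalized Cartan matrices $C^a=(c^a_{jk})_{j,k\in I}$ such that (C1) $\rho_i^2=\mathrm{id}$ and (C2) $c^a_{ij}=c^{\rho_i(a)}_{ij}$ for all $a\in A$, $i,j\in I$. It is connected if the group generated by the $\rho_i$ acts transitively on $A$; it is standard if $C^a=C^b$ for all $a,b\in A$ (a root system is standard if its Cartan scheme is). For $i\in I$, $a\in A$ let $\sigma_i^a\in\mathrm{Aut}(\mathbb Z^I)$, $\sigma_i^a(\alpha_j)=\alpha_j-c^a_{ij}\alpha_i$. A root system of type $\mathcal C$ is a family $\mathcal R=\mathcal R(\mathcal C,(R^a)_{a\in A})$ of subsets $R^a\subset\mathbb Z^I$ such that, writing $R^a_+=R^a\cap\mathbb N_0^I$ and $m^a_{i,j}=|R^a\cap(\mathbb N_0\alpha_i+\mathbb N_0\alpha_j)|$, for all $a\in A$, $i,j\in I$: (R1) $R^a=R^a_+\cup(-R^a_+)$; (R2) $R^a\cap\mathbb Z\alpha_i=\{\alpha_i,-\alpha_i\}$;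 (R3) $\sigma_i^a(R^a)=R^{\rho_i(a)}$; (R4) if $i\neq j$ and $m^a_{i,j}$ is finite then $(\rho_i\rho_j)^{m^a_{i,j}}(a)=a$. It is finite if every $R^a$ is finite. $\mathcal R$ is reducible if there exist nonempty disjoint $I_1,I_2\subset I$ with $I=I_1\cup I_2$ and $R^a=(R^a\cap\sum_{i\in I_1}\mathbb Z\alpha_i)\cup(R^a\cap\sum_{j\in I_2}\mathbb Z\alpha_j)$ for all $a\in A$; otherwise it is irreducible. *)

theory Defs
  imports Main
begin

text \<open>Elements of Z^I are represented as functions nat => int vanishing outside I.
  The index set I is a finite set of naturals; the object set A is a set of an
  arbitrary type 'a.\<close>

definition supp_in :: "nat set \<Rightarrow> (nat \<Rightarrow> int) set" where
  "supp_in J = {v. \<forall>k. k \<notin> J \<longrightarrow> v k = 0}"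

definition alpha :: "nat \<Rightarrow> nat \<Rightarrow> int" where
  "alpha i = (\<lambda>k. if k = i then 1 else 0)"

definition gcm :: "nat set \<Rightarrow> (nat \<Rightarrow> nat \<Rightarrow> int) \<Rightarrow> bool" where
  "gcm I M \<longleftrightarrow>
     (\<forall>i\<in>I. M i i = 2) \<and>
     (\<forall>j\<in>I. \<forall>k\<in>I. j \<noteq> k \<longrightarrow> M j k \<le> 0) \<and>
     (\<forall>i\<in>I. \<forall>j\<in>I. M i j = 0 \<longrightarrow> M j i = 0)"

definition cartan_scheme ::
  "nat set \<Rightarrow> 'a set \<Rightarrow> (nat \<Rightarrow> 'a \<Rightarrow> 'a) \<Rightarrow> ('a \<Rightarrow> nat \<Rightarrow> nat \<Rightarrow> int) \<Rightarrow> bool" where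
  "cartan_scheme I A \<rho> C \<longleftrightarrow>
     finite I \<and> I \<noteq> {} \<and> A \<noteq> {} \<and>
     (\<forall>i\<in>I. \<forall>a\<in>A. \<rho> i a \<in> A) \<and>
     (\<forall>a\<in>A. gcm I (C a)) \<and>
     (\<forall>i\<in>I. \<forall>a\<in>A. \<rho> i (\<rho> i a) = a) \<and>
     (\<forall>a\<in>A. \<forall>i\<in>I. \<forall>j\<in>I. C a i j = C (\<rho> i a) i j)"

text \<open>Connected: the group generated by the rho_i (which are involutions, so the
  group consists of finite products of them) acts transitively on A.\<close>
definition cs_connected ::
  "nat set \<Rightarrow> 'a set \<Rightarrow> (nat \<Rightarrow> 'a \<Rightarrow> 'a) \<Rightarrow> bool" where
  "cs_connected I A \<rho> \<longleftrightarrow>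
     (\<forall>a\<in>A. \<forall>b\<in>A. \<exists>ws. set ws \<subseteq> I \<and> foldr \<rho> ws a = b)"

definition cs_standard :: "nat set \<Rightarrow> 'a set \<Rightarrow> ('a \<Rightarrow> nat \<Rightarrow> nat \<Rightarrow> int) \<Rightarrow> bool" where
  "cs_standard I A C \<longleftrightarrow> (\<forall>a\<in>A. \<forall>b\<in>A. \<forall>i\<in>I. \<forall>j\<in>I. C a i j = C b i j)"

text \<open>sigma_i^a, the linear map with sigma_i^a(alpha_j) = alpha_j - c^a_ij alpha_i.\<close>
definition sigma ::
  "nat set \<Rightarrow> ('a \<Rightarrow> nat \<Rightarrow> nat \<Rightarrow> int) \<Rightarrow> 'a \<Rightarrow> nat \<Rightarrow> (nat \<Rightarrow> int) \<Rightarrow> (nat \<Rightarrow> int)" where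
  "sigma I C a i v = (\<lambda>k. if k = i then v k - (\<Sum>j\<in>I. C a i j * v j) else v k)"

definition pos_part :: "(nat \<Rightarrow> int) set \<Rightarrow> (nat \<Rightarrow> int) set" where
  "pos_part R = {v \<in> R. \<forall>k. 0 \<le> v k}"

definition cone2 :: "nat \<Rightarrow> nat \<Rightarrow> (nat \<Rightarrow> int) set" where
  "cone2 i j = {v. (\<forall>k. k \<noteq> i \<and> k \<noteq> j \<longrightarrow> v k = 0) \<and> 0 \<le> v i \<and> 0 \<le> v j}"

definition root_system ::
  "nat set \<Rightarrow> 'a set \<Rightarrow> (nat \<Rightarrow> 'a \<Rightarrow> 'a) \<Rightarrow> ('a \<Rightarrow> nat \<Rightarrow> nat \<Rightarrow> int)
     \<Rightarrow> ('a \<Rightarrow> (nat \<Rightarrow> int) set) \<Rightarrow> bool" where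
  "root_system I A \<rho> C R \<longleftrightarrow>
     cartan_scheme I A \<rho> C \<and>
     (\<forall>a\<in>A. R a \<subseteq> supp_in I) \<and>
     (\<forall>a\<in>A. R a = pos_part (R a) \<union> (\<lambda>v k. - v k) ` pos_part (R a)) \<and>
     (\<forall>a\<in>A. \<forall>i\<in>I. R a \<inter> {v. \<exists>n::int. v = (\<lambda>k. n * alpha i k)}
                     = {alpha i, (\<lambda>k. - alpha i k)}) \<and>
     (\<forall>a\<in>A. \<forall>i\<in>I. sigma I C a i ` R a = R (\<rho> i a)) \<and>
     (\<forall>a\<in>A. \<forall>i\<in>I. \<forall>j\<in>I. i \<noteq> j \<longrightarrow> finite (R a \<inter> cone2 i j) \<longrightarrow>
         ((\<rho> i \<circ> \<rho> j) ^^ card (R a \<inter> cone2 i j)) a = a)"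

definition rs_finite :: "'a set \<Rightarrow> ('a \<Rightarrow> (nat \<Rightarrow> int) set) \<Rightarrow> bool" where
  "rs_finite A R \<longleftrightarrow> (\<forall>a\<in>A. finite (R a))"

definition rs_reducible :: "nat set \<Rightarrow> 'a set \<Rightarrow> ('a \<Rightarrow> (nat \<Rightarrow> int) set) \<Rightarrow> bool" where
  "rs_reducible I A R \<longleftrightarrow>
     (\<exists>I1 I2. I1 \<noteq> {} \<and> I2 \<noteq> {} \<and> I1 \<inter> I2 = {} \<and> I = I1 \<union> I2 \<and>
        (\<forall>a\<in>A. R a = (R a \<inter> supp_in I1) \<union> (R a \<inter> supp_in I2)))"

definition rs_irreducible :: "nat set \<Rightarrow> 'a set \<Rightarrow> ('a \<Rightarrow> (nat \<Rightarrow> int) set) \<Rightarrow> bool" where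
  "rs_irreducible I A R \<longleftrightarrow> \<not> rs_reducible I A R"

definition indecomposable :: "nat set \<Rightarrow> (nat \<Rightarrow> nat \<Rightarrow> int) \<Rightarrow> bool" where
  "indecomposable I M \<longleftrightarrow>
     \<not> (\<exists>I1 I2. I1 \<noteq> {} \<and> I2 \<noteq> {} \<and> I1 \<inter> I2 = {} \<and> I = I1 \<union> I2 \<and>
            (\<forall>i\<in>I1. \<forall>j\<in>I2. M i j = 0))"

text \<open>Cartan matrices of rank 4 in standard numbering (indices 1..4), with the
  convention c_ij = <alpha_i^vee, alpha_j> matching sigma_i(alpha_j) = alpha_j - c_ij alpha_i.\<close>
definition mat4 :: "int list list \<Rightarrow> nat \<Rightarrow> nat \<Rightarrow> int" where
  "mat4 L i j = L ! (i - 1) ! (j - 1)"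

definition cartan_B4 :: "nat \<Rightarrow> nat \<Rightarrow> int" where
  "cartan_B4 = mat4 [[2,-1,0,0],[-1,2,-1,0],[0,-1,2,-1],[0,0,-2,2]]"

definition cartan_C4 :: "nat \<Rightarrow> nat \<Rightarrow> int" where
  "cartan_C4 = mat4 [[2,-1,0,0],[-1,2,-1,0],[0,-1,2,-2],[0,0,-1,2]]"

definition cartan_D4 :: "nat \<Rightarrow> nat \<Rightarrow> int" where
  "cartan_D4 = mat4 [[2,-1,0,0],[-1,2,-1,-1],[0,-1,2,0],[0,-1,0,2]]"

text \<open>F4 with chain 1-2-3-4 and double bond between 2 and 3; since the orientation
  of the double bond depends on a convention (and both orientations are matrices
  of type F4), both orientations are admitted.\<close>
definition cartan_F4 :: "nat \<Rightarrow> nat \<Rightarrow> int" where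
  "cartan_F4 = mat4 [[2,-1,0,0],[-1,2,-1,0],[0,-2,2,-1],[0,0,-1,2]]"

definition cartan_F4' :: "nat \<Rightarrow> nat \<Rightarrow> int" where
  "cartan_F4' = mat4 [[2,-1,0,0],[-1,2,-2,0],[0,-1,2,-1],[0,0,-1,2]]"

definition mat_eq4 :: "(nat \<Rightarrow> nat \<Rightarrow> int) \<Rightarrow> (nat \<Rightarrow> nat \<Rightarrow> int) \<Rightarrow> bool" where
  "mat_eq4 M N \<longleftrightarrow> (\<forall>i\<in>{1..4}. \<forall>j\<in>{1..4}. M i j = N i j)"

definition swaps_fixes :: "('a \<Rightarrow> 'a) \<Rightarrow> 'a \<Rightarrow> 'a \<Rightarrow> 'a \<Rightarrow> bool" where
  "swaps_fixes f p q r \<longleftrightarrow> f p = q \<and> f q = p \<and> f r = r"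

definition is_id_on :: "('a \<Rightarrow> 'a) \<Rightarrow> 'a set \<Rightarrow> bool" where
  "is_id_on f S \<longleftrightarrow> (\<forall>a\<in>S. f a = a)"

end

theory Submission
  imports Defs
begin

text \<open>For \<open>J \<subseteq> I\<close> let \<open>d\<^sup>a\<close> be the sum of the positive roots at \<open>a\<close> with support in \<open>J\<close>. Since
  \<open>\<sigma>\<^sub>i\<close> permutes the positive roots other than \<open>\<alpha>\<^sub>i\<close>, the \<open>i\<close>-th coordinates at \<open>a\<close> and \<open>\<rho>\<^sub>i(a)\<close>
  add up to \<open>2 - \<Sum>\<^sub>j c\<^sub>i\<^sub>j d\<^sup>a\<^sub>j\<close> (over \<open>j \<noteq> i\<close>) and all other coordinates agree. With three
  objects these are few linear equations with positive integer solutions; as for the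
  vector \<open>2\<rho>\<close> of a Weyl group, they rule out cycles, affine diagrams and nonconstant Cartan
  entries already in ranks three to five. Besides, (R4) is needed in three cases: two distinct
  transpositions have a product of order three, hence are joined and not of type \<open>B\<^sub>2\<close>; a transposition and an
  identity have even \<open>m\<close>, hence are not of type \<open>A\<^sub>2\<close>. Two distinct transpositions
  \<open>(x y)\<close>, \<open>(y z)\<close> occur by connectedness; \<open>D\<^sub>4\<close>, \<open>B\<^sub>4\<close>/\<open>C\<^sub>4\<close> and \<open>F\<^sub>4\<close> correspond to three, two or
  one indices acting by the transposition that occurs most often.\<close>

section \<open>Integer equations\<close>

text \<open>Between objects, (C2) only compares row \<open>i\<close> at \<open>a\<close> with row
  \<open>i\<close> at \<open>\<rho>\<^sub>i(a)\<close>, so a bond seen at one object need not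
  persist. Hence the entries at the three objects are separate unknowns, and the equations are
  bilinear in entries and coordinates. They become linear estimates because a nonzero entry is at
  least 1, so that its term is at least the coordinate itself; even \<open>m\<close> gives the
  sharper estimate \<open>double_bond\<close>. Once coordinates at two objects are known to agree,
  comparing the equations there forces entries to agree as well. Where all coordinates agree, the
  equations read \<open>C d = (2, ..., 2)\<close>: a positive left null vector of an affine matrix
  would annihilate the left side but not the right one. Irreducibility speaks of roots, while the
  classification extends a diagram of Cartan entries one index at a time. The bridge is
  \<open>reducible_of_blocks\<close>, whose proof needs a longest element.\<close>

lemma prod_eq_1:
  fixes a b :: int
  assumes "1 \<le> a" "1 \<le> b" "a * b \<le> 1"
  shows "a = 1 \<and> b = 1"
proof -
  have "a * 1 \<le> a * b" "1 * b \<le> a * b"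
    using assms by (intro mult_left_mono mult_right_mono; simp)+
  then show ?thesis using assms by linarith
qed

lemma prod_eq_2:
  fixes a b :: int
  assumes "1 \<le> a" "1 \<le> b" "a * b = 2"
  shows "a = 1 \<and> b = 2 \<or> a = 2 \<and> b = 1"
proof -
  have "a * 1 \<le> a * b" "1 * b \<le> a * b"
    using assms by (intro mult_left_mono mult_right_mono; simp)+
  then have "a \<le> 2" "b \<le> 2" using assms by linarith+
  then have "a = 1 \<or> a = 2" "b = 1 \<or> b = 2" using assms by auto
  then show ?thesis using assms(3) by auto
qed

text \<open>The variables are coordinates of the sums of the positive roots of a subset of \<open>I\<close> at the
  three objects \<open>x\<close>, \<open>y\<close>, \<open>z\<close>, and negated Cartan entries. In \<open>arith_A3\<close> the coordinates \<open>di\<close>, \<open>dk\<close>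
  are the same at all objects, while the one of the middle index is \<open>b\<close> at \<open>x\<close>, \<open>y\<close> and \<open>w\<close> at \<open>z\<close>.\<close>
lemma arith_A3:
  fixes di dk b w p p' e e' q q' r r' m m' mz mz' :: int
  assumes pos: "1 \<le> di" "1 \<le> dk" "1 \<le> b" "1 \<le> w"
    and ge: "1 \<le> p" "1 \<le> p'" "1 \<le> e" "1 \<le> e'" "1 \<le> q" "1 \<le> q'" "1 \<le> r" "1 \<le> r'"
      "0 \<le> m" "0 \<le> m'" "0 \<le> mz" "0 \<le> mz'" "m = 0 \<longleftrightarrow> m' = 0"
    and x: "2 * di = 2 + p * b + m * dk" "2 * dk = 2 + p' * b + m' * di" "2 * b = 2 + e * di + e' * dk"
    and yz: "b + w = 2 + q * di + q' * dk" "2 * di = 2 + r * w + mz * dk" "2 * dk = 2 + r' * w + mz' * di"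
    and not_B2: "\<not> (p = 1 \<and> e = 2)" "\<not> (p = 2 \<and> e = 1)" "\<not> (p' = 1 \<and> e' = 2)" "\<not> (p' = 2 \<and> e' = 1)"
  shows "p = 1 \<and> p' = 1 \<and> e = 1 \<and> e' = 1 \<and> q = 1 \<and> q' = 1 \<and> r = 1 \<and> r' = 1 \<and>
    m = 0 \<and> m' = 0 \<and> mz = 0 \<and> mz' = 0"
proof -
  have lb: "b \<le> p * b" "b \<le> p' * b" "di \<le> e * di" "dk \<le> e' * dk" "di \<le> q * di" "dk \<le> q' * dk"
    using mult_right_mono[of 1 _ b] mult_right_mono[of 1 _ di] mult_right_mono[of 1 _ dk] ge pos by auto
  have m0: "m = 0"
  proof (rule ccontr)
    assume "m \<noteq> 0"
    then have "dk \<le> m * dk" "di \<le> m' * di"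
      using mult_right_mono[of 1 m dk] mult_right_mono[of 1 m' di] ge pos by auto
    then show False using lb x by linarith
  qed
  then have m'0: "m' = 0" using ge by simp
  have "2 * di = 2 + p * b" "2 * dk = 2 + p' * b" using x m0 m'0 by simp_all
  \<comment> \<open>Scaling the equations of the end indices by \<open>e\<close> and
    \<open>e'\<close> lets the equation of the middle one eliminate \<open>di\<close> and
    \<open>dk\<close>; what remains bounds the sum of the two bond products by 3.\<close>
  then have "e * (2 * di) = e * (2 + p * b)" "e' * (2 * dk) = e' * (2 + p' * b)" by simp_all
  then have "4 * b = 4 + 2 * e + 2 * e' + (e * p + e' * p') * b" using x(3) by (simp add: algebra_simps)
  then have "(e * p + e' * p') * b < 4 * b" using ge by linarith
  then have lt: "e * p + e' * p' < 4" using pos by (simp add: mult_less_cancel_right)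
  have "1 \<le> e * p" "1 \<le> e' * p'" using ge mult_mono[of 1 e 1 p] mult_mono[of 1 e' 1 p'] by auto
  moreover have "e * p \<noteq> 2" "e' * p' \<noteq> 2" using prod_eq_2[of e p] prod_eq_2[of e' p'] ge not_B2 by auto
  ultimately have "e * p = 1" "e' * p' = 1" using lt by linarith+
  then have 1: "e = 1 \<and> p = 1" "e' = 1 \<and> p' = 1" using prod_eq_1 ge by simp_all
  \<comment> \<open>3, 4, 3 are the coefficients of twice the Weyl vector of A3.\<close>
  then have d: "b = 4" "di = 3" "dk = 3" using x m0 m'0 by auto
  have "4 \<le> w" using yz(1) lb d by linarith
  then have "w \<le> r * w" "w \<le> r' * w" using mult_right_mono[of 1 _ w] ge by auto
  moreover have "r * w + 3 * mz = 4" "r' * w + 3 * mz' = 4" using yz d by simp_all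
  ultimately have w: "w = 4" "mz = 0" "mz' = 0" using \<open>4 \<le> w\<close> ge by linarith+
  then have "r = 1" "r' = 1" "q = 1" "q' = 1" using yz d ge by auto
  then show ?thesis using 1 m0 m'0 w by simp
qed

text \<open>Elimination at \<open>x\<close> forces \<open>k = m = 1\<close>. As
  \<open>my = m\<close>, evenness at \<open>y\<close> can only come from \<open>ky\<close>, which
  pushes \<open>w\<close> above \<open>b\<close>; the equations of the index with coordinate
  \<open>di\<close> at \<open>x\<close> and \<open>z\<close> bound \<open>w\<close> by
  \<open>b\<close>.\<close>

lemma arith_A3_middle:
  fixes di dk b c w g h g' h' k m ky my gz gz' :: int
  assumes pos: "1 \<le> di" "1 \<le> dk" "1 \<le> b" "1 \<le> w" "1 \<le> c"
    and ge: "0 \<le> g" "0 \<le> g'" "1 \<le> k" "1 \<le> m" "1 \<le> ky" "1 \<le> my" "0 \<le> gz" "0 \<le> h" "0 \<le> h'"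
      "g = 0" "g' = 0" "h = 0" "h' = 0" "2 \<le> ky * my"
    and x: "2 * di = 2 + b + g * c" "2 * dk = 2 + b + g' * c" "2 * b = 2 + di + dk + k * c"
      "2 * c = 2 + h * di + h' * dk + m * b"
    and yz: "2 * c = 2 + my * b" "b + w = 2 + di + dk + ky * c" "2 * di = 2 + w + gz * c"
  shows False
proof -
  have b: "b = 4 + k * c" using x ge by auto
  have my: "my = m" using x(4) yz(1) ge pos by simp
  have "2 * c = 2 + m * b" using x(4) ge by simp
  then have "k * (2 * c) = k * (2 + m * b)" by simp
  then have "2 * b = 8 + 2 * k + (k * m) * b" using b by (simp add: algebra_simps)
  then have "(k * m) * b < 2 * b" using ge by linarith
  then have "k * m < 2" using pos by (simp add: mult_less_cancel_right)
  then have "k = 1 \<and> m = 1" using prod_eq_1 ge by simp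
  then have "2 \<le> ky" using ge my by simp
  then have "2 * c \<le> ky * c" using pos by simp
  moreover have "0 \<le> gz * c" using ge pos by simp
  moreover have "2 * b = 2 + di + dk + c" "2 * di = 2 + b" using x ge \<open>k = 1 \<and> m = 1\<close> by simp_all
  ultimately show False using yz pos by linarith
qed

text \<open>Bonds from the fourth index to \<open>di\<close> or \<open>b\<close> would close a
  cycle, excluded by adding the equations along it. Without them, eliminating \<open>di\<close>,
  \<open>b\<close> and \<open>dk\<close> leaves \<open>3 * (g' * h') * c < 8 * c\<close>, so an even
  bond has product exactly 2.\<close>

lemma arith_A3_end:
  fixes di dk b c g h g' h' k m :: int
  assumes pos: "1 \<le> di" "1 \<le> dk" "1 \<le> b" "1 \<le> c"
    and ge: "0 \<le> g" "1 \<le> g'" "0 \<le> k" "0 \<le> m" "0 \<le> h" "1 \<le> h'" "g = 0 \<longleftrightarrow> h = 0" "k = 0 \<longleftrightarrow> m = 0"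
      "2 \<le> g' * h'"
    and x: "2 * di = 2 + b + g * c" "2 * dk = 2 + b + g' * c" "2 * b = 2 + di + dk + k * c"
      "2 * c = 2 + h * di + h' * dk + m * b"
  shows "g = 0 \<and> h = 0 \<and> k = 0 \<and> m = 0 \<and> g' * h' = 2"
proof -
  have lb: "c \<le> g' * c" "dk \<le> h' * dk" "0 \<le> g * c" "0 \<le> h * di" "0 \<le> k * c" "0 \<le> m * b"
    using mult_right_mono[of 1 g' c] mult_right_mono[of 1 h' dk] ge pos by auto
  have k0: "k = 0"
  proof (rule ccontr)
    assume "k \<noteq> 0"
    then have "c \<le> k * c" "b \<le> m * b"
      using mult_right_mono[of 1 k c] mult_right_mono[of 1 m b] ge pos by auto
    then show False using lb x by linarith
  qed
  then have m0: "m = 0" using ge by simp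
  have g0: "g = 0"
  proof (rule ccontr)
    assume "g \<noteq> 0"
    then have "c \<le> g * c" "di \<le> h * di"
      using mult_right_mono[of 1 g c] mult_right_mono[of 1 h di] ge pos by auto
    then show False using lb x by linarith
  qed
  then have h0: "h = 0" using ge by simp
  have "2 * di = 2 + b" "2 * b = 2 + di + dk" using x g0 k0 by simp_all
  then have b: "2 * b = 8 + g' * c" using x(2) by linarith
  then have "4 * dk = 12 + 3 * (g' * c)" using x(2) by linarith
  then have "h' * (4 * dk) = h' * (12 + 3 * (g' * c))" by simp
  then have *: "4 * (h' * dk) = 12 * h' + 3 * ((g' * h') * c)" by (simp add: algebra_simps)
  define P where "P = g' * h'"
  have "2 * c = 2 + h' * dk" using x(4) h0 m0 by simp
  then have "3 * (P * c) < 8 * c" using * ge unfolding P_def[symmetric] by linarith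
  then have "(3 * P) * c < 8 * c" by simp
  then have "3 * P < 8" using pos by simp
  then have "3 * (g' * h') < 8" by (simp add: P_def)
  then show ?thesis using g0 h0 k0 m0 ge by linarith
qed

text \<open>Estimates \<open>G * c\<close>, the contribution of a neighbour with coordinate
  \<open>c\<close> to the equation of the index with coordinate \<open>b\<close>. Only the product
  \<open>G * H\<close> enters, so both orientations of a double bond are treated at once.\<close>

lemma double_bond:
  fixes G H c b :: int
  assumes "1 \<le> G" "1 \<le> H" "2 \<le> G * H" "2 * c \<ge> s + H * b" "0 \<le> b"
  shows "G * s + 2 * b \<le> 2 * (G * c)"
proof -
  have "G * (s + H * b) \<le> G * (2 * c)" using assms by (intro mult_left_mono) auto
  moreover have "2 * b \<le> (G * H) * b" using assms by (intro mult_right_mono) auto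
  ultimately show ?thesis by (simp add: algebra_simps)
qed

text \<open>From here on \<open>i\<close> acts by \<open>(x y)\<close>, \<open>j\<close> by \<open>(y z)\<close> and a third index as identity: the \<open>i\<close>-th
  coordinate is \<open>u\<close> at \<open>x\<close> and \<open>v\<close> at \<open>y\<close>, \<open>z\<close>, the \<open>j\<close>-th is \<open>b\<close> at \<open>x\<close>, \<open>y\<close> and \<open>w\<close> at \<open>z\<close>.\<close>
lemma arith_triangle:
  fixes u v w b c p q r e g h h' G H H' k1 k2 k3 k4 :: int
  assumes pos: "1 \<le> u" "1 \<le> v" "1 \<le> w" "1 \<le> b" "1 \<le> c"
    and ge: "1 \<le> p" "1 \<le> q" "1 \<le> r" "1 \<le> e" "1 \<le> g" "1 \<le> h" "1 \<le> h'" "1 \<le> G" "1 \<le> H" "1 \<le> H'"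
      "0 \<le> k1" "0 \<le> k2" "0 \<le> k3" "0 \<le> k4"
    and even: "2 \<le> g * h" "2 \<le> g * h'" "2 \<le> G * H" "2 \<le> G * H'"
    and eq: "u + v = 2 + p * b + g * c" "2 * v = 2 + r * w + k1 * c" "b + w = 2 + q * v + G * c"
      "2 * b = 2 + e * u + k2 * c" "2 * c = 2 + h * u + k3 * b" "2 * c = 2 + h' * v + H' * b"
      "2 * c = 2 + k4 * v + H * w"
  shows False
proof -
  have lb: "b \<le> p * b" "w \<le> r * w" "v \<le> q * v" "u \<le> e * u" "c \<le> g * c" "u \<le> h * u" "v \<le> h' * v"
     "c \<le> G * c" "w \<le> H * w" "b \<le> H' * b" "0 \<le> k1 * c" "0 \<le> k2 * c" "0 \<le> k3 * b" "0 \<le> k4 * v"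
    using mult_right_mono[of 1 _ b] mult_right_mono[of 1 _ w] mult_right_mono[of 1 _ v]
      mult_right_mono[of 1 _ u] mult_right_mono[of 1 _ c] ge pos by auto
  \<comment> \<open>The factor \<open>g\<close> is shared by two objects while \<open>h\<close> and
    \<open>h'\<close> may differ; if \<open>g = 1\<close>, both of them are at least 2. The same
    holds for \<open>G\<close>, so four orientations remain.\<close>
  consider "2 \<le> g" "2 \<le> G" | "2 \<le> g" "2 \<le> H" "2 \<le> H'" | "2 \<le> h" "2 \<le> h'" "2 \<le> G"
    | "2 \<le> h" "2 \<le> h'" "2 \<le> H" "2 \<le> H'"
  proof -
    have "2 \<le> g \<or> (2 \<le> h \<and> 2 \<le> h')" using even ge by (cases "g = 1") auto
    moreover have "2 \<le> G \<or> (2 \<le> H \<and> 2 \<le> H')" using even ge by (cases "G = 1") auto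
    ultimately show ?thesis using that by blast
  qed
  then show False
  proof cases
    case 1
    then have "2 * c \<le> g * c" "2 * c \<le> G * c" using pos by simp_all
    then show False using lb eq by linarith
  next
    case 2
    then have "2 * c \<le> g * c" "2 * w \<le> H * w" "2 * b \<le> H' * b" using pos by simp_all
    then show False using lb eq by linarith
  next
    case 3
    then have "2 * c \<le> G * c" "2 * u \<le> h * u" "2 * v \<le> h' * v" using pos by simp_all
    then show False using lb eq by linarith
  next
    case 4
    then have "2 * u \<le> h * u" "2 * v \<le> h' * v" "2 * w \<le> H * w" "2 * b \<le> H' * b" using pos by simp_all
    then show False using lb eq pos by linarith
  qed
qed

text \<open>The solutions are the patterns of B3 and C3. The implications in \<open>B2\<close> tie
  \<open>H\<close> at \<open>z\<close> to \<open>H'\<close> at \<open>y\<close>; these entries lie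
  in the row of the identity index, which (C2) does not compare between different objects.\<close>

lemma arith_B3:
  fixes u v w b c p q r e G H H' k1 k2 k4 :: int
  assumes pos: "1 \<le> u" "1 \<le> v" "1 \<le> w" "1 \<le> b" "1 \<le> c"
    and ge: "1 \<le> p" "1 \<le> q" "1 \<le> r" "1 \<le> e" "1 \<le> G" "1 \<le> H" "1 \<le> H'"
      "0 \<le> k1" "1 \<le> k2" "0 \<le> k4" "k1 = 0 \<longleftrightarrow> k4 = 0"
    and even: "2 \<le> G * H" "2 \<le> G * H'"
    and B2: "G * H' = 2 \<Longrightarrow> H = H'" "G * H = 2 \<Longrightarrow> H = H'" "\<not> (p = 1 \<and> e = 2)"
    and eq: "u + v = 2 + p * b" "2 * v = 2 + r * w + k1 * c" "b + w = 2 + q * v + G * c"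
      "2 * b = 2 + e * u + k2 * c" "2 * c = 2 + H' * b" "2 * c = 2 + k4 * v + H * w"
  shows "p = 1 \<and> q = 1 \<and> r = 1 \<and> e = 1 \<and> H = H' \<and> G * H = 2 \<and> k1 = 0 \<and> k4 = 0 \<and> k2 = G"
proof -
  have lb: "b \<le> p * b" "w \<le> r * w" "v \<le> q * v" "u \<le> e * u" "c \<le> G * c" "w \<le> H * w" "b \<le> H' * b"
     "0 \<le> k1 * c" "c \<le> k2 * c" "0 \<le> k4 * v"
    using mult_right_mono[of 1 _ b] mult_right_mono[of 1 _ w] mult_right_mono[of 1 _ v]
      mult_right_mono[of 1 _ u] mult_right_mono[of 1 _ c] ge pos by auto
  have H': "H' \<le> 2"
  proof (rule ccontr)
    assume "\<not> ?thesis"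
    then have "3 * b \<le> H' * b" using pos by simp
    consider "H' \<ge> 4" | "H' = 3" using \<open>\<not> H' \<le> 2\<close> by linarith
    then show False
    proof cases
      case 1
      then have "4 * b \<le> H' * b" using pos by simp
      then show False using lb eq pos by linarith
    next
      case 2
      then have "H' * b = 3 * b" by simp
      consider "2 \<le> G" | "G = 1" "H = 2" | "3 \<le> H" using even ge by (cases "G = 1"; cases "H = 2"; cases "H = 1") auto
      then show False
      proof cases
        case 1
        then have "2 * c \<le> G * c" using pos by simp
        then show False using lb eq pos \<open>H' * b = 3 * b\<close> by linarith
      next
        case H2: 2
        then show False using B2 2 by simp
      next
        case 3
        then have "3 * w \<le> H * w" using pos by simp
        then show False using lb eq pos \<open>H' * b = 3 * b\<close> by linarith
      qed
    qed
  qed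
  then consider "H' = 1" "G = 2" | "H' = 1" "3 \<le> G" | "H' = 2" "G = 1" | "H' = 2" "2 \<le> G"
    using ge even by (cases "H' = 1"; cases "G = 1"; cases "G = 2") auto
  then show ?thesis
  proof cases
    case 1
    then have H: "H = 1" using B2 by simp
    have c: "2 * c = 2 + b" using eq 1 by simp
    have w: "w = 2 + q * v + 2 * c - b" using eq 1 by simp
    have rw: "q * v + 4 \<le> r * w" using lb w c by linarith
    have k40: "k4 = 0"
    proof (rule ccontr)
      assume "k4 \<noteq> 0"
      then have "c \<le> k1 * c" "v \<le> k4 * v" using mult_right_mono[of 1 k1 c] mult_right_mono[of 1 k4 v] ge pos by auto
      moreover have "H * w = w" using H by simp
      ultimately show False using eq(2,6) c w rw lb by linarith
    qed
    then have "b = w" using eq(6) H c by simp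
    have k1: "k1 = 0" using ge k40 by simp
    then have e2: "2 * v = 2 + r * w" using eq(2) by simp
    have q: "q = 1"
    proof (rule ccontr)
      assume "q \<noteq> 1"
      then have "2 * v \<le> q * v" using ge pos by simp
      then show False using e2 w c lb(2) by linarith
    qed
    have r: "r = 1"
    proof (rule ccontr)
      assume "r \<noteq> 1"
      then have "2 * w \<le> r * w" using ge pos by simp
      moreover have "q * v = v" using q by simp
      ultimately show False using e2 w c pos by linarith
    qed
    have "r * w = w" "q * v = v" using q r by simp_all
    \<comment> \<open>6, 10, 6 are the coefficients of twice the Weyl vector of C3.\<close>
    then have v: "v = 6" "w = 10" "b = 10" "c = 6" using e2 w c \<open>b = w\<close> by linarith+
    have "k2 * c = 6 * k2" "p * b = 10 * p" using v by simp_all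
    then have "e * u + 6 * k2 = 18" "u = 10 * p - 4" using eq(1,4) v by linarith+
    then have "p = 1" using lb(4) ge pos by linarith
    then have "6 * e + 6 * k2 = 18" using \<open>e * u + 6 * k2 = 18\<close> \<open>u = 10 * p - 4\<close> by simp
    then have "e + k2 = 3" by simp
    moreover have "e \<noteq> 2" using B2(3) \<open>p = 1\<close> by simp
    ultimately have "e = 1" "k2 = 2" using ge by linarith+
    then show ?thesis using \<open>p = 1\<close> q r H 1 k1 k40 by simp
  next
    case 2
    then have "3 * c \<le> G * c" "H' * b = b" using pos by simp_all
    then show ?thesis using lb eq pos by linarith
  next
    case 3
    then have H: "H = 2" using B2 by simp
    have c: "c = 1 + b" using eq 3 by simp
    have k2: "k2 = 1"
    proof (rule ccontr)
      assume "k2 \<noteq> 1"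
      then have "2 * c \<le> k2 * c" using ge pos by simp
      then show False using eq c lb pos by linarith
    qed
    then have b: "b = 3 + e * u" using eq c by simp
    have w: "w = 3 + q * v" using eq 3 c by simp
    have k40: "k4 = 0"
    proof (rule ccontr)
      assume "k4 \<noteq> 0"
      then have "c \<le> k1 * c" "v \<le> k4 * v" using mult_right_mono[of 1 k1 c] mult_right_mono[of 1 k4 v] ge pos by auto
      moreover have "H * w = 2 * w" using H by simp
      ultimately show False using eq(2,6) c w lb by linarith
    qed
    then have "b = w" using eq(6) H c by simp
    have k1: "k1 = 0" using ge k40 by simp
    then have e2: "2 * v = 2 + r * w" using eq(2) by simp
    have q: "q = 1"
    proof (rule ccontr)
      assume "q \<noteq> 1"
      then have "2 * v \<le> q * v" using ge pos by simp
      then show False using w e2 lb by linarith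
    qed
    have r: "r = 1"
    proof (rule ccontr)
      assume "r \<noteq> 1"
      then have "2 * w \<le> r * w" using ge pos by simp
      moreover have "q * v = v" using q by simp
      ultimately show False using e2 w pos by linarith
    qed
    have "r * w = w" "q * v = v" using q r by simp_all
    \<comment> \<open>With \<open>c = 9\<close> these are the coefficients 5, 8, 9 of twice the Weyl
      vector of B3.\<close>
    then have v: "v = 5" "w = 8" "b = 8" using e2 w \<open>b = w\<close> by linarith+
    have "p * b = 8 * p" using v by simp
    then have "e * u = 5" "u = 8 * p - 3" using eq(1) b v by linarith+
    then have "p = 1" using lb(4) ge pos by linarith
    then have "e = 1" using \<open>e * u = 5\<close> \<open>u = 8 * p - 3\<close> by simp
    then show ?thesis using \<open>p = 1\<close> q r H 3 k1 k40 k2 by simp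
  next
    case 4
    then have "2 * c \<le> G * c" "H' * b = 2 * b" using pos by simp_all
    then show ?thesis using lb eq pos by linarith
  qed
qed

text \<open>Because \<open>G * H = 2\<close>, the unknown \<open>v\<close> disappears from twice the
  equation for \<open>c\<close> at \<open>x\<close> plus the one at \<open>z\<close>. Eliminating
  \<open>f\<close> as well leaves \<open>(2 * k + kz) * N < 4\<close>, where the left side is at
  least 3.\<close>

lemma arith_F4:
  fixes u v w b c f G H N k kz :: int
  assumes pos: "1 \<le> u" "1 \<le> v" "1 \<le> w" "1 \<le> b" "1 \<le> c" "1 \<le> f"
    and ge: "1 \<le> G" "1 \<le> H" "1 \<le> N" "1 \<le> k" "1 \<le> kz" and GH: "G * H = 2"
    and eq: "u + v = 2 + b" "2 * v = 2 + w" "b + w = 2 + v + G * c"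
      "2 * c = 2 + H * b + k * f" "2 * c = 2 + H * w + kz * f" "2 * f = 2 + N * c"
  shows "N = 1 \<and> k = 1 \<and> kz = 1"
proof -
  have b: "b = 4 + G * c - v" and w: "w = 2 * v - 2" using eq by simp_all
  have 1: "H * b = 4 * H + 2 * c - H * v"
    using GH by (simp add: b algebra_simps flip: mult.assoc)
  have 2: "H * w = 2 * (H * v) - 2 * H" by (simp add: w algebra_simps)
  have 3: "2 * c = 6 + 6 * H + 2 * (k * f) + kz * f" using eq(4,5) 1 2 by simp
  have "4 * c = 12 + 12 * H + (2 * k + kz) * (2 * f)" using 3 by (simp add: algebra_simps)
  also have "\<dots> = 12 + 12 * H + 2 * (2 * k + kz) + ((2 * k + kz) * N) * c"
    unfolding eq(6) by (simp add: algebra_simps)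
  finally have *: "4 * c = 12 + 12 * H + 2 * (2 * k + kz) + ((2 * k + kz) * N) * c" .
  define Q where "Q = (2 * k + kz) * N"
  have "4 * c - Q * c = 12 + 12 * H + 2 * (2 * k + kz)" using * unfolding Q_def[symmetric] by simp
  moreover have "0 < 12 + 12 * H + 2 * (2 * k + kz)" using ge by simp
  ultimately have "Q * c < 4 * c" by simp
  then have lt: "(2 * k + kz) * N < 4" using pos unfolding Q_def by simp
  then have "N = 1" using mult_mono[of 3 "2 * k + kz" 2 N] ge by (cases "N = 1") auto
  then show ?thesis using lt ge by simp
qed

section \<open>The sum of the positive roots\<close>

locale finite_root_system =
  fixes I :: "nat set" and A :: "'a set" and \<rho> :: "nat \<Rightarrow> 'a \<Rightarrow> 'a"
    and C :: "'a \<Rightarrow> nat \<Rightarrow> nat \<Rightarrow> int" and R :: "'a \<Rightarrow> (nat \<Rightarrow> int) set"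
  assumes rs: "root_system I A \<rho> C R"
    and fin: "rs_finite A R"
begin

text \<open>The sign makes off-diagonal entries nonnegative, so that every term on the right of
  \<open>d_eq\<close> can be bounded below.\<close>

definition n :: "'a \<Rightarrow> nat \<Rightarrow> nat \<Rightarrow> int" where
  "n a i j = - C a i j"

abbreviation sig :: "'a \<Rightarrow> nat \<Rightarrow> (nat \<Rightarrow> int) \<Rightarrow> nat \<Rightarrow> int" where
  "sig \<equiv> sigma I C"

lemma cs: "cartan_scheme I A \<rho> C"
  using rs by (simp add: root_system_def)

lemma finI: "finite I"
  using cs unfolding cartan_scheme_def by blast

lemma rho_in [simp]: "i \<in> I \<Longrightarrow> a \<in> A \<Longrightarrow> \<rho> i a \<in> A"
  using cs unfolding cartan_scheme_def by blast

lemma rho_rho [simp]: "i \<in> I \<Longrightarrow> a \<in> A \<Longrightarrow> \<rho> i (\<rho> i a) = a"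
  using cs unfolding cartan_scheme_def by blast

lemma gcm: "a \<in> A \<Longrightarrow> gcm I (C a)"
  using cs unfolding cartan_scheme_def by blast

lemma C_diag: "i \<in> I \<Longrightarrow> a \<in> A \<Longrightarrow> C a i i = 2"
  using gcm unfolding gcm_def by blast

lemma C_rho: "i \<in> I \<Longrightarrow> j \<in> I \<Longrightarrow> a \<in> A \<Longrightarrow> C (\<rho> i a) i j = C a i j"
  using cs unfolding cartan_scheme_def by metis

lemma n_rho: "i \<in> I \<Longrightarrow> j \<in> I \<Longrightarrow> a \<in> A \<Longrightarrow> n (\<rho> i a) i j = n a i j"
  by (simp add: n_def C_rho)

lemma n_nonneg: "i \<in> I \<Longrightarrow> j \<in> I \<Longrightarrow> a \<in> A \<Longrightarrow> i \<noteq> j \<Longrightarrow> 0 \<le> n a i j"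
  using gcm unfolding gcm_def n_def by force

lemma n_zero_sym: "i \<in> I \<Longrightarrow> j \<in> I \<Longrightarrow> a \<in> A \<Longrightarrow> n a i j = 0 \<Longrightarrow> n a j i = 0"
  using gcm unfolding gcm_def n_def by force

lemma R_supp: "a \<in> A \<Longrightarrow> v \<in> R a \<Longrightarrow> k \<notin> I \<Longrightarrow> v k = 0"
  using rs by (auto simp: root_system_def supp_in_def)

lemma R_pos_neg: "a \<in> A \<Longrightarrow> R a = pos_part (R a) \<union> (\<lambda>v k. - v k) ` pos_part (R a)"
  using rs by (simp add: root_system_def)

lemma R_sign:
  assumes "a \<in> A" "v \<in> R a"
  shows "(\<forall>k. 0 \<le> v k) \<or> (\<forall>k. v k \<le> 0)"
proof -
  have "v \<in> pos_part (R a) \<union> (\<lambda>v k. - v k) ` pos_part (R a)"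
    using assms R_pos_neg by blast
  then show ?thesis by (auto simp: pos_part_def)
qed

lemma R_uminus:
  assumes "a \<in> A" "v \<in> R a"
  shows "(\<lambda>k. - v k) \<in> R a"
proof -
  have "v \<in> pos_part (R a) \<union> (\<lambda>v k. - v k) ` pos_part (R a)"
    using assms R_pos_neg by blast
  then consider "v \<in> pos_part (R a)" | w where "w \<in> pos_part (R a)" "v = (\<lambda>k. - w k)"
    by blast
  then show ?thesis
  proof cases
    case 1
    then show ?thesis using R_pos_neg[OF assms(1)] by blast
  next
    case 2
    then show ?thesis by (simp add: pos_part_def)
  qed
qed

lemma R_multiples:
  "a \<in> A \<Longrightarrow> i \<in> I \<Longrightarrow> R a \<inter> {v. \<exists>m::int. v = (\<lambda>k. m * alpha i k)} = {alpha i, (\<lambda>k. - alpha i k)}"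
  using rs by (simp add: root_system_def)

lemma alpha_in [simp]: "a \<in> A \<Longrightarrow> i \<in> I \<Longrightarrow> alpha i \<in> R a"
  using R_multiples by blast

lemma R_simple:
  assumes "a \<in> A" "i \<in> I" "v \<in> R a" "\<And>k. k \<noteq> i \<Longrightarrow> v k = 0"
  shows "v = alpha i \<or> v = (\<lambda>k. - alpha i k)"
proof -
  have "v = (\<lambda>k. v i * alpha i k)" using assms(4) by (auto simp: alpha_def)
  then have "v \<in> R a \<inter> {v. \<exists>m::int. v = (\<lambda>k. m * alpha i k)}" using assms(3) by blast
  then show ?thesis using R_multiples[OF assms(1,2)] by blast
qed

text \<open>The zero vector is a multiple of a simple root, and (R2) admits only the multiples 1 and
  -1.\<close>

lemma R_nonzero:
  assumes "a \<in> A" "v \<in> R a"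
  shows "\<exists>k\<in>I. v k \<noteq> 0"
proof (rule ccontr)
  assume "\<not> ?thesis"
  then have z: "v k = 0" for k using R_supp[OF assms] by blast
  obtain i where "i \<in> I" using cs unfolding cartan_scheme_def by blast
  then have "v = alpha i \<or> v = (\<lambda>k. - alpha i k)" using R_simple assms z by blast
  then have "v i \<noteq> 0" by (auto simp: alpha_def)
  then show False using z by blast
qed

lemma sig_image: "a \<in> A \<Longrightarrow> i \<in> I \<Longrightarrow> sig a i ` R a = R (\<rho> i a)"
  using rs by (simp add: root_system_def)

lemma sig_in [simp]: "a \<in> A \<Longrightarrow> i \<in> I \<Longrightarrow> v \<in> R a \<Longrightarrow> sig a i v \<in> R (\<rho> i a)"
  using sig_image by blast

lemma sig_other [simp]: "k \<noteq> i \<Longrightarrow> sig a i v k = v k"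
  by (simp add: sigma_def)

lemma sig_split:
  assumes "a \<in> A" "i \<in> I"
  shows "sig a i v i = - v i + (\<Sum>j\<in>I - {i}. n a i j * v j)"
proof -
  have "(\<Sum>j\<in>I. C a i j * v j) = 2 * v i + (\<Sum>j\<in>I - {i}. C a i j * v j)"
    using assms by (simp add: sum.remove[OF finI assms(2)] C_diag)
  then show ?thesis by (simp add: sigma_def n_def sum_negf)
qed

lemma sig_supp:
  assumes "a \<in> A" "i \<in> J" "J \<subseteq> I" "v \<in> supp_in J"
  shows "sig a i v i = - v i + (\<Sum>j\<in>J - {i}. n a i j * v j)"
proof -
  have "(\<Sum>j\<in>I - {i}. n a i j * v j) = (\<Sum>j\<in>J - {i}. n a i j * v j)"
    using assms finI by (intro sum.mono_neutral_right) (auto simp: supp_in_def)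
  then show ?thesis using sig_split assms by auto
qed

lemma sig_supp_in: "i \<in> J \<Longrightarrow> v \<in> supp_in J \<Longrightarrow> sig a i v \<in> supp_in J"
  by (auto simp: supp_in_def sigma_def)

lemma sig_sig [simp]:
  assumes "a \<in> A" "i \<in> I"
  shows "sig (\<rho> i a) i (sig a i v) = v"
proof
  fix k
  show "sig (\<rho> i a) i (sig a i v) k = v k"
  proof (cases "k = i")
    case True
    have "(\<Sum>j\<in>I - {i}. n (\<rho> i a) i j * sig a i v j) = (\<Sum>j\<in>I - {i}. n a i j * v j)"
      using assms by (intro sum.cong) (auto simp: n_rho)
    then have "sig (\<rho> i a) i (sig a i v) i = v i"
      using sig_split[of "\<rho> i a" i "sig a i v"] sig_split[of a i v] assms by simp
    then show ?thesis using True by simp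
  qed simp
qed

lemma sig_alpha:
  assumes "a \<in> A" "i \<in> I"
  shows "sig a i (alpha i) = (\<lambda>k. - alpha i k)"
proof
  fix k
  have "(\<Sum>j\<in>I - {i}. n a i j * alpha i j) = 0"
    by (rule sum.neutral) (simp add: alpha_def)
  then have 1: "sig a i (alpha i) i = - alpha i i"
    using sig_split[OF assms, of "alpha i"] by linarith
  show "sig a i (alpha i) k = - alpha i k"
  proof (cases "k = i")
    case True
    then show ?thesis using 1 by metis
  next
    case False
    then have "alpha i k = 0" by (simp add: alpha_def)
    then show ?thesis using sig_other[OF False, of a "alpha i"] by linarith
  qed
qed

text \<open>A reflection changes a single coordinate; a positive one elsewhere survives, and by (R1)
  it decides the sign of the whole image.\<close>

lemma sig_pos:
  assumes "a \<in> A" "i \<in> I" "v \<in> R a" "k \<noteq> i" "0 < v k"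
  shows "0 \<le> sig a i v l"
proof -
  have "sig a i v k > 0" using assms by simp
  then show ?thesis using R_sign[of "\<rho> i a" "sig a i v"] assms(1-3)
    by (metis leD rho_in sig_in)
qed

definition pos :: "nat set \<Rightarrow> 'a \<Rightarrow> (nat \<Rightarrow> int) set" where
  "pos J a = {v \<in> R a \<inter> supp_in J. \<forall>k. 0 \<le> v k}"

definition d :: "nat set \<Rightarrow> 'a \<Rightarrow> nat \<Rightarrow> int" where
  "d J a k = (\<Sum>v\<in>pos J a. v k)"

lemma pos_finite: "a \<in> A \<Longrightarrow> finite (pos J a)"
  using fin by (auto simp: pos_def rs_finite_def)

lemma alpha_pos: "a \<in> A \<Longrightarrow> i \<in> J \<Longrightarrow> J \<subseteq> I \<Longrightarrow> alpha i \<in> pos J a"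
  by (auto simp: pos_def supp_in_def alpha_def[abs_def] intro: alpha_in[unfolded alpha_def[abs_def]])

lemma pos_non_simple:
  assumes "a \<in> A" "i \<in> I" "v \<in> pos J a" "v \<noteq> alpha i"
  shows "\<exists>k. k \<noteq> i \<and> 0 < v k"
proof (rule ccontr)
  assume c: "\<not> ?thesis"
  have v: "v \<in> R a" "\<And>k. 0 \<le> v k" using assms by (auto simp: pos_def)
  have "v k = 0" if "k \<noteq> i" for k using c v(2)[of k] that by force
  then have "v = alpha i \<or> v = (\<lambda>k. - alpha i k)" using R_simple assms v by blast
  then have "v i = -1" using assms(4) by (auto simp: alpha_def)
  then show False using v(2)[of i] by simp
qed

lemma sig_pos_set:
  assumes "a \<in> A" "i \<in> J" "J \<subseteq> I" "v \<in> pos J a - {alpha i}"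
  shows "sig a i v \<in> pos J (\<rho> i a) - {alpha i}"
proof -
  have iI: "i \<in> I" using assms by blast
  obtain k where k: "k \<noteq> i" "0 < v k" using pos_non_simple[OF assms(1) iI] assms(4) by blast
  have v: "v \<in> R a" "v \<in> supp_in J" using assms(4) by (simp_all add: pos_def)
  have "sig a i v k \<noteq> alpha i k" using k by (simp add: alpha_def)
  then have "sig a i v \<noteq> alpha i" by metis
  moreover have "sig a i v \<in> supp_in J" using sig_supp_in v assms by blast
  moreover have "\<forall>l. 0 \<le> sig a i v l" using sig_pos[OF assms(1) iI v(1) k] by blast
  ultimately show ?thesis
    using v iI assms(1) by (simp add: pos_def)
qed

lemma sig_bij:
  assumes "a \<in> A" "i \<in> J" "J \<subseteq> I"
  shows "bij_betw (sig a i) (pos J a - {alpha i}) (pos J (\<rho> i a) - {alpha i})"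
proof -
  have iI: "i \<in> I" using assms by blast
  show ?thesis
  proof (rule bij_betw_byWitness[where f' = "sig (\<rho> i a) i"])
    show "\<forall>v\<in>pos J a - {alpha i}. sig (\<rho> i a) i (sig a i v) = v" using assms iI by simp
    show "\<forall>v\<in>pos J (\<rho> i a) - {alpha i}. sig a i (sig (\<rho> i a) i v) = v"
      using sig_sig[of "\<rho> i a" i] assms iI by simp
    show "sig a i ` (pos J a - {alpha i}) \<subseteq> pos J (\<rho> i a) - {alpha i}"
      by (rule image_subsetI) (rule sig_pos_set[OF assms])
    show "sig (\<rho> i a) i ` (pos J (\<rho> i a) - {alpha i}) \<subseteq> pos J a - {alpha i}"
    proof (rule image_subsetI)
      fix v assume "v \<in> pos J (\<rho> i a) - {alpha i}"
      then show "sig (\<rho> i a) i v \<in> pos J a - {alpha i}"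
        using sig_pos_set[of "\<rho> i a" i J v] assms iI by simp
    qed
  qed
qed

lemma d_remove:
  assumes "a \<in> A" "i \<in> J" "J \<subseteq> I"
  shows "(\<Sum>v\<in>pos J a - {alpha i}. v k) = d J a k - alpha i k"
  by (simp add: d_def sum.remove[OF pos_finite alpha_pos[OF assms]] assms(1))

lemma d_other:
  assumes "a \<in> A" "i \<in> J" "J \<subseteq> I" "k \<noteq> i"
  shows "d J (\<rho> i a) k = d J a k"
proof -
  have iI: "i \<in> I" using assms by blast
  have "d J (\<rho> i a) k - alpha i k = (\<Sum>v\<in>pos J a - {alpha i}. sig a i v k)"
    using d_remove[of "\<rho> i a" i J k] sum.reindex_bij_betw[OF sig_bij[OF assms(1-3)], of "\<lambda>v. v k"] assms iI
    by simp
  also have "\<dots> = d J a k - alpha i k" using assms d_remove[OF assms(1-3)] by simp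
  finally show ?thesis by simp
qed

text \<open>The reflection permutes the positive roots other than \<open>\<alpha>\<^sub>i\<close>, so it maps their
  sum at \<open>a\<close> to the one at \<open>\<rho>\<^sub>i(a)\<close>.\<close>
lemma d_eq:
  assumes "a \<in> A" "i \<in> J" "J \<subseteq> I"
  shows "d J a i + d J (\<rho> i a) i = 2 + (\<Sum>j\<in>J - {i}. n a i j * d J a j)"
proof -
  have iI: "i \<in> I" using assms by blast
  let ?P = "pos J a - {alpha i}"
  have "d J (\<rho> i a) i - 1 = (\<Sum>v\<in>?P. sig a i v i)"
    using d_remove[of "\<rho> i a" i J i] sum.reindex_bij_betw[OF sig_bij[OF assms(1-3)], of "\<lambda>v. v i"] assms iI
    by (simp add: alpha_def)
  also have "\<dots> = (\<Sum>v\<in>?P. - v i + (\<Sum>j\<in>J - {i}. n a i j * v j))"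
    by (rule sum.cong[OF refl], rule sig_supp) (use assms in \<open>auto simp: pos_def\<close>)
  also have "\<dots> = - (\<Sum>v\<in>?P. v i) + (\<Sum>j\<in>J - {i}. n a i j * (\<Sum>v\<in>?P. v j))"
    by (simp only: sum.distrib sum_negf sum_distrib_left sum.swap[of _ "J - {i}" ?P])
  also have "(\<Sum>j\<in>J - {i}. n a i j * (\<Sum>v\<in>?P. v j)) = (\<Sum>j\<in>J - {i}. n a i j * d J a j)"
    by (rule sum.cong[OF refl]) (use d_remove[OF assms] in \<open>simp add: alpha_def\<close>)
  finally show ?thesis using d_remove[OF assms, of i] by (simp add: alpha_def)
qed

lemma d_pos:
  assumes "a \<in> A" "k \<in> J" "J \<subseteq> I"
  shows "1 \<le> d J a k"
proof -
  have "alpha k k \<le> (\<Sum>v\<in>pos J a. v k)"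
    by (rule member_le_sum[OF alpha_pos[OF assms] _ pos_finite[OF assms(1)]]) (simp add: pos_def)
  then show ?thesis by (simp add: d_def alpha_def)
qed

text \<open>If \<open>k\<close> is isolated in \<open>J\<close>, then \<open>\<sigma>\<^sub>k\<close> only changes the sign of the \<open>k\<close>-th
  coordinate, so no root with support in \<open>J\<close> can mix \<open>\<alpha>\<^sub>k\<close> with other simple roots.\<close>
lemma isolated_split:
  assumes "a \<in> A" "k \<in> J" "J \<subseteq> I" "\<And>j. j \<in> J \<Longrightarrow> j \<noteq> k \<Longrightarrow> n a k j = 0"
    and "v \<in> R a" "v \<in> supp_in J" "v k \<noteq> 0" "l \<noteq> k"
  shows "v l = 0"
proof (rule ccontr)
  assume l: "v l \<noteq> 0"
  have kI: "k \<in> I" using assms by blast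
  have "sig a k v k = - v k"
    using sig_supp[OF assms(1-3,6)] assms(4) by simp
  moreover have "sig a k v l = v l" using assms by simp
  moreover have "(\<forall>m. 0 \<le> sig a k v m) \<or> (\<forall>m. sig a k v m \<le> 0)"
    using R_sign[of "\<rho> k a"] assms kI by auto
  moreover have "(\<forall>m. 0 \<le> v m) \<or> (\<forall>m. v m \<le> 0)" using R_sign assms by blast
  ultimately show False using l assms(7) by (smt (verit))
qed

text \<open>At \<open>\<rho> m a\<close> the root obtained from \<open>alpha j\<close> by the
  reflection in \<open>k\<close> has \<open>n (\<rho> m a) k j\<close> as \<open>k\<close>-th
  coordinate. Its pullback \<open>w\<close> to \<open>a\<close> keeps this coordinate, and
  \<open>w\<close> cannot be supported on \<open>k\<close> alone: the reflection in \<open>m\<close>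
  would fix it, losing the \<open>j\<close>-th coordinate 1. So \<open>isolated_split\<close> at
  \<open>a\<close> makes the coordinate vanish.\<close>

lemma isolated_step:
  assumes a: "a \<in> A" and k: "k \<in> J" and J: "J \<subseteq> I"
    and iso: "\<And>j. j \<in> J \<Longrightarrow> j \<noteq> k \<Longrightarrow> n a k j = 0"
    and m: "m \<in> J" and j: "j \<in> J" "j \<noteq> k"
  shows "n (\<rho> m a) k j = 0"
proof (cases "m = k")
  case True
  then show ?thesis using assms n_rho[of k j a] by auto
next
  case False
  let ?b = "\<rho> m a"
  have I: "k \<in> I" "m \<in> I" "j \<in> I" using assms by auto
  have b: "?b \<in> A" using a I by simp
  define w where "w = sig ?b m (sig (\<rho> k ?b) k (alpha j))"
  have aj: "alpha j \<in> R (\<rho> k ?b)" "alpha j \<in> supp_in J"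
    using b I j by simp (use j in \<open>auto simp: supp_in_def alpha_def\<close>)
  then have w1: "sig (\<rho> k ?b) k (alpha j) \<in> R ?b" using sig_in[of "\<rho> k ?b" k "alpha j"] b I by simp
  have "w \<in> R a" using sig_in[OF b I(2) w1] a I by (simp add: w_def)
  moreover have "w \<in> supp_in J" using aj m k by (simp add: w_def sig_supp_in)
  moreover have wk: "w k = n ?b k j"
  proof -
    have "w k = sig (\<rho> k ?b) k (alpha j) k" using False by (simp add: w_def)
    also have "\<dots> = (\<Sum>i\<in>J - {k}. n (\<rho> k ?b) k i * alpha j i)"
      using sig_supp[of "\<rho> k ?b" k J "alpha j"] aj b I J k j by (simp add: alpha_def)
    also have "\<dots> = (\<Sum>i\<in>J - {k}. if i = j then n (\<rho> k ?b) k j else 0)"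
      by (intro sum.cong) (auto simp: alpha_def)
    also have "\<dots> = n (\<rho> k ?b) k j"
      using j finite_subset[OF J finI] by (simp add: sum.delta)
    finally show ?thesis using n_rho b I by simp
  qed
  moreover have "\<exists>l. l \<noteq> k \<and> w l \<noteq> 0"
  proof (rule ccontr)
    assume "\<not> ?thesis"
    then have z: "w l = 0" if "l \<noteq> k" for l using that by blast
    have nm: "n a m k = 0" using iso[of m] m False n_zero_sym[OF I(1,2) a] by blast
    have "(\<Sum>i\<in>I - {m}. n a m i * w i) = 0"
    proof (intro sum.neutral ballI)
      fix i assume "i \<in> I - {m}"
      show "n a m i * w i = 0" using nm z[of i] by (cases "i = k") auto
    qed
    then have "sig a m w m = w m" using sig_split[OF a I(2), of w] z[of m] False by simp
    then have "sig a m w i = w i" for i by (cases "i = m") simp_all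
    moreover have "sig a m w = sig (\<rho> k ?b) k (alpha j)"
      using sig_sig[OF b I(2), of "sig (\<rho> k ?b) k (alpha j)"] a I by (simp add: w_def)
    ultimately have "w j = alpha j j" using sig_other[OF j(2), of "\<rho> k ?b" "alpha j"] by simp
    then show False using z j by (simp add: alpha_def)
  qed
  ultimately show ?thesis using isolated_split[OF a k J iso] by metis
qed

section \<open>Rank two\<close>

definition vec :: "nat \<Rightarrow> nat \<Rightarrow> int \<Rightarrow> int \<Rightarrow> nat \<Rightarrow> int" where
  "vec i j s t = (\<lambda>k. if k = i then s else if k = j then t else 0)"

lemma vec_swap: "i \<noteq> j \<Longrightarrow> vec i j s t = vec j i t s"
  by (auto simp: vec_def)

lemma vec_eq_iff [simp]: "i \<noteq> j \<Longrightarrow> vec i j s t = vec i j s' t' \<longleftrightarrow> s = s' \<and> t = t'"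
  by (auto simp: vec_def fun_eq_iff)

lemma sig_vec:
  assumes "a \<in> A" "i \<in> I" "j \<in> I" "i \<noteq> j"
  shows "sig a i (vec i j s t) = vec i j (n a i j * t - s) t"
proof
  fix k
  have "(\<Sum>l\<in>I - {i}. n a i l * vec i j s t l) = (\<Sum>l\<in>I - {i}. if l = j then n a i j * t else 0)"
    by (rule sum.cong) (auto simp: vec_def)
  also have "\<dots> = n a i j * t"
    using assms finI by simp
  finally have 1: "sig a i (vec i j s t) i = n a i j * t - s"
    using sig_split[OF assms(1,2), of "vec i j s t"] by (simp add: vec_def)
  show "sig a i (vec i j s t) k = vec i j (n a i j * t - s) t k"
  proof (cases "k = i")
    case True
    then show ?thesis using 1 by (simp add: vec_def)
  next
    case False
    then show ?thesis by (simp add: vec_def)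
  qed
qed

definition rt :: "'a \<Rightarrow> nat \<Rightarrow> nat \<Rightarrow> int \<Rightarrow> int \<Rightarrow> bool" where
  "rt a i j s t \<longleftrightarrow> vec i j s t \<in> R a"

lemma rt_swap: "i \<noteq> j \<Longrightarrow> rt a i j s t \<longleftrightarrow> rt a j i t s"
  using vec_swap[of i j s t] by (simp add: rt_def)

lemma rt_step1:
  assumes "a \<in> A" "i \<in> I" "j \<in> I" "i \<noteq> j" "rt a i j s t"
  shows "rt (\<rho> i a) i j (n a i j * t - s) t"
  using assms sig_in[of a i "vec i j s t"] by (simp add: rt_def sig_vec)

lemma rt_step2:
  assumes "a \<in> A" "i \<in> I" "j \<in> I" "i \<noteq> j" "rt a i j s t"
  shows "rt (\<rho> j a) i j s (n a j i * s - t)"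
  using assms rt_step1[of a j i t s] by (simp add: rt_swap)

lemma rt_sign:
  assumes "a \<in> A" "i \<noteq> j" "rt a i j s t"
  shows "(0 \<le> s \<and> 0 \<le> t) \<or> (s \<le> 0 \<and> t \<le> 0)"
proof -
  have "(\<forall>k. 0 \<le> vec i j s t k) \<or> (\<forall>k. vec i j s t k \<le> 0)"
    using R_sign assms by (simp add: rt_def)
  moreover have "vec i j s t i = s" "vec i j s t j = t" using assms by (simp_all add: vec_def)
  ultimately show ?thesis by metis
qed

lemma rt_10: "a \<in> A \<Longrightarrow> i \<in> I \<Longrightarrow> rt a i j 1 0"
proof -
  assume "a \<in> A" "i \<in> I"
  moreover have "vec i j 1 0 = alpha i" by (auto simp: vec_def alpha_def)
  ultimately show ?thesis by (simp add: rt_def)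
qed

lemma rt_01: "a \<in> A \<Longrightarrow> i \<noteq> j \<Longrightarrow> j \<in> I \<Longrightarrow> rt a i j 0 1"
  using rt_10[of a j i] by (simp add: rt_swap)

lemma rt_axis1:
  assumes "a \<in> A" "i \<in> I" "rt a i j s 0" "0 \<le> s"
  shows "s = 1"
proof -
  have "vec i j s 0 = alpha i \<or> vec i j s 0 = (\<lambda>k. - alpha i k)"
    using assms by (intro R_simple[of a]) (auto simp: rt_def vec_def)
  then have "vec i j s 0 i = alpha i i \<or> vec i j s 0 i = - alpha i i" by metis
  then show ?thesis using assms(4) by (auto simp: vec_def alpha_def)
qed

lemma rt_axis2: "a \<in> A \<Longrightarrow> j \<in> I \<Longrightarrow> i \<noteq> j \<Longrightarrow> rt a i j 0 t \<Longrightarrow> 0 \<le> t \<Longrightarrow> t = 1"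
  using rt_axis1[of a j i t] by (simp add: rt_swap)

lemma cone2_roots:
  assumes "i \<noteq> j"
  shows "R a \<inter> cone2 i j = (\<lambda>(s, t). vec i j s t) ` {(s, t). 0 \<le> s \<and> 0 \<le> t \<and> rt a i j s t}"
proof (intro equalityI subsetI)
  fix v assume v: "v \<in> R a \<inter> cone2 i j"
  then have "v = vec i j (v i) (v j)" by (auto simp: cone2_def vec_def)
  moreover have "0 \<le> v i" "0 \<le> v j" using v by (simp_all add: cone2_def)
  ultimately show "v \<in> (\<lambda>(s, t). vec i j s t) ` {(s, t). 0 \<le> s \<and> 0 \<le> t \<and> rt a i j s t}"
    using v by (intro image_eqI[of _ _ "(v i, v j)"]) (auto simp: rt_def)
next
  fix v assume "v \<in> (\<lambda>(s, t). vec i j s t) ` {(s, t). 0 \<le> s \<and> 0 \<le> t \<and> rt a i j s t}"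
  then show "v \<in> R a \<inter> cone2 i j" using assms by (auto simp: rt_def vec_def cone2_def)
qed

lemma pos_cone2: "pos {i, j} a = R a \<inter> cone2 i j"
proof (intro equalityI subsetI)
  fix v assume "v \<in> R a \<inter> cone2 i j"
  then have v: "v \<in> R a" "\<And>k. k \<noteq> i \<Longrightarrow> k \<noteq> j \<Longrightarrow> v k = 0" "0 \<le> v i" "0 \<le> v j"
    by (auto simp: cone2_def)
  then have "0 \<le> v k" for k by (cases "k = i \<or> k = j") auto
  then show "v \<in> pos {i, j} a" using v by (simp add: pos_def supp_in_def)
qed (auto simp: pos_def supp_in_def cone2_def)

text \<open>(R4) counts the roots in a cone; listing them as pairs turns it into an explicit
  relation between \<open>\<rho> i\<close> and \<open>\<rho> j\<close>, and yields the values of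
  \<open>d\<close> as well.\<close>

lemma rank2_roots:
  assumes "a \<in> A" "i \<in> I" "j \<in> I" "i \<noteq> j"
    and "\<And>s t. 0 \<le> s \<Longrightarrow> 0 \<le> t \<Longrightarrow> rt a i j s t \<longleftrightarrow> (s, t) \<in> S"
    and "\<forall>(s, t)\<in>S. 0 \<le> s \<and> 0 \<le> t"
  shows "card (R a \<inter> cone2 i j) = card S" "d {i, j} a i = sum fst S" "d {i, j} a j = sum snd S"
    "((\<rho> i \<circ> \<rho> j) ^^ card S) a = a"
proof -
  have "{(s, t). 0 \<le> s \<and> 0 \<le> t \<and> rt a i j s t} = S" using assms(5,6) by auto
  then have 1: "R a \<inter> cone2 i j = (\<lambda>(s, t). vec i j s t) ` S" using cone2_roots[OF assms(4)] by simp
  have inj: "inj_on (\<lambda>(s, t). vec i j s t) S" using assms(4) by (auto simp: inj_on_def)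
  show c: "card (R a \<inter> cone2 i j) = card S" using 1 card_image[OF inj] by simp
  have i: "(\<lambda>(s, t). vec i j s t) p i = fst p" and j: "(\<lambda>(s, t). vec i j s t) p j = snd p" for p
    using assms(4) by (auto simp: vec_def split: prod.split)
  show "d {i, j} a i = sum fst S" "d {i, j} a j = sum snd S"
    by (simp_all only: d_def pos_cone2 1 sum.reindex[OF inj] o_def i j)
  have "finite (R a \<inter> cone2 i j)" using fin assms(1) by (simp add: rs_finite_def)
  then have "((\<rho> i \<circ> \<rho> j) ^^ card (R a \<inter> cone2 i j)) a = a"
    using rs assms(1-4) unfolding root_system_def by blast
  then show "((\<rho> i \<circ> \<rho> j) ^^ card S) a = a" by (simp add: c)
qed

lemma rank2_A1A1:
  assumes "a \<in> A" "i \<in> I" "j \<in> I" "i \<noteq> j" "n a i j = 0"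
  shows "\<rho> i (\<rho> j (\<rho> i (\<rho> j a))) = a"
proof -
  let ?S = "{(1, 0), (0, 1)} :: (int \<times> int) set"
  have "rt a i j s t \<longleftrightarrow> (s, t) \<in> ?S" if st: "0 \<le> s" "0 \<le> t" for s t
  proof
    assume r: "rt a i j s t"
    have "rt (\<rho> i a) i j (- s) t" using rt_step1[OF assms(1-4) r] assms(5) by simp
    then have "s = 0 \<or> t = 0" using rt_sign[of "\<rho> i a" i j "- s" t] assms st by auto
    then show "(s, t) \<in> ?S" using rt_axis1[of a i j s] rt_axis2[of a j i t] assms st r by auto
  next
    assume "(s, t) \<in> ?S"
    then show "rt a i j s t" using rt_10 rt_01 assms by auto
  qed
  from rank2_roots(4)[OF assms(1-4) this] show ?thesis by (auto simp: numeral_eq_Suc)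
qed

text \<open>A candidate \<open>(s, t)\<close> is reflected once in \<open>i\<close> and once in
  \<open>j\<close>. The common sign demanded by (R1) leaves the two axes and the diagonal, and (R2)
  leaves one root on each of these rays.\<close>

lemma rank2_A2:
  assumes "a \<in> A" "i \<in> I" "j \<in> I" "i \<noteq> j" "n a i j = 1" "n a j i = 1"
  shows "\<rho> i (\<rho> j (\<rho> i (\<rho> j (\<rho> i (\<rho> j a))))) = a"
proof -
  let ?S = "{(1, 0), (0, 1), (1, 1)} :: (int \<times> int) set"
  have "rt a i j s t \<longleftrightarrow> (s, t) \<in> ?S" if st: "0 \<le> s" "0 \<le> t" for s t
  proof
    assume r: "rt a i j s t"
    have 1: "rt (\<rho> i a) i j (t - s) t" using rt_step1[OF assms(1-4) r] assms(5) by simp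
    have 2: "rt (\<rho> j a) i j s (s - t)" using rt_step2[OF assms(1-4) r] assms(6) by simp
    have "t = 0 \<or> s \<le> t" using rt_sign[of "\<rho> i a" i j "t - s" t] 1 assms st by auto
    moreover have "s = 0 \<or> t \<le> s" using rt_sign[of "\<rho> j a" i j s "s - t"] 2 assms st by auto
    ultimately consider "t = 0" | "s = 0" | "s = t" by linarith
    then show "(s, t) \<in> ?S"
    proof cases
      case 3
      then have "t = 1" using rt_axis2[of "\<rho> i a" j i t] 1 assms st by auto
      then show ?thesis using 3 by simp
    qed (use rt_axis1[of a i j s] rt_axis2[of a j i t] assms st r in auto)
  next
    assume "(s, t) \<in> ?S"
    moreover have "rt a i j 1 1"
      using rt_step1[of "\<rho> i a" i j 0 1] rt_01[of "\<rho> i a" i j] assms by (simp add: n_rho)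
    ultimately show "rt a i j s t" using rt_10 rt_01 assms by auto
  qed
  from rank2_roots(4)[OF assms(1-4) this] show ?thesis by (auto simp: numeral_eq_Suc)
qed

text \<open>As \<open>\<rho> j a = a\<close>, the entries at \<open>a\<close> may be used again
  after a reflection in \<open>j\<close>. The further reflection in \<open>i\<close> excludes the
  directions strictly between \<open>(1, 1)\<close> and \<open>(1, 2)\<close>.\<close>

lemma rank2_B2:
  assumes "a \<in> A" "i \<in> I" "j \<in> I" "i \<noteq> j" "n a i j = 1" "n a j i = 2" "\<rho> j a = a"
  shows "\<rho> i (\<rho> j (\<rho> i (\<rho> j (\<rho> i (\<rho> j (\<rho> i (\<rho> j a))))))) = a" "d {i, j} a i = 3" "d {i, j} a j = 4"
proof -
  let ?S = "{(1, 0), (0, 1), (1, 1), (1, 2)} :: (int \<times> int) set"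
  have "rt a i j s t \<longleftrightarrow> (s, t) \<in> ?S" if st: "0 \<le> s" "0 \<le> t" for s t
  proof
    assume r: "rt a i j s t"
    have 1: "rt (\<rho> i a) i j (t - s) t" using rt_step1[OF assms(1-4) r] assms(5) by simp
    have 2: "rt a i j s (2 * s - t)" using rt_step2[OF assms(1-4) r] assms(6,7) by simp
    have 3: "rt (\<rho> i a) i j (s - t) (2 * s - t)" using rt_step1[OF assms(1-4) 2] assms(5) by simp
    have "t = 0 \<or> s \<le> t" using rt_sign[of "\<rho> i a" i j "t - s" t] 1 assms st by auto
    moreover have "s = 0 \<or> t \<le> 2 * s" using rt_sign[of a i j s "2 * s - t"] 2 assms st by auto
    moreover have "t \<le> s \<or> 2 * s \<le> t" using rt_sign[of "\<rho> i a" i j "s - t" "2 * s - t"] 3 assms st by auto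
    ultimately consider "t = 0" | "s = 0" | "s = t" | "t = 2 * s" by linarith
    then show "(s, t) \<in> ?S"
    proof cases
      case 3
      then have "t = 1" using rt_axis2[of "\<rho> i a" j i t] 1 assms st by auto
      then show ?thesis using 3 by simp
    next
      case 4
      then have "s = 1" using rt_axis1[of a i j s] 2 assms st by auto
      then show ?thesis using 4 by simp
    qed (use rt_axis1[of a i j s] rt_axis2[of a j i t] assms st r in auto)
  next
    assume "(s, t) \<in> ?S"
    moreover have "rt a i j 1 1"
      using rt_step1[of "\<rho> i a" i j 0 1] rt_01[of "\<rho> i a" i j] assms by (simp add: n_rho)
    moreover have "rt a i j 1 2"
      using rt_step2[of a i j 1 0] rt_10[of a i j] assms by simp
    ultimately show "rt a i j s t" using rt_10 rt_01 assms by auto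
  qed
  note * = rank2_roots[OF assms(1-4) this]
  show "\<rho> i (\<rho> j (\<rho> i (\<rho> j (\<rho> i (\<rho> j (\<rho> i (\<rho> j a))))))) = a" using *(4) by (auto simp: numeral_eq_Suc)
  show "d {i, j} a i = 3" using *(2) by auto
  show "d {i, j} a j = 4" using *(3) by auto
qed

text \<open>This is not \<open>rank2_B2\<close> with \<open>i\<close> and \<open>j\<close>
  exchanged: the index \<open>j\<close> fixing \<open>a\<close> now sits at the other end of the
  double bond.\<close>

lemma rank2_C2:
  assumes "a \<in> A" "i \<in> I" "j \<in> I" "i \<noteq> j" "n a i j = 2" "n a j i = 1" "\<rho> j a = a"
  shows "\<rho> i (\<rho> j (\<rho> i (\<rho> j (\<rho> i (\<rho> j (\<rho> i (\<rho> j a))))))) = a" "d {i, j} a i = 4" "d {i, j} a j = 3"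
proof -
  let ?S = "{(1, 0), (0, 1), (1, 1), (2, 1)} :: (int \<times> int) set"
  have "rt a i j s t \<longleftrightarrow> (s, t) \<in> ?S" if st: "0 \<le> s" "0 \<le> t" for s t
  proof
    assume r: "rt a i j s t"
    have 1: "rt (\<rho> i a) i j (2 * t - s) t" using rt_step1[OF assms(1-4) r] assms(5) by simp
    have 2: "rt a i j s (s - t)" using rt_step2[OF assms(1-4) r] assms(6,7) by simp
    have 3: "rt (\<rho> i a) i j (s - 2 * t) (s - t)" using rt_step1[OF assms(1-4) 2] assms(5) by (simp add: algebra_simps)
    have "t = 0 \<or> s \<le> 2 * t" using rt_sign[of "\<rho> i a" i j "2 * t - s" t] 1 assms st by auto
    moreover have "s = 0 \<or> t \<le> s" using rt_sign[of a i j s "s - t"] 2 assms st by auto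
    moreover have "2 * t \<le> s \<or> s \<le> t" using rt_sign[of "\<rho> i a" i j "s - 2 * t" "s - t"] 3 assms st by auto
    ultimately consider "t = 0" | "s = 0" | "s = t" | "s = 2 * t" by linarith
    then show "(s, t) \<in> ?S"
    proof cases
      case 3
      then have "s = 1" using rt_axis1[of a i j s] 2 assms st by auto
      then show ?thesis using 3 by simp
    next
      case 4
      then have "t = 1" using rt_axis2[of "\<rho> i a" j i t] 1 assms st by auto
      then show ?thesis using 4 by simp
    qed (use rt_axis1[of a i j s] rt_axis2[of a j i t] assms st r in auto)
  next
    assume "(s, t) \<in> ?S"
    moreover have "rt a i j 1 1"
      using rt_step2[of a i j 1 0] rt_10[of a i j] assms by simp
    moreover have "rt a i j 2 1"
      using rt_step1[of "\<rho> i a" i j 0 1] rt_01[of "\<rho> i a" i j] assms by (simp add: n_rho)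
    ultimately show "rt a i j s t" using rt_10 rt_01 assms by auto
  qed
  note * = rank2_roots[OF assms(1-4) this]
  show "\<rho> i (\<rho> j (\<rho> i (\<rho> j (\<rho> i (\<rho> j (\<rho> i (\<rho> j a))))))) = a" using *(4) by (auto simp: numeral_eq_Suc)
  show "d {i, j} a i = 4" using *(2) by auto
  show "d {i, j} a j = 3" using *(3) by auto
qed

section \<open>Longest elements and reducibility\<close>

text \<open>The word acts from its right end, as in \<open>foldr \<rho>\<close>, and each reflection
  is taken at the object reached so far.\<close>

primrec path :: "nat list \<Rightarrow> 'a \<Rightarrow> (nat \<Rightarrow> int) \<Rightarrow> nat \<Rightarrow> int" where
  "path [] a v = v"
| "path (i # is) a v = sig (foldr \<rho> is a) i (path is a v)"

lemma foldr_in: "a \<in> A \<Longrightarrow> set is \<subseteq> I \<Longrightarrow> foldr \<rho> is a \<in> A"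
  by (induction "is") auto

lemma path_in: "a \<in> A \<Longrightarrow> set is \<subseteq> I \<Longrightarrow> v \<in> R a \<Longrightarrow> path is a v \<in> R (foldr \<rho> is a)"
  by (induction "is") (auto simp: foldr_in)

lemma path_inj: "a \<in> A \<Longrightarrow> set is \<subseteq> I \<Longrightarrow> path is a v = path is a w \<Longrightarrow> v = w"
proof (induction "is")
  case (Cons i "is")
  then have "sig (foldr \<rho> is a) i (path is a v) = sig (foldr \<rho> is a) i (path is a w)" by simp
  then have "path is a v = path is a w"
    using sig_sig[of "foldr \<rho> is a" i] foldr_in[of a "is"] Cons.prems
    by (metis list.set_intros(1) set_subset_Cons subset_trans in_mono)
  then show ?case using Cons by simp
qed simp

lemma path_surj: "a \<in> A \<Longrightarrow> set is \<subseteq> I \<Longrightarrow> path is a ` R a = R (foldr \<rho> is a)"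
proof (induction "is")
  case (Cons i "is")
  have "path (i # is) a ` R a = sig (foldr \<rho> is a) i ` (path is a ` R a)" by (simp add: image_image)
  also have "\<dots> = R (foldr \<rho> (i # is) a)" using Cons sig_image[OF foldr_in] by simp
  finally show ?case .
qed simp

lemma sig_sum:
  assumes "finite S"
  shows "sig a i (\<lambda>k. \<Sum>l\<in>S. c l * f l k) = (\<lambda>k. \<Sum>l\<in>S. c l * sig a i (f l) k)"
proof
  fix k
  have "(\<Sum>j\<in>I. C a i j * (\<Sum>l\<in>S. c l * f l j)) = (\<Sum>l\<in>S. c l * (\<Sum>j\<in>I. C a i j * f l j))"
    by (simp add: sum_distrib_left sum.swap[of _ S I] mult.left_commute)
  then show "sig a i (\<lambda>k. \<Sum>l\<in>S. c l * f l k) k = (\<Sum>l\<in>S. c l * sig a i (f l) k)"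
    by (simp add: sigma_def right_diff_distrib sum_subtractf)
qed

lemma path_sum:
  assumes "finite S"
  shows "path is a (\<lambda>k. \<Sum>l\<in>S. c l * f l k) = (\<lambda>k. \<Sum>l\<in>S. c l * path is a (f l) k)"
  by (induction "is") (simp_all add: sig_sum[OF assms])

text \<open>The size of this set plays the part of the length of a Weyl group element.\<close>

definition inversions :: "nat list \<Rightarrow> 'a \<Rightarrow> (nat \<Rightarrow> int) set" where
  "inversions is a = {v \<in> pos I a. \<forall>k. path is a v k \<le> 0}"

text \<open>The only positive root whose sign the reflection in \<open>i\<close> changes is
  \<open>alpha i\<close>. It turns the image of \<open>v\<close> negative, and an inversion can be
  lost only if its image is the negative of \<open>alpha i\<close>; but that is the image of the
  negative of \<open>v\<close>.\<close>

lemma inversions_extend: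
  assumes "a \<in> A" "set is \<subseteq> I" "i \<in> I" "v \<in> pos I a" "path is a v = alpha i"
  shows "insert v (inversions is a) \<subseteq> inversions (i # is) a" "v \<notin> inversions is a"
proof -
  let ?b = "foldr \<rho> is a"
  have b: "?b \<in> A" using foldr_in assms by blast
  have "sig ?b i (path is a w) l \<le> 0" if w: "w \<in> inversions is a" for w l
  proof -
    let ?u = "\<lambda>k. - path is a w k"
    have wR: "w \<in> R a" "w \<in> pos I a" "\<And>k. path is a w k \<le> 0" "\<And>k. 0 \<le> w k"
      using w by (auto simp: inversions_def pos_def)
    have uR: "?u \<in> R ?b" using R_uminus[OF b path_in[OF assms(1,2) wR(1)]] .
    have "?u \<noteq> alpha i"
    proof
      assume "?u = alpha i"
      then have "path is a w = (\<lambda>k. - alpha i k)" by (metis add.inverse_inverse)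
      moreover have "path is a (\<lambda>k. \<Sum>l\<in>{()}. (- 1) * v k) = (\<lambda>k. \<Sum>l\<in>{()}. (- 1) * path is a v k)"
        by (rule path_sum) simp
      ultimately have "path is a w = path is a (\<lambda>k. - v k)" using assms(5) by simp
      then have "w = (\<lambda>k. - v k)" using path_inj assms(1,2) by blast
      then have "v k = 0" for k using wR(4)[of k] assms(4) by (simp add: pos_def) (meson order_antisym)
      then show False using R_nonzero[OF assms(1)] assms(4) by (auto simp: pos_def)
    qed
    moreover have "?u \<in> pos I ?b" using uR wR(3) R_supp[OF b uR] by (auto simp: pos_def supp_in_def)
    ultimately obtain k where "k \<noteq> i" "0 < ?u k" using pos_non_simple[OF b assms(3)] by blast
    then have "sig ?b i (path is a w) k < 0" by simp
    then show ?thesis using R_sign[of "\<rho> i ?b" "sig ?b i (path is a w)"] b assms(3) path_in[OF assms(1,2) wR(1)]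
      by (metis leD rho_in sig_in)
  qed
  then show "insert v (inversions is a) \<subseteq> inversions (i # is) a"
    using assms(4,5) sig_alpha[OF b assms(3)] by (auto simp: inversions_def alpha_def)
  have "path is a v i > 0" using assms(5) by (simp add: alpha_def)
  then show "v \<notin> inversions is a" unfolding inversions_def by (metis (mono_tags, lifting) leD mem_Collect_eq)
qed

text \<open>Choose a path with the maximal number of inversions: no simple root can be the image of a
  positive one, hence the image of no positive root is a nonnegative combination of simple roots.\<close>
lemma longest:
  assumes "a \<in> A"
  shows "\<exists>is. set is \<subseteq> I \<and> inversions is a = pos I a"
proof -
  have bound: "card (inversions is a) \<le> card (pos I a)" for "is"
    using pos_finite[OF assms] by (intro card_mono) (auto simp: inversions_def)
  \<comment> \<open>Words are arbitrarily long, but their inversions are bounded in number by the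
    positive roots at \<open>a\<close>, so a maximum is attained.\<close>
  obtain "is" where is_I: "set is \<subseteq> I"
    and max: "\<And>js. set js \<subseteq> I \<Longrightarrow> card (inversions js a) \<le> card (inversions is a)"
    using ex_has_greatest_nat[of "\<lambda>is. set is \<subseteq> I" "[]" "\<lambda>is. card (inversions is a)" "Suc (card (pos I a))"] bound
    by (auto simp: less_Suc_eq_le)
  let ?b = "foldr \<rho> is a"
  have b: "?b \<in> A" using foldr_in assms is_I by blast
  have "\<exists>v\<in>R a. path is a v = alpha i \<and> (\<forall>k. v k \<le> 0)" if i: "i \<in> I" for i
  proof -
    have "alpha i \<in> path is a ` R a" using path_surj[OF assms is_I] b i by simp
    then obtain v where v: "v \<in> R a" "path is a v = alpha i" by auto
    have "\<not> (\<forall>k. 0 \<le> v k)"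
    proof
      assume "\<forall>k. 0 \<le> v k"
      then have vp: "v \<in> pos I a" using v R_supp[OF assms v(1)] by (auto simp: pos_def supp_in_def)
      have "card (inversions (i # is) a) \<ge> card (insert v (inversions is a))"
        using inversions_extend(1)[OF assms is_I i vp v(2)] pos_finite[OF assms, of I]
        by (intro card_mono) (auto simp: inversions_def)
      moreover have "finite (inversions is a)" using pos_finite[OF assms, of I] by (simp add: inversions_def)
      ultimately have "card (inversions (i # is) a) > card (inversions is a)"
        using inversions_extend(2)[OF assms is_I i vp v(2)] by simp
      then show False using max[of "i # is"] is_I i by simp
    qed
    then show ?thesis using v R_sign[OF assms v(1)] by blast
  qed
  then obtain f where f: "\<And>i. i \<in> I \<Longrightarrow> path is a (f i) = alpha i" "\<And>i k. i \<in> I \<Longrightarrow> f i k \<le> 0"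
    by metis
  have "\<forall>k. path is a v k \<le> 0" if v: "v \<in> pos I a" for v
  proof (rule ccontr)
    assume "\<not> ?thesis"
    moreover have vR: "v \<in> R a" using v by (simp add: pos_def)
    moreover have wR: "path is a v \<in> R ?b" using path_in assms is_I vR by blast
    ultimately have nn: "0 \<le> path is a v k" for k using R_sign[OF b] by blast
    \<comment> \<open>Expanding the image of \<open>v\<close> in simple roots and pulling back
      writes \<open>v\<close> as a nonnegative combination of the negative roots
      \<open>f l\<close>.\<close>
    let ?w = "\<lambda>k. \<Sum>l\<in>I. path is a v l * f l k"
    have "path is a ?w = (\<lambda>k. \<Sum>l\<in>I. path is a v l * path is a (f l) k)" by (rule path_sum[OF finI])
    also have "\<dots> = path is a v"
    proof
      fix k
      have "(\<Sum>l\<in>I. path is a v l * path is a (f l) k) = (\<Sum>l\<in>I. if l = k then path is a v k else 0)"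
        by (rule sum.cong) (auto simp: f alpha_def)
      also have "\<dots> = path is a v k" using finI R_supp[OF b wR] by simp
      finally show "(\<Sum>l\<in>I. path is a v l * path is a (f l) k) = path is a v k" .
    qed
    finally have "v = ?w" using path_inj[OF assms is_I] by metis
    moreover have "?w k \<le> 0" for k by (rule sum_nonpos) (use nn f(2) in \<open>simp add: mult_nonneg_nonpos\<close>)
    ultimately have "v k \<le> 0" for k by metis
    then have "v k = 0" for k using v by (simp add: pos_def) (meson order_antisym)
    then show False using R_nonzero[OF assms vR] by blast
  qed
  then show ?thesis using is_I by (auto simp: inversions_def)
qed

text \<open>The reflection in \<open>m\<close> keeps the coordinates in \<open>I2\<close>, hence the
  sign. Since no entry joins \<open>m\<close> to \<open>I2\<close>, it acts on the
  \<open>I1\<close>-part by itself and invertibly, so it cannot make that part vanish.\<close>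

lemma mixed_step:
  assumes a: "a \<in> A" and I: "I1 \<union> I2 = I" "I1 \<inter> I2 = {}"
    and block: "\<And>i j. i \<in> I1 \<Longrightarrow> j \<in> I2 \<Longrightarrow> n a i j = 0"
    and m: "m \<in> I1" and v: "v \<in> R a" "\<forall>k. 0 \<le> v k" "k1 \<in> I1" "v k1 \<noteq> 0" "k2 \<in> I2" "v k2 \<noteq> 0"
  shows "(\<forall>k. 0 \<le> sig a m v k) \<and> (\<exists>k\<in>I1. sig a m v k \<noteq> 0) \<and> (\<exists>k\<in>I2. sig a m v k \<noteq> 0)"
proof (intro conjI)
  have k2: "k2 \<noteq> m" "0 < v k2" using m v I by (auto simp: less_le)
  have mI: "m \<in> I" using m I by blast
  show "\<forall>k. 0 \<le> sig a m v k" using sig_pos[OF a mI v(1) k2] by blast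
  show "\<exists>k\<in>I2. sig a m v k \<noteq> 0" using k2 v(5) by (intro bexI[of _ k2]) auto
  show "\<exists>k\<in>I1. sig a m v k \<noteq> 0"
  proof (rule ccontr)
    assume "\<not> ?thesis"
    then have z: "sig a m v k = 0" if "k \<in> I1" for k using that by blast
    have "(\<Sum>l\<in>I - {m}. n a m l * v l) = 0"
    proof (rule sum.neutral, rule ballI)
      fix l assume l: "l \<in> I - {m}"
      show "n a m l * v l = 0"
      proof (cases "l \<in> I1")
        case True
        then show ?thesis using z[of l] l by simp
      next
        case False
        then show ?thesis using block[of m l] m l I by auto
      qed
    qed
    then have "v m = 0" using sig_split[OF a mI, of v] z[OF m] by simp
    then show False using z[OF v(3)] v(4) by (cases "k1 = m") auto
  qed
qed

text \<open>By \<open>mixed_step\<close> a positive root meeting both blocks stays positive along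
  every path, whereas a longest path turns every positive root negative.\<close>

lemma reducible_of_blocks:
  assumes I: "I1 \<union> I2 = I" "I1 \<inter> I2 = {}" "I1 \<noteq> {}" "I2 \<noteq> {}"
    and block: "\<And>a i j. a \<in> A \<Longrightarrow> i \<in> I1 \<Longrightarrow> j \<in> I2 \<Longrightarrow> n a i j = 0"
  shows "rs_reducible I A R"
proof -
  have block': "n a j i = 0" if "a \<in> A" "i \<in> I1" "j \<in> I2" for a i j
    using n_zero_sym[of i j a] block that I by blast
  have no_mixed: "\<not> (k1 \<in> I1 \<and> v k1 \<noteq> 0 \<and> k2 \<in> I2 \<and> v k2 \<noteq> 0)"
    if a: "a \<in> A" and v: "v \<in> pos I a" for a v k1 k2
  proof
    assume k: "k1 \<in> I1 \<and> v k1 \<noteq> 0 \<and> k2 \<in> I2 \<and> v k2 \<noteq> 0"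
    have vR: "v \<in> R a" "\<forall>k. 0 \<le> v k" using v by (simp_all add: pos_def)
    have mixed: "(\<forall>k. 0 \<le> path is a v k) \<and> (\<exists>k\<in>I1. path is a v k \<noteq> 0) \<and> (\<exists>k\<in>I2. path is a v k \<noteq> 0)"
      if "set is \<subseteq> I" for "is"
      using that
    proof (induction "is")
      case Nil
      then show ?case using vR k by auto
    next
      case (Cons m "is")
      let ?b = "foldr \<rho> is a"
      have b: "?b \<in> A" "path is a v \<in> R ?b" using foldr_in path_in a vR Cons.prems by auto
      obtain l1 l2 where l: "l1 \<in> I1" "path is a v l1 \<noteq> 0" "l2 \<in> I2" "path is a v l2 \<noteq> 0"
        and nn: "\<forall>k. 0 \<le> path is a v k" using Cons by auto
      consider "m \<in> I1" | "m \<in> I2" using Cons.prems I by auto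
      then show ?case
      proof cases
        case 1
        then show ?thesis
          using mixed_step[OF b(1) I(1,2) block[OF b(1)] 1 b(2) nn l] by simp
      next
        case 2
        have "I2 \<union> I1 = I" "I2 \<inter> I1 = {}" using I by blast+
        then show ?thesis
          using mixed_step[OF b(1) _ _ block'[OF b(1)] 2 b(2) nn l(3,4,1,2)] by simp
      qed
    qed
    obtain "is" where "set is \<subseteq> I" "inversions is a = pos I a" using longest[OF a] by blast
    then have "\<forall>k. path is a v k \<le> 0" "(\<forall>k. 0 \<le> path is a v k)" "\<exists>k\<in>I1. path is a v k \<noteq> 0"
      using v mixed by (auto simp: inversions_def)
    then show False by (metis order_antisym)
  qed
  have "v \<in> supp_in I1 \<or> v \<in> supp_in I2" if a: "a \<in> A" and v: "v \<in> R a" for a v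
  proof (rule ccontr)
    assume "\<not> ?thesis"
    then obtain k1 k2 where k: "k1 \<notin> I1" "v k1 \<noteq> 0" "k2 \<notin> I2" "v k2 \<noteq> 0" by (auto simp: supp_in_def)
    then have kI: "k1 \<in> I2" "k2 \<in> I1" using R_supp[OF a v] I by blast+
    have s: "u \<in> supp_in I" if "u \<in> R a" for u using R_supp[OF a that] by (auto simp: supp_in_def)
    consider "\<forall>l. 0 \<le> v l" | "\<forall>l. v l \<le> 0" using R_sign[OF a v] by blast
    then show False
    proof cases
      case 1
      then have "v \<in> pos I a" using v s by (simp add: pos_def)
      then show False using no_mixed[OF a] k kI by blast
    next
      case 2
      then have "(\<lambda>l. - v l) \<in> pos I a" using R_uminus[OF a v] s by (simp add: pos_def)
      then show False using no_mixed[OF a, of "\<lambda>l. - v l" k2 k1] k kI by simp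
    qed
  qed
  then have "\<forall>a\<in>A. R a = (R a \<inter> supp_in I1) \<union> (R a \<inter> supp_in I2)" by blast
  then show ?thesis unfolding rs_reducible_def using I by blast
qed

section \<open>Three objects\<close>

lemma d_eq3:
  assumes "a \<in> A" "J = {i, j, k}" "J \<subseteq> I" "i \<noteq> j" "i \<noteq> k" "j \<noteq> k"
  shows "d J a i + d J (\<rho> i a) i = 2 + n a i j * d J a j + n a i k * d J a k"
proof -
  have "J - {i} = {j, k}" using assms by auto
  then show ?thesis using d_eq[of a i J] assms by simp
qed

lemma d_eq4:
  assumes "a \<in> A" "J = {i, j, k, l}" "J \<subseteq> I" "distinct [i, j, k, l]"
  shows "d J a i + d J (\<rho> i a) i = 2 + n a i j * d J a j + n a i k * d J a k + n a i l * d J a l"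
proof -
  have "J - {i} = {j, k, l}" using assms by auto
  then show ?thesis using d_eq[of a i J] assms by simp
qed

lemma d_eq5:
  assumes "a \<in> A" "J = {i, j, k, l, m}" "J \<subseteq> I" "distinct [i, j, k, l, m]"
  shows "d J a i + d J (\<rho> i a) i =
    2 + n a i j * d J a j + n a i k * d J a k + n a i l * d J a l + n a i m * d J a m"
proof -
  have "J - {i} = {j, k, l, m}" using assms by auto
  then show ?thesis using d_eq[of a i J] assms by simp
qed

definition objs :: "'a \<Rightarrow> 'a \<Rightarrow> 'a \<Rightarrow> bool" where
  "objs x y z \<longleftrightarrow> A = {x, y, z} \<and> x \<noteq> y \<and> y \<noteq> z \<and> x \<noteq> z"

text \<open>The objects form a path with middle \<open>y\<close>, so the indices \<open>i\<close>
  and \<open>j\<close> alone reach all of them; \<open>y\<close> is the object moved by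
  both.\<close>

definition frame :: "'a \<Rightarrow> 'a \<Rightarrow> 'a \<Rightarrow> nat \<Rightarrow> nat \<Rightarrow> bool" where
  "frame x y z i j \<longleftrightarrow> objs x y z \<and> i \<in> I \<and> j \<in> I \<and>
     swaps_fixes (\<rho> i) x y z \<and> swaps_fixes (\<rho> j) y z x"

lemma frame_sym:
  assumes "frame x y z i j"
  shows "frame z y x j i"
proof -
  have "{x, y, z} = {z, y, x}" by blast
  then have "objs z y x" using assms unfolding frame_def objs_def by metis
  then show ?thesis using assms unfolding frame_def swaps_fixes_def by simp
qed

lemma frame_facts:
  assumes "frame x y z i j"
  shows "x \<in> A" "y \<in> A" "z \<in> A" "x \<noteq> y" "y \<noteq> z" "x \<noteq> z" "i \<in> I" "j \<in> I"
    "\<rho> i x = y" "\<rho> i y = x" "\<rho> i z = z" "\<rho> j x = x" "\<rho> j y = z" "\<rho> j z = y" "i \<noteq> j"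
proof -
  have A: "A = {x, y, z}" using assms by (simp add: frame_def objs_def)
  show "x \<in> A" "y \<in> A" "z \<in> A" unfolding A by blast+
  show d: "x \<noteq> y" "y \<noteq> z" "x \<noteq> z" using assms by (simp_all add: frame_def objs_def)
  show "i \<in> I" "j \<in> I" "\<rho> i x = y" "\<rho> i y = x" "\<rho> i z = z" "\<rho> j x = x" "\<rho> j y = z" "\<rho> j z = y"
    using assms by (simp_all add: frame_def swaps_fixes_def)
  then show "i \<noteq> j" using d by metis
qed

lemma frame_cases:
  assumes "frame x y z i j" "a \<in> A"
  obtains "a = x" | "a = y" | "a = z"
  using assms unfolding frame_def objs_def by blast

lemma frame_n:
  assumes "frame x y z i j" "k \<in> I"
  shows "n y i k = n x i k" "n z j k = n y j k"
  using frame_facts[OF assms(1)] n_rho[of i k x] n_rho[of j k y] assms(2) by simp_all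

lemma frame_d:
  assumes "frame x y z i j" "J \<subseteq> I"
  shows "i \<in> J \<Longrightarrow> k \<noteq> i \<Longrightarrow> d J y k = d J x k" "j \<in> J \<Longrightarrow> k \<noteq> j \<Longrightarrow> d J z k = d J y k"
  using frame_facts[OF assms(1)] d_other[OF _ _ assms(2), of x i k] d_other[OF _ _ assms(2), of y j k]
  by simp_all

text \<open>The composite of \<open>\<rho> i\<close> and \<open>\<rho> j\<close> is a three-cycle,
  so its square fixes no object, while a vanishing entry would give \<open>m = 2\<close>.\<close>

lemma frame_n_pos:
  assumes "frame x y z i j" "a \<in> A"
  shows "1 \<le> n a i j" "1 \<le> n a j i"
proof -
  note f = frame_facts[OF assms(1)]
  have "\<rho> i (\<rho> j (\<rho> i (\<rho> j a))) \<noteq> a"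
    using f by (cases rule: frame_cases[OF assms]) simp_all
  then have "n a i j \<noteq> 0" using rank2_A1A1[of a i j] f assms(2) by blast
  moreover then have "n a j i \<noteq> 0" using n_zero_sym[of j i a] f assms(2) by blast
  ultimately show "1 \<le> n a i j" "1 \<le> n a j i"
    using n_nonneg[of i j a] n_nonneg[of j i a] f assms(2) by linarith+
qed

text \<open>Type \<open>B\<^sub>2\<close> means \<open>m = 4\<close>, but \<open>\<rho>\<^sub>i \<rho>\<^sub>j\<close> has order three.\<close>
lemma frame_not_B2:
  assumes "frame x y z i j"
  shows "\<not> (n x i j = 1 \<and> n x j i = 2)" "\<not> (n x i j = 2 \<and> n x j i = 1)"
proof -
  note f = frame_facts[OF assms]
  have "\<rho> i (\<rho> j (\<rho> i (\<rho> j (\<rho> i (\<rho> j (\<rho> i (\<rho> j x))))))) \<noteq> x" by (simp add: f f(4)[symmetric])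
  then show "\<not> (n x i j = 1 \<and> n x j i = 2)" "\<not> (n x i j = 2 \<and> n x j i = 1)"
    using rank2_B2(1)[of x i j] rank2_C2(1)[of x i j] f(1,7,8,12,15) by blast+
qed

text \<open>A transposition and an identity only satisfy (R4) at a moved object if
  \<open>m\<close> is even, which excludes the type \<open>A\<^sub>2\<close>.\<close>
lemma even_bond:
  assumes "swaps_fixes (\<rho> i) p q r" "is_id_on (\<rho> l) A" "p \<in> A" "q \<in> A" "p \<noteq> q" "i \<in> I" "l \<in> I"
    and "n p i l \<noteq> 0 \<or> n p l i \<noteq> 0"
  shows "1 \<le> n p i l" "1 \<le> n p l i" "2 \<le> n p i l * n p l i"
proof -
  have f: "\<rho> i p = q" "\<rho> i q = p" "\<rho> l p = p" "\<rho> l q = q"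
    using assms by (auto simp: swaps_fixes_def is_id_on_def)
  have il: "i \<noteq> l" using f assms by auto
  have "n p i l \<noteq> 0" "n p l i \<noteq> 0"
    using assms(3,6,7,8) n_zero_sym[of i l p] n_zero_sym[of l i p] by auto
  then show 1: "1 \<le> n p i l" "1 \<le> n p l i"
    using n_nonneg[of i l p] n_nonneg[of l i p] assms(3,6,7) il by linarith+
  show "2 \<le> n p i l * n p l i"
  proof (rule ccontr)
    assume "\<not> ?thesis"
    then have "n p i l = 1 \<and> n p l i = 1" using 1 prod_eq_1[of "n p i l" "n p l i"] by linarith
    then have "\<rho> i (\<rho> l (\<rho> i (\<rho> l (\<rho> i (\<rho> l p))))) = p" using rank2_A2[of p i l] assms(3,6,7) il by blast
    then show False using f assms(5) by simp
  qed
qed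

text \<open>(C2) for \<open>j\<close> does not compare row \<open>l\<close> at \<open>p\<close> and
  \<open>q\<close>. But the rank two computation gives \<open>d\<close> at \<open>p\<close> exactly,
  the equation of \<open>j\<close> carries it to \<open>q\<close>, and there the equation of
  \<open>l\<close> determines the entry.\<close>

lemma double_bond_const:
  assumes "swaps_fixes (\<rho> j) p q r" "is_id_on (\<rho> l) A" "p \<in> A" "q \<in> A" "p \<noteq> q" "j \<in> I" "l \<in> I"
    and "1 \<le> n p j l" "1 \<le> n p l j" "n p j l * n p l j = 2"
  shows "n q l j = n p l j"
proof -
  have f: "\<rho> j p = q" "\<rho> j q = p" "\<rho> l p = p" "\<rho> l q = q"
    using assms by (auto simp: swaps_fixes_def is_id_on_def)
  have jl: "j \<noteq> l" using f assms by auto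
  have D: "{j, l} - {j} = {l}" "{j, l} - {l} = {j}" "{j, l} \<subseteq> I" using jl assms by auto
  have 1: "d {j, l} p j + d {j, l} q j = 2 + n p j l * d {j, l} p l"
    using d_eq[of p j "{j, l}"] D f assms(3) by simp
  have 2: "2 * d {j, l} q l = 2 + n q l j * d {j, l} q j"
    using d_eq[of q l "{j, l}"] D f assms(4) by simp
  have 3: "d {j, l} q l = d {j, l} p l"
    using d_other[of p j "{j, l}" l] D f assms(3) jl by simp
  consider "n p j l = 1" "n p l j = 2" | "n p j l = 2" "n p l j = 1"
    using prod_eq_2 assms by blast
  then show ?thesis
  proof cases
    case 1
    then have "d {j, l} p j = 3" "d {j, l} p l = 4"
      using rank2_B2[of p j l] assms f jl by auto
    then show ?thesis using 1 \<open>d {j, l} p j + _ = _\<close> 2 3 by simp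
  next
    case 2
    then have "d {j, l} p j = 4" "d {j, l} p l = 3"
      using rank2_C2[of p j l] assms f jl by auto
    then show ?thesis using 2 1 \<open>2 * d {j, l} q l = _\<close> 3 by simp
  qed
qed

lemma isolated_everywhere:
  assumes "frame x y z i j" "i \<in> J" "j \<in> J" "J \<subseteq> I" "k \<in> J" "a \<in> A" "b \<in> A"
    and "\<And>m. m \<in> J \<Longrightarrow> m \<noteq> k \<Longrightarrow> n a k m = 0" "m \<in> J" "m \<noteq> k"
  shows "n b k m = 0"
proof -
  note f = frame_facts[OF assms(1)]
  define P where "P c \<longleftrightarrow> (\<forall>m\<in>J. m \<noteq> k \<longrightarrow> n c k m = 0)" for c
  have step: "P (\<rho> l c)" if "P c" "l \<in> J" "c \<in> A" for l c
    using isolated_step[of c k J l] that assms(4,5) unfolding P_def by blast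
  have "P a" using assms(8) by (simp add: P_def)
  moreover have "P x \<Longrightarrow> P y" "P y \<Longrightarrow> P x" "P y \<Longrightarrow> P z" "P z \<Longrightarrow> P y"
    using step[OF _ assms(2), of x] step[OF _ assms(2), of y] step[OF _ assms(3), of y]
      step[OF _ assms(3), of z] by (simp_all add: f)
  ultimately have "P b"
    using frame_cases[OF assms(1,6)] frame_cases[OF assms(1,7)] by metis
  then show ?thesis using assms(9,10) by (simp add: P_def)
qed

text \<open>Each of \<open>i\<close> and \<open>k\<close> preserves the coordinate of the other and
  that of \<open>j\<close>, so \<open>d\<close> is the same at \<open>x\<close> and
  \<open>y\<close>. This reduces the equations to those of \<open>arith_A3\<close>.\<close>

lemma frame_A3:
  assumes "frame x y z i j" "frame x y z k j" "i \<noteq> k" "a \<in> A"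
  shows "n a i j = 1" "n a j i = 1" "n a k j = 1" "n a j k = 1" "n a i k = 0" "n a k i = 0"
proof -
  note f = frame_facts[OF assms(1)] and f' = frame_facts[OF assms(2)]
  let ?J = "{i, j, k}"
  have J: "?J \<subseteq> I" "?J = {k, j, i}" "?J = {j, i, k}" using f f' by auto
  have ne: "i \<noteq> j" "k \<noteq> j" "i \<noteq> k" using f f' assms(3) by auto
  let ?d = "d ?J"
  have yx: "?d y i = ?d x i" "?d y k = ?d x k" "?d y j = ?d x j"
    using frame_d(1)[OF assms(1) J(1)] frame_d(1)[OF assms(2) J(1)] ne by simp_all
  have zy: "?d z i = ?d y i" "?d z k = ?d y k"
    using frame_d(2)[OF assms(1) J(1)] ne by simp_all
  have x: "2 * ?d x i = 2 + n x i j * ?d x j + n x i k * ?d x k"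
    "2 * ?d x k = 2 + n x k j * ?d x j + n x k i * ?d x i"
    "2 * ?d x j = 2 + n x j i * ?d x i + n x j k * ?d x k"
    using d_eq3[OF f(1) refl J(1)] d_eq3[OF f(1) J(2,1)] d_eq3[OF f(1) J(3,1)] ne by (simp_all add: f f' yx)
  have yz: "?d x j + ?d z j = 2 + n y j i * ?d x i + n y j k * ?d x k"
    "2 * ?d x i = 2 + n z i j * ?d z j + n z i k * ?d x k"
    "2 * ?d x k = 2 + n z k j * ?d z j + n z k i * ?d x i"
    using d_eq3[OF f(2) J(3,1)] d_eq3[OF f(3) refl J(1)] d_eq3[OF f(3) J(2,1)] ne by (simp_all add: f f' yx zy)
  have pos: "1 \<le> ?d x i" "1 \<le> ?d x k" "1 \<le> ?d x j" "1 \<le> ?d z j"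
    using d_pos[OF _ _ J(1)] by (simp_all add: f)
  note np = frame_n_pos[OF assms(1)] frame_n_pos[OF assms(2)]
  have nn: "0 \<le> n b i k" "0 \<le> n b k i" "n b i k = 0 \<longleftrightarrow> n b k i = 0" if "b \<in> A" for b
    using n_nonneg[OF f(7) f'(7) that ne(3)] n_nonneg[OF f'(7) f(7) that] ne(3)
      n_zero_sym[OF f(7) f'(7) that] n_zero_sym[OF f'(7) f(7) that] by auto
  have *: "n x i j = 1 \<and> n x k j = 1 \<and> n x j i = 1 \<and> n x j k = 1 \<and> n y j i = 1 \<and> n y j k = 1 \<and>
      n z i j = 1 \<and> n z k j = 1 \<and> n x i k = 0 \<and> n x k i = 0 \<and> n z i k = 0 \<and> n z k i = 0"
    by (rule arith_A3[OF pos _ _ _ _ _ _ _ _ _ _ _ _ _ x yz])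
      (use np nn frame_not_B2[OF assms(1)] frame_not_B2[OF assms(2)] in \<open>simp_all add: f\<close>)
  have "n y i j = 1 \<and> n y k j = 1 \<and> n y i k = 0 \<and> n y k i = 0 \<and> n z j i = 1 \<and> n z j k = 1"
    using * frame_n[OF assms(1)] frame_n[OF assms(2)] by (simp add: f f')
  then show "n a i j = 1" "n a j i = 1" "n a k j = 1" "n a j k = 1" "n a i k = 0" "n a k i = 0"
    using * by (cases rule: frame_cases[OF assms(1,4)]; simp)+
qed

lemma frame_id:
  assumes "frame x y z i j" "is_id_on (\<rho> l) A"
  shows "\<rho> l x = x" "\<rho> l y = y" "\<rho> l z = z" "l \<noteq> i" "l \<noteq> j"
proof -
  note f = frame_facts[OF assms(1)]
  show 1: "\<rho> l x = x" "\<rho> l y = y" "\<rho> l z = z" using assms(2) f(1-3) by (simp_all add: is_id_on_def)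
  show "l \<noteq> i" "l \<noteq> j" using 1 f by metis+
qed

lemma term_nonneg:
  assumes "a \<in> A" "J \<subseteq> I" "i \<in> I" "j \<in> J" "i \<noteq> j"
  shows "0 \<le> n a i j * d J a j"
  using n_nonneg[of i j a] d_pos[of a j J] assms by (intro mult_nonneg_nonneg) auto

lemma term_ge:
  assumes "a \<in> A" "J \<subseteq> I" "j \<in> J" "1 \<le> n a i j"
  shows "d J a j \<le> n a i j * d J a j"
  using mult_right_mono[of 1 "n a i j" "d J a j"] d_pos[of a j J] assms by simp

text \<open>The three indices are pairwise joined at every object. In the sum of the nine
  inequalities every coordinate occurs twice on each side, and only the constants remain.\<close>

lemma no_transposition_triangle:
  assumes "frame x y z i j" "t \<in> I" "swaps_fixes (\<rho> t) x z y"
  shows False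
proof -
  note f = frame_facts[OF assms(1)]
  have 1: "frame y x z i t" "frame y z x j t"
    using assms f(4-6)[symmetric] unfolding frame_def objs_def swaps_fixes_def
    by (simp_all add: insert_commute)
  have t: "\<rho> t x = z" "\<rho> t z = x" "\<rho> t y = y" using assms(3) by (simp_all add: swaps_fixes_def)
  have ne: "i \<noteq> j" "i \<noteq> t" "j \<noteq> t" using f(15) frame_facts(15)[OF 1(1)] frame_facts(15)[OF 1(2)] by auto
  let ?J = "{i, j, t}"
  have J: "?J \<subseteq> I" "?J = {j, i, t}" "?J = {t, i, j}" using f(7,8) assms(2) by auto
  let ?d = "d ?J"
  have e: "2 + ?d a j + ?d a t \<le> ?d a i + ?d (\<rho> i a) i" "2 + ?d a i + ?d a t \<le> ?d a j + ?d (\<rho> j a) j"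
    "2 + ?d a i + ?d a j \<le> ?d a t + ?d (\<rho> t a) t" if a: "a \<in> A" for a
  proof -
    note np = frame_n_pos[OF assms(1) a] frame_n_pos[OF 1(1) a] frame_n_pos[OF 1(2) a]
    note ge = term_ge[OF a J(1)]
    show "2 + ?d a j + ?d a t \<le> ?d a i + ?d (\<rho> i a) i"
      using d_eq3[OF a refl J(1)] ne ge[of j i] ge[of t i] np by simp
    show "2 + ?d a i + ?d a t \<le> ?d a j + ?d (\<rho> j a) j"
      using d_eq3[OF a J(2,1)] ne ge[of i j] ge[of t j] np by simp
    show "2 + ?d a i + ?d a j \<le> ?d a t + ?d (\<rho> t a) t"
      using d_eq3[OF a J(3,1)] ne ge[of i t] ge[of j t] np by simp
  qed
  show False using e[OF f(1)] e[OF f(2)] e[OF f(3)] unfolding f(9-14) t by linarith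
qed

text \<open>By \<open>frame_A3\<close>, also for the reversed frame, the four indices form a simply
  laced cycle at \<open>x\<close>; adding its four equations gives a contradiction.\<close>

lemma no_transposition_square:
  assumes "frame x y z i j" "frame x y z k j" "frame x y z i m" "i \<noteq> k" "j \<noteq> m"
  shows False
proof -
  note f = frame_facts[OF assms(1)] and fk = frame_facts[OF assms(2)] and fm = frame_facts[OF assms(3)]
  have km: "frame x y z k m" using assms unfolding frame_def by blast
  note A = frame_A3[OF assms(1,2,4) f(1)] frame_A3[OF assms(3) km assms(4) f(1)]
    frame_A3[OF frame_sym[OF assms(1)] frame_sym[OF assms(3)] assms(5) f(1)]
  have dist: "distinct [i, k, j, m]" using f(15) fk(15) fm(15) frame_facts(15)[OF km] assms(4,5) by auto
  let ?J = "{i, k, j, m}"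
  have J: "?J \<subseteq> I" "?J = {k, i, j, m}" "?J = {j, i, k, m}" "?J = {m, i, k, j}" using f(7,8) fk(7) fm(8) by auto
  let ?d = "d ?J"
  have yx: "?d y i = ?d x i" "?d y k = ?d x k"
    using frame_d(1)[OF assms(1) J(1), of k] frame_d(1)[OF assms(2) J(1), of i] assms(4) by simp_all
  have "2 * ?d x i = 2 + ?d x j + ?d x m"
    using d_eq4[OF f(1) refl J(1)] dist by (simp add: f yx A)
  moreover have "2 * ?d x k = 2 + ?d x j + ?d x m"
    using d_eq4[OF f(1) J(2,1)] dist f(15)[symmetric] fk(15)[symmetric] fm(15)[symmetric] by (simp add: f fk yx A)
  moreover have "2 * ?d x j = 2 + ?d x i + ?d x k"
    using d_eq4[OF f(1) J(3,1)] dist f(15)[symmetric] fk(15)[symmetric] fm(15)[symmetric] by (simp add: f A)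
  moreover have "2 * ?d x m = 2 + ?d x i + ?d x k"
    using d_eq4[OF f(1) J(4,1)] dist f(15)[symmetric] fk(15)[symmetric] fm(15)[symmetric] by (simp add: fm A)
  ultimately show False by linarith
qed

section \<open>Two indices with the same transposition\<close>

text \<open>As \<open>i\<close> and \<open>k\<close> act alike, \<open>d\<close> agrees at
  \<open>x\<close> and \<open>y\<close>, and at \<open>z\<close> only the coordinate of
  \<open>j\<close> may differ. Five unknown coordinates suffice for all objects.\<close>

lemma A3_id_eqs:
  assumes "frame x y z i j" "frame x y z k j" "i \<noteq> k" "l \<in> I" "is_id_on (\<rho> l) A"
    and "J = {i, k, j, l}"
  shows "2 * d J x i = 2 + d J x j + n x i l * d J x l"
    "2 * d J x k = 2 + d J x j + n x k l * d J x l"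
    "2 * d J x j = 2 + d J x i + d J x k + n x j l * d J x l"
    "2 * d J x l = 2 + n x l i * d J x i + n x l k * d J x k + n x l j * d J x j"
    "2 * d J x l = 2 + n y l i * d J x i + n y l k * d J x k + n y l j * d J x j"
    "d J x j + d J z j = 2 + d J x i + d J x k + n y j l * d J x l"
    "2 * d J x i = 2 + d J z j + n z i l * d J x l"
    "2 * d J x k = 2 + d J z j + n z k l * d J x l"
    "2 * d J x l = 2 + n z l i * d J x i + n z l k * d J x k + n z l j * d J z j"
    "1 \<le> d J x i" "1 \<le> d J x k" "1 \<le> d J x j" "1 \<le> d J z j" "1 \<le> d J x l"
proof -
  note f = frame_facts[OF assms(1)] and fk = frame_facts[OF assms(2)]
  note l = frame_id[OF assms(1,5)] frame_id[OF assms(2,5)]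
  note A = frame_A3[OF assms(1-3)]
  have J: "J \<subseteq> I" "J = {k, i, j, l}" "J = {j, i, k, l}" "J = {l, i, k, j}" using f(7,8) fk(7) assms(4,6) by auto
  have dist: "distinct [i, k, j, l]" using f(15) fk(15) l(4,5,9) assms(3) by auto
  have yx: "d J y i = d J x i" "d J y k = d J x k" "d J y j = d J x j" "d J y l = d J x l"
    using frame_d(1)[OF assms(1) J(1)] frame_d(1)[OF assms(2) J(1), of i] dist assms(6) by simp_all
  have zy: "d J z i = d J x i" "d J z k = d J x k" "d J z l = d J x l"
    using frame_d(2)[OF assms(1) J(1)] dist yx assms(6) by simp_all
  note e = d_eq4[OF _ assms(6) J(1)] d_eq4[OF _ J(2,1)] d_eq4[OF _ J(3,1)] d_eq4[OF _ J(4,1)]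
  note s = f fk l A yx zy f(15)[symmetric] fk(15)[symmetric] l(4,5,9)[symmetric] assms(3)[symmetric]
  show "2 * d J x i = 2 + d J x j + n x i l * d J x l" using e(1)[of x] dist by (simp add: s)
  show "2 * d J x k = 2 + d J x j + n x k l * d J x l" using e(2)[of x] dist by (simp add: s)
  show "2 * d J x j = 2 + d J x i + d J x k + n x j l * d J x l" using e(3)[of x] dist by (simp add: s)
  show "2 * d J x l = 2 + n x l i * d J x i + n x l k * d J x k + n x l j * d J x j"
    using e(4)[of x] dist by (simp add: s)
  show "2 * d J x l = 2 + n y l i * d J x i + n y l k * d J x k + n y l j * d J x j"
    using e(4)[of y] dist by (simp add: s)
  show "d J x j + d J z j = 2 + d J x i + d J x k + n y j l * d J x l" using e(3)[of y] dist by (simp add: s)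
  show "2 * d J x i = 2 + d J z j + n z i l * d J x l" using e(1)[of z] dist by (simp add: s)
  show "2 * d J x k = 2 + d J z j + n z k l * d J x l" using e(2)[of z] dist by (simp add: s)
  show "2 * d J x l = 2 + n z l i * d J x i + n z l k * d J x k + n z l j * d J z j"
    using e(4)[of z] dist by (simp add: s)
  show "1 \<le> d J x i" "1 \<le> d J x k" "1 \<le> d J x j" "1 \<le> d J z j" "1 \<le> d J x l"
    using d_pos[OF _ _ J(1)] assms(6) by (simp_all add: f)
qed

text \<open>At \<open>y\<close> the bond between \<open>j\<close> and \<open>l\<close> has even \<open>m\<close>, so it is heavier there than at \<open>x\<close>; then
  the \<open>j\<close>-th coordinate is larger at \<open>z\<close> than at \<open>x\<close>, contradicting the equations for \<open>i\<close>.\<close>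
lemma A3_id_not_middle:
  assumes "frame x y z i j" "frame x y z k j" "i \<noteq> k" "l \<in> I" "is_id_on (\<rho> l) A"
    and "n x l i = 0" "n x l k = 0"
  shows "n x l j = 0"
proof (rule ccontr)
  assume lj: "n x l j \<noteq> 0"
  note f = frame_facts[OF assms(1)] and fk = frame_facts[OF assms(2)]
  note l = frame_id[OF assms(1,5)] frame_id[OF assms(2,5)]
  note e = A3_id_eqs[OF assms(1-5) refl]
  have z: "n x i l = 0" "n x k l = 0"
    using n_zero_sym[OF assms(4) f(7) f(1)] n_zero_sym[OF assms(4) fk(7) f(1)] assms(6,7) by auto
  then have "n y i l = 0" "n y k l = 0"
    using frame_n(1)[OF assms(1,4)] frame_n(1)[OF assms(2,4)] by simp_all
  then have zy: "n y l i = 0" "n y l k = 0"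
    using n_zero_sym[OF f(7) assms(4) f(2)] n_zero_sym[OF fk(7) assms(4) f(2)] by auto
  have pos: "1 \<le> n x l j" "1 \<le> n x j l" "0 \<le> n z i l"
    using n_nonneg[OF assms(4) f(8,1)] n_nonneg[OF f(8) assms(4) f(1)] n_zero_sym[OF f(8) assms(4) f(1)]
      n_nonneg[OF f(7) assms(4) f(3)] lj l by force+
  have y1: "2 * d {i, k, j, l} x l = 2 + n y l j * d {i, k, j, l} x j" using e(5) zy by simp
  \<comment> \<open>The coordinates at \<open>x\<close> and \<open>y\<close> agree, so the two
    equations of \<open>l\<close> have the same solution for this entry.\<close>
  then have "n y l j = n x l j" using e(4,12) assms(6,7) by simp
  then have "n y l j \<noteq> 0" using lj by simp
  then have ev: "1 \<le> n y j l" "1 \<le> n y l j" "2 \<le> n y j l * n y l j"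
    using even_bond[of j y z x l] assms(1,4,5) f(2,3,5,8) unfolding frame_def by auto
  show False
    by (rule arith_A3_middle[OF e(10-14) _ _ pos(2,1) ev(1,2) pos(3) _ _ z _ _ ev(3) e(1-4) y1 e(6,7)])
      (simp_all add: z assms(6,7))
qed

text \<open>At \<open>x\<close>, \<open>arith_A3_end\<close> leaves a double bond to
  \<open>k\<close> and no other bond of \<open>l\<close>. Then the coordinates turn out to agree at
  all objects, and comparing the equations carries the entries over.\<close>

lemma A3_id_end:
  assumes "frame x y z i j" "frame x y z k j" "i \<noteq> k" "l \<in> I" "is_id_on (\<rho> l) A"
    and "n x k l \<noteq> 0" "a \<in> A"
  shows "n a k l = n x k l" "n a l k = n x l k" "n a i l = 0" "n a l i = 0" "n a j l = 0" "n a l j = 0"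
    "n x k l * n x l k = 2" "1 \<le> n x k l" "1 \<le> n x l k"
proof -
  note f = frame_facts[OF assms(1)] and fk = frame_facts[OF assms(2)]
  note l = frame_id[OF assms(1,5)] frame_id[OF assms(2,5)]
  note e = A3_id_eqs[OF assms(1-5) refl]
  let ?d = "d {i, k, j, l}"
  have nn: "0 \<le> n b i l" "0 \<le> n b l i" "n b i l = 0 \<longleftrightarrow> n b l i = 0"
    "0 \<le> n b j l" "0 \<le> n b l j" "n b j l = 0 \<longleftrightarrow> n b l j = 0" if "b \<in> A" for b
    using n_nonneg[OF f(7) assms(4) that] n_nonneg[OF assms(4) f(7) that]
      n_nonneg[OF f(8) assms(4) that] n_nonneg[OF assms(4) f(8) that]
      n_zero_sym[OF f(7) assms(4) that] n_zero_sym[OF assms(4) f(7) that]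
      n_zero_sym[OF f(8) assms(4) that] n_zero_sym[OF assms(4) f(8) that] l by (fastforce+)
  have sw: "swaps_fixes (\<rho> k) x y z" "swaps_fixes (\<rho> k) y x z"
    using assms(2) by (auto simp: frame_def swaps_fixes_def)
  have ev: "1 \<le> n x k l" "1 \<le> n x l k" "2 \<le> n x k l * n x l k"
    using even_bond[OF sw(1) assms(5) f(1,2,4) fk(7) assms(4)] assms(6) by auto
  have yk: "n y k l = n x k l" using frame_n(1)[OF assms(2,4)] .
  have evy: "1 \<le> n y k l" "1 \<le> n y l k" "2 \<le> n y k l * n y l k"
    using even_bond[OF sw(2) assms(5) f(2,1) f(4)[symmetric] fk(7) assms(4)] assms(6) yk by auto
  have x: "n x i l = 0 \<and> n x l i = 0 \<and> n x j l = 0 \<and> n x l j = 0 \<and> n x k l * n x l k = 2"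
    by (rule arith_A3_end[OF e(10-12,14) _ ev(1) _ _ _ ev(2) _ _ ev(3) e(1-4)])
      (use nn[OF f(1)] in auto)
  then show "n x k l * n x l k = 2" "1 \<le> n x k l" "1 \<le> n x l k" using ev by auto
  have yi: "n y i l = 0" "n y l i = 0" using frame_n(1)[OF assms(1,4)] x nn(3)[OF f(2)] by auto
  have c2: "2 * ?d x l = 2 + n x l k * ?d x k" using e(4) x by simp
  have c2y: "2 * ?d x l = 2 + n y l k * ?d x k + n y l j * ?d x j" using e(5) yi by simp
  \<comment> \<open>Row \<open>k\<close> agrees at \<open>x\<close> and \<open>y\<close>; if its
    entry is 1, evenness at \<open>y\<close> must come from the entry in row
    \<open>l\<close>.\<close>
  have "n x l k \<le> n y l k"
  proof -
    consider "n x k l = 1" "n x l k = 2" | "n x l k = 1" using prod_eq_2[OF ev(1,2)] x by auto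
    then show ?thesis
    proof cases
      case 1
      then show ?thesis using evy(3) yk by simp
    qed (use evy in simp)
  qed
  moreover have tj: "0 \<le> n y l j * ?d x j" using nn(5)[OF f(2)] e(12) by simp
  ultimately have lk: "n y l k = n x l k"
  proof -
    have "n y l k * ?d x k \<le> n x l k * ?d x k" using c2 c2y tj by linarith
    then have "n y l k \<le> n x l k" using e(11) by simp
    then show ?thesis using \<open>n x l k \<le> n y l k\<close> by simp
  qed
  then have "n y l j * ?d x j = 0" using c2 c2y by simp
  then have yj: "n y l j = 0" "n y j l = 0" using e(12) nn(6)[OF f(2)] by auto
  then have w: "?d z j = ?d x j" using e(3,6) x by simp
  have "n z i l * ?d x l = 0" using e(1,7) w x by simp
  then have zi: "n z i l = 0" "n z l i = 0" using e(14) nn(3)[OF f(3)] by auto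
  have zj: "n z j l = 0" "n z l j = 0" using frame_n(2)[OF assms(1,4)] yj nn(6)[OF f(3)] by auto
  have "n z k l * ?d x l = n x k l * ?d x l" using e(2,8) w by simp
  then have zk: "n z k l = n x k l" using e(14) by simp
  have "2 * ?d x l = 2 + n z l k * ?d x k" using e(9) zi zj by simp
  then have "n z l k * ?d x k = n x l k * ?d x k" using c2 by linarith
  then have zlk: "n z l k = n x l k" using e(11) by simp
  show "n a k l = n x k l" "n a l k = n x l k" "n a i l = 0" "n a l i = 0" "n a j l = 0" "n a l j = 0"
    using x yi yj zi zj zk zlk lk yk by (cases rule: frame_cases[OF assms(1,7)]; simp)+
qed

text \<open>Otherwise \<open>l\<close> is not attached to \<open>j\<close> at \<open>x\<close>
  either, by \<open>A3_id_not_middle\<close>; being isolated at \<open>x\<close>, it is isolated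
  everywhere.\<close>

lemma A3_id_attached:
  assumes "frame x y z i j" "frame x y z k j" "i \<noteq> k" "l \<in> I" "is_id_on (\<rho> l) A"
    and "a \<in> A" "n a l i \<noteq> 0 \<or> n a l k \<noteq> 0 \<or> n a l j \<noteq> 0"
  shows "n x i l \<noteq> 0 \<or> n x k l \<noteq> 0"
proof (rule ccontr)
  assume c: "\<not> ?thesis"
  note f = frame_facts[OF assms(1)] and fk = frame_facts[OF assms(2)]
  note l = frame_id[OF assms(1,5)] frame_id[OF assms(2,5)]
  have z: "n x l i = 0" "n x l k = 0"
    using n_zero_sym[OF f(7) assms(4) f(1)] n_zero_sym[OF fk(7) assms(4) f(1)] c by auto
  then have "n x l j = 0" using A3_id_not_middle[OF assms(1-5)] by simp
  then have "n x l m = 0" if "m \<in> {i, k, j, l}" "m \<noteq> l" for m using z that by auto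
  moreover have "{i, k, j, l} \<subseteq> I" using f(7,8) fk(7) assms(4) by auto
  ultimately have "n a l m = 0" if "m \<in> {i, k, j, l}" "m \<noteq> l" for m
    using isolated_everywhere[OF assms(1), of "{i, k, j, l}" l x a m] f(1) assms(6) that by blast
  then show False using assms(7) l by (metis insertCI)
qed

text \<open>Each configuration is at least as heavy as an affine diagram: a second even bond at
  \<open>k\<close>, an even bond at the other end \<open>i\<close> of the chain, or a further index
  beyond the double bond.\<close>

lemma A3_two_ids:
  assumes "frame x y z i j" "frame x y z k j" "i \<noteq> k" "l \<in> I" "is_id_on (\<rho> l) A"
    and "m \<in> I" "is_id_on (\<rho> m) A" "l \<noteq> m" "n x k l \<noteq> 0"
  shows "n x k m = 0" "n x i m = 0" "\<not> (1 \<le> n x l m \<and> 1 \<le> n x m l)"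
proof -
  note f = frame_facts[OF assms(1)] and fk = frame_facts[OF assms(2)]
  note l = frame_id[OF assms(1,5)] frame_id[OF assms(2,5)] and m = frame_id[OF assms(1,7)] frame_id[OF assms(2,7)]
  note A = frame_A3[OF assms(1-3) f(1)]
  note L = A3_id_end[OF assms(1-5,9) f(1)]
  let ?J = "{i, k, j, l, m}"
  let ?d = "d ?J"
  have J: "?J \<subseteq> I" "?J = {k, i, j, l, m}" "?J = {j, i, k, l, m}" "?J = {l, i, k, j, m}" "?J = {m, i, k, j, l}"
    using f(7,8) fk(7) assms(4,6) by auto
  have dist: "distinct [i, k, j, l, m]" using f(15) fk(15) l(4,5,9) m(4,5,9) assms(3,8) by auto
  have yx: "?d y i = ?d x i" "?d y k = ?d x k"
    using frame_d(1)[OF assms(1) J(1), of k] frame_d(1)[OF assms(2) J(1), of i] assms(3) by simp_all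
  note e = d_eq5[OF f(1) refl J(1)] d_eq5[OF f(1) J(2,1)] d_eq5[OF f(1) J(3,1)] d_eq5[OF f(1) J(4,1)]
    d_eq5[OF f(1) J(5,1)]
  note s = f fk l m A yx L(3-6) f(15)[symmetric] fk(15)[symmetric] l(4,5,9)[symmetric] m(4,5,9)[symmetric]
    assms(3)[symmetric] assms(8)[symmetric]
  have e1: "2 * ?d x i = 2 + ?d x j + n x i m * ?d x m" using e(1) dist by (simp add: s)
  have e2: "2 * ?d x k = 2 + ?d x j + n x k l * ?d x l + n x k m * ?d x m" using e(2) dist by (simp add: s)
  have e3: "2 * ?d x j = 2 + ?d x i + ?d x k + n x j m * ?d x m" using e(3) dist by (simp add: s)
  have e4: "2 * ?d x l = 2 + n x l k * ?d x k + n x l m * ?d x m" using e(4) dist by (simp add: s)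
  have e5: "2 * ?d x m = 2 + n x m i * ?d x i + n x m k * ?d x k + n x m j * ?d x j + n x m l * ?d x l"
    using e(5) dist by (simp add: s)
  have pos: "1 \<le> ?d x i" "1 \<le> ?d x k" "1 \<le> ?d x j" "1 \<le> ?d x l" "1 \<le> ?d x m"
    using d_pos[OF f(1) _ J(1)] by simp_all
  note nn = term_nonneg[OF f(1) J(1)]
  have t: "0 \<le> n x i m * ?d x m" "0 \<le> n x k m * ?d x m" "0 \<le> n x j m * ?d x m" "0 \<le> n x l m * ?d x m"
    "0 \<le> n x m i * ?d x i" "0 \<le> n x m k * ?d x k" "0 \<le> n x m j * ?d x j" "0 \<le> n x m l * ?d x l"
    using nn[of i m] nn[of k m] nn[of j m] nn[of l m] nn[of m i] nn[of m k] nn[of m j] nn[of m l]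
      assms(4,6) f(7,8) fk(7) dist by auto
  have b: "n x k l * 2 + 2 * ?d x k \<le> 2 * (n x k l * ?d x l)"
    by (rule double_bond[OF L(8,9)]) (use L(7) e4 t pos in simp_all)
  have sw: "swaps_fixes (\<rho> k) x y z" "swaps_fixes (\<rho> i) x y z" using assms(1,2) by (simp_all add: frame_def)
  show "n x k m = 0"
  proof (rule ccontr)
    assume "n x k m \<noteq> 0"
    then have ev: "1 \<le> n x k m" "1 \<le> n x m k" "2 \<le> n x k m * n x m k"
      using even_bond[OF sw(1) assms(7) f(1,2,4) fk(7) assms(6)] by auto
    have "n x k m * 2 + 2 * ?d x k \<le> 2 * (n x k m * ?d x m)"
      by (rule double_bond[OF ev]) (use e5 t pos in linarith)+
    then show False using b e2 L(8) ev pos by linarith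
  qed
  show "n x i m = 0"
  proof (rule ccontr)
    assume "n x i m \<noteq> 0"
    then have ev: "1 \<le> n x i m" "1 \<le> n x m i" "2 \<le> n x i m * n x m i"
      using even_bond[OF sw(2) assms(7) f(1,2,4,7) assms(6)] by auto
    have "n x i m * 2 + 2 * ?d x i \<le> 2 * (n x i m * ?d x m)"
      by (rule double_bond[OF ev]) (use e5 t pos in linarith)+
    then show False using b e1 e2 e3 L(8) ev t pos by linarith
  qed
  show "\<not> (1 \<le> n x l m \<and> 1 \<le> n x m l)"
  proof
    assume "1 \<le> n x l m \<and> 1 \<le> n x m l"
    then have ge: "?d x m \<le> n x l m * ?d x m" "?d x l \<le> n x m l * ?d x l"
      using term_ge[OF f(1) J(1)] by simp_all
    \<comment> \<open>Twice the equation of \<open>l\<close> plus that of \<open>m\<close>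
      eliminates \<open>m\<close>; the result is doubled to fit \<open>double_bond\<close>.\<close>
    have "12 + 4 * (n x l k * ?d x k) \<le> 6 * ?d x l" using e4 e5 ge t by linarith
    then have "2 * (3 * ?d x l) \<ge> 12 + n x l k * (4 * ?d x k)" by (simp add: algebra_simps)
    then have "n x k l * 12 + 2 * (4 * ?d x k) \<le> 2 * (n x k l * (3 * ?d x l))"
      by (intro double_bond[OF L(8,9)]) (use L(7) pos in simp_all)
    then have "n x k l * 12 + 8 * ?d x k \<le> 6 * (n x k l * ?d x l)" by simp
    then show False using e1 e2 e3 L(8) t pos by linarith
  qed
qed

text \<open>A double bond at a leaf would give an affine diagram with a fork at one end and a double
  bond at the other.\<close>

lemma D4_id:
  assumes "frame x y z i j" "frame x y z k j" "frame x y z m j" "i \<noteq> k" "i \<noteq> m" "k \<noteq> m"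
    and "l \<in> I" "is_id_on (\<rho> l) A"
  shows "n x k l = 0"
proof (rule ccontr)
  assume kl: "n x k l \<noteq> 0"
  note f = frame_facts[OF assms(1)] and fk = frame_facts[OF assms(2)] and fm = frame_facts[OF assms(3)]
  note l = frame_id[OF assms(1,8)] frame_id[OF assms(2,8)] frame_id[OF assms(3,8)]
  note A = frame_A3[OF assms(1,2,4) f(1)] frame_A3[OF assms(1,3,5) f(1)] frame_A3[OF assms(2,3,6) f(1)]
  note L = A3_id_end[OF assms(1,2,4,7,8) kl f(1)] A3_id_end[OF assms(3,2) assms(6)[symmetric] assms(7,8) kl f(1)]
  let ?J = "{i, k, m, j, l}"
  let ?d = "d ?J"
  have J: "?J \<subseteq> I" "?J = {k, i, m, j, l}" "?J = {m, i, k, j, l}" "?J = {j, i, k, m, l}" "?J = {l, i, k, m, j}"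
    using f(7,8) fk(7) fm(7) assms(7) by auto
  have dist: "distinct [i, k, m, j, l]" using f(15) fk(15) fm(15) l(4,5,9,14) assms(4-6) by auto
  have yx: "?d y i = ?d x i" "?d y k = ?d x k" "?d y m = ?d x m"
    using frame_d(1)[OF assms(1) J(1), of k] frame_d(1)[OF assms(2) J(1), of i] frame_d(1)[OF assms(2) J(1), of m]
      assms(4-6) by simp_all
  note s = f fk fm l A yx L(3-6,12-15) f(15)[symmetric] fk(15)[symmetric] fm(15)[symmetric]
    l(4,5,9,14)[symmetric] assms(4-6)[symmetric]
  have "2 * ?d x i = 2 + ?d x j" using d_eq5[OF f(1) refl J(1)] dist by (simp add: s)
  moreover have "2 * ?d x k = 2 + ?d x j + n x k l * ?d x l" using d_eq5[OF f(1) J(2,1)] dist by (simp add: s)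
  moreover have "2 * ?d x m = 2 + ?d x j" using d_eq5[OF f(1) J(3,1)] dist by (simp add: s)
  moreover have "2 * ?d x j = 2 + ?d x i + ?d x k + ?d x m" using d_eq5[OF f(1) J(4,1)] dist by (simp add: s)
  moreover have e: "2 * ?d x l = 2 + n x l k * ?d x k" using d_eq5[OF f(1) J(5,1)] dist by (simp add: s)
  moreover have p: "1 \<le> ?d x k" using d_pos[OF f(1) _ J(1)] by simp
  moreover have "n x k l * 2 + 2 * ?d x k \<le> 2 * (n x k l * ?d x l)"
    by (rule double_bond[OF L(8,9)]) (use L(7) e p in simp_all)
  ultimately show False using L(8) by linarith
qed

text \<open>This is the affine diagram of D4: the four leaf equations plus twice the central one
  give \<open>0 = 12\<close>.\<close>

lemma no_four_leaves:
  assumes "frame x y z i j" "frame x y z k j" "frame x y z m j" "frame x y z l j" "distinct [i, k, m, l]"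
  shows False
proof -
  note f = frame_facts[OF assms(1)] and fk = frame_facts[OF assms(2)] and fm = frame_facts[OF assms(3)]
    and fl = frame_facts[OF assms(4)]
  have dd: "i \<noteq> k" "i \<noteq> m" "i \<noteq> l" "k \<noteq> m" "k \<noteq> l" "m \<noteq> l" using assms(5) by auto
  note A = frame_A3[OF assms(1,2) dd(1) f(1)] frame_A3[OF assms(1,3) dd(2) f(1)] frame_A3[OF assms(1,4) dd(3) f(1)]
    frame_A3[OF assms(2,3) dd(4) f(1)] frame_A3[OF assms(2,4) dd(5) f(1)] frame_A3[OF assms(3,4) dd(6) f(1)]
  let ?J = "{i, k, m, l, j}"
  let ?d = "d ?J"
  have J: "?J \<subseteq> I" "?J = {k, i, m, l, j}" "?J = {m, i, k, l, j}" "?J = {l, i, k, m, j}" "?J = {j, i, k, m, l}"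
    using f(7,8) fk(7) fm(7) fl(7) by auto
  have yx: "?d y i = ?d x i" "?d y k = ?d x k" "?d y m = ?d x m" "?d y l = ?d x l"
    using frame_d(1)[OF assms(1) J(1), of k] frame_d(1)[OF assms(2) J(1), of i] frame_d(1)[OF assms(2) J(1), of m]
      frame_d(1)[OF assms(2) J(1), of l] dd by simp_all
  note s = f fk fm fl A yx dd dd[symmetric] f(15)[symmetric] fk(15)[symmetric] fm(15)[symmetric] fl(15)[symmetric]
  have "2 * ?d x i = 2 + ?d x j" using d_eq5[OF f(1) refl J(1)] by (simp add: s)
  moreover have "2 * ?d x k = 2 + ?d x j" using d_eq5[OF f(1) J(2,1)] by (simp add: s)
  moreover have "2 * ?d x m = 2 + ?d x j" using d_eq5[OF f(1) J(3,1)] by (simp add: s)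
  moreover have "2 * ?d x l = 2 + ?d x j" using d_eq5[OF f(1) J(4,1)] by (simp add: s)
  moreover have "2 * ?d x j = 2 + ?d x i + ?d x k + ?d x m + ?d x l" using d_eq5[OF f(1) J(5,1)] by (simp add: s)
  ultimately show False by linarith
qed

section \<open>Distinct transpositions and identities\<close>

lemma id_nonneg:
  assumes "frame x y z i j" "l \<in> I" "is_id_on (\<rho> l) A" "a \<in> A"
  shows "0 \<le> n a i l" "0 \<le> n a l i" "n a i l = 0 \<longleftrightarrow> n a l i = 0"
    "0 \<le> n a j l" "0 \<le> n a l j" "n a j l = 0 \<longleftrightarrow> n a l j = 0"
proof -
  note f = frame_facts[OF assms(1)] and l = frame_id[OF assms(1,3)]
  show "0 \<le> n a i l" "0 \<le> n a l i" "0 \<le> n a j l" "0 \<le> n a l j"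
    using n_nonneg[OF f(7) assms(2,4)] n_nonneg[OF assms(2) f(7) assms(4)]
      n_nonneg[OF f(8) assms(2,4)] n_nonneg[OF assms(2) f(8) assms(4)] l by force+
  show "n a i l = 0 \<longleftrightarrow> n a l i = 0" "n a j l = 0 \<longleftrightarrow> n a l j = 0"
    using n_zero_sym[OF f(7) assms(2,4)] n_zero_sym[OF assms(2) f(7) assms(4)]
      n_zero_sym[OF f(8) assms(2,4)] n_zero_sym[OF assms(2) f(8) assms(4)] by blast+
qed

lemma id_even:
  assumes "frame x y z i j" "l \<in> I" "is_id_on (\<rho> l) A" "n y l j \<noteq> 0"
  shows "1 \<le> n y j l" "1 \<le> n y l j" "1 \<le> n z l j" "2 \<le> n y j l * n y l j" "2 \<le> n y j l * n z l j" "n z j l = n y j l"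
proof -
  note f = frame_facts[OF assms(1)]
  have sw: "swaps_fixes (\<rho> j) y z x" "swaps_fixes (\<rho> j) z y x"
    using assms(1) by (auto simp: frame_def swaps_fixes_def)
  show c: "n z j l = n y j l" using frame_n(2)[OF assms(1,2)] .
  show y: "1 \<le> n y j l" "1 \<le> n y l j" "2 \<le> n y j l * n y l j"
    using even_bond[OF sw(1) assms(3) f(2,3,5,8) assms(2)] assms(4) by auto
  then have "n z j l \<noteq> 0" using c by simp
  then show "1 \<le> n z l j" "2 \<le> n y j l * n z l j"
    using even_bond[OF sw(2) assms(3) f(3,2) f(5)[symmetric] f(8) assms(2)] c by auto
qed

lemma frame_id_eqs:
  assumes "frame x y z i j" "l \<in> I" "is_id_on (\<rho> l) A" "J = {i, j, l}"
  shows "d J x i + d J y i = 2 + n x i j * d J x j + n x i l * d J x l"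
    "2 * d J y i = 2 + n z i j * d J z j + n z i l * d J x l"
    "d J x j + d J z j = 2 + n y j i * d J y i + n y j l * d J x l"
    "2 * d J x j = 2 + n x j i * d J x i + n x j l * d J x l"
    "2 * d J x l = 2 + n x l i * d J x i + n x l j * d J x j"
    "2 * d J x l = 2 + n y l i * d J y i + n y l j * d J x j"
    "2 * d J x l = 2 + n z l i * d J y i + n z l j * d J z j"
    "1 \<le> d J x i" "1 \<le> d J y i" "1 \<le> d J z j" "1 \<le> d J x j" "1 \<le> d J x l"
proof -
  note f = frame_facts[OF assms(1)] and l = frame_id[OF assms(1,3)]
  have J: "J \<subseteq> I" "J = {j, i, l}" "J = {l, i, j}" using f(7,8) assms(2,4) by auto
  have yx: "d J y j = d J x j" "d J y l = d J x l" "d J z i = d J y i" "d J z l = d J x l"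
    using frame_d[OF assms(1) J(1)] l f(15) assms(4) by auto
  note e = d_eq3[OF _ assms(4) J(1)] d_eq3[OF _ J(2,1)] d_eq3[OF _ J(3,1)]
  note s = f l yx f(15)[symmetric] l(4,5)[symmetric]
  show "d J x i + d J y i = 2 + n x i j * d J x j + n x i l * d J x l" using e(1)[of x] by (simp add: s)
  show "2 * d J y i = 2 + n z i j * d J z j + n z i l * d J x l" using e(1)[of z] by (simp add: s)
  show "d J x j + d J z j = 2 + n y j i * d J y i + n y j l * d J x l" using e(2)[of y] by (simp add: s)
  show "2 * d J x j = 2 + n x j i * d J x i + n x j l * d J x l" using e(2)[of x] by (simp add: s)
  show "2 * d J x l = 2 + n x l i * d J x i + n x l j * d J x j" using e(3)[of x] by (simp add: s)
  show "2 * d J x l = 2 + n y l i * d J y i + n y l j * d J x j" using e(3)[of y] by (simp add: s)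
  show "2 * d J x l = 2 + n z l i * d J y i + n z l j * d J z j" using e(3)[of z] by (simp add: s)
  show "1 \<le> d J x i" "1 \<le> d J y i" "1 \<le> d J z j" "1 \<le> d J x j" "1 \<le> d J x l"
    using d_pos[OF _ _ J(1)] assms(4) by (simp_all add: f)
qed

text \<open>Both \<open>i\<close> and \<open>j\<close> move \<open>y\<close>, so both bonds of
  \<open>l\<close> would be even there. Reversing the frame gives the estimates for
  \<open>i\<close>, and \<open>arith_triangle\<close> excludes the resulting triangle.\<close>

lemma no_id_triangle:
  assumes "frame x y z i j" "l \<in> I" "is_id_on (\<rho> l) A" "n y l j \<noteq> 0"
  shows "n y l i = 0"
proof (rule ccontr)
  assume li: "n y l i \<noteq> 0"
  note f = frame_facts[OF assms(1)]
  note e = frame_id_eqs[OF assms(1-3) refl]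
  note ev = id_even[OF assms] and ev' = id_even[OF frame_sym[OF assms(1)] assms(2,3) li]
  note np = frame_n_pos[OF assms(1)]
  note nn = id_nonneg[OF assms(1-3)]
  have "n x i l = n y i l" using ev'(6) .
  show False
    by (rule arith_triangle[OF e(8-12) np(1)[OF f(1)] np(2)[OF f(2)] np(1)[OF f(3)] np(2)[OF f(1)]
          ev'(1) ev'(3) ev'(2) ev(1) ev(3) ev(2) nn(1)[OF f(3)] nn(4)[OF f(1)] nn(5)[OF f(1)] nn(2)[OF f(3)]
          ev'(5,4) ev(5,4) _ e(2-7)])
      (use e(1) ev'(6) in simp)
qed

text \<open>One bond at \<open>y\<close> fixes all entries of \<open>i\<close>, \<open>j\<close>,
  \<open>l\<close> at all objects up to the orientation of the double bond. Row \<open>l\<close> is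
  compared between \<open>x\<close> and \<open>y\<close> by the equation of \<open>l\<close>, and
  between \<open>y\<close> and \<open>z\<close> by \<open>double_bond_const\<close>.\<close>

lemma id_bond:
  assumes "frame x y z i j" "l \<in> I" "is_id_on (\<rho> l) A" "n y l j \<noteq> 0" "a \<in> A"
  shows "n a i j = 1" "n a j i = 1" "n a i l = 0" "n a l i = 0" "n a j l = n y j l" "n a l j = n y l j"
    "n y j l * n y l j = 2" "1 \<le> n y j l" "1 \<le> n y l j"
proof -
  note f = frame_facts[OF assms(1)]
  note e = frame_id_eqs[OF assms(1-3) refl]
  note ev = id_even[OF assms(1-4)]
  note np = frame_n_pos[OF assms(1)]
  note nn = id_nonneg[OF assms(1-3)]
  have yi: "n y l i = 0" "n y i l = 0" using no_id_triangle[OF assms(1-4)] nn(3)[OF f(2)] by auto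
  have xi: "n x i l = 0" "n x l i = 0" using frame_n(1)[OF assms(1,2)] yi nn(3)[OF f(1)] by auto
  have "2 * d {i, j, l} x l = 2 + n x l j * d {i, j, l} x j" "2 * d {i, j, l} x l = 2 + n y l j * d {i, j, l} x j"
    using e(5,6) xi yi by simp_all
  then have "n x l j * d {i, j, l} x j = n y l j * d {i, j, l} x j" by linarith
  then have lj: "n x l j = n y l j" using e(11) by simp
  then have "n x j l \<noteq> 0" using nn(6)[OF f(1)] assms(4) by simp
  then have jl: "1 \<le> n x j l" using nn(4)[OF f(1)] by simp
  have sw: "swaps_fixes (\<rho> j) y z x" "swaps_fixes (\<rho> j) z y x"
    using assms(1) by (auto simp: frame_def swaps_fixes_def)
  have B2: "n y j l * n y l j = 2 \<Longrightarrow> n z l j = n y l j" "n y j l * n z l j = 2 \<Longrightarrow> n z l j = n y l j"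
  proof -
    show "n y j l * n y l j = 2 \<Longrightarrow> n z l j = n y l j"
      by (rule double_bond_const[OF sw(1) assms(3) f(2,3,5,8) assms(2) ev(1,2)])
    assume "n y j l * n z l j = 2"
    then have "n z j l * n z l j = 2" by (simp only: ev(6))
    then have "n y l j = n z l j"
      using double_bond_const[OF sw(2) assms(3) f(3,2) f(5)[symmetric] f(8) assms(2) _ ev(3)] ev(1,6) by metis
    then show "n z l j = n y l j" ..
  qed
  have e1: "d {i, j, l} x i + d {i, j, l} y i = 2 + n x i j * d {i, j, l} x j"
    and e6: "2 * d {i, j, l} x l = 2 + n y l j * d {i, j, l} x j" using e(1,6) xi yi by simp_all
  have *: "n x i j = 1 \<and> n y j i = 1 \<and> n z i j = 1 \<and> n x j i = 1 \<and> n z l j = n y l j \<and>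
      n y j l * n z l j = 2 \<and> n z i l = 0 \<and> n z l i = 0 \<and> n x j l = n y j l"
    by (rule arith_B3[OF e(8-12) np(1)[OF f(1)] np(2)[OF f(2)] np(1)[OF f(3)] np(2)[OF f(1)]
          ev(1,3,2) nn(1)[OF f(3)] jl nn(2,3)[OF f(3)] ev(5,4) B2 frame_not_B2(1)[OF assms(1)] e1 e(2-4) e6 e(7)])
  have y: "n y i j = 1" "n z j i = 1" using * frame_n[OF assms(1)] f by simp_all
  show "n a i j = 1" "n a j i = 1" "n a i l = 0" "n a l i = 0" "n a j l = n y j l" "n a l j = n y l j"
    using * y lj xi yi ev(6) by (cases rule: frame_cases[OF assms(1,5)]; simp)+
  show "n y j l * n y l j = 2" "1 \<le> n y j l" "1 \<le> n y l j" using * ev by auto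
qed

lemma id_attached:
  assumes "frame x y z i j" "l \<in> I" "is_id_on (\<rho> l) A" "a \<in> A" "n a l i \<noteq> 0 \<or> n a l j \<noteq> 0"
  shows "n y l i \<noteq> 0 \<or> n y l j \<noteq> 0"
proof (rule ccontr)
  assume c: "\<not> ?thesis"
  note f = frame_facts[OF assms(1)] and l = frame_id[OF assms(1,3)]
  have J: "{i, j, l} \<subseteq> I" using f(7,8) assms(2) by auto
  have "n a l m = 0" if "m \<in> {i, j, l}" "m \<noteq> l" for m
    using isolated_everywhere[OF assms(1) _ _ J, of l y a m] c f(2) assms(4) that by blast
  then show False using assms(5) l by (metis insertCI)
qed

text \<open>\<open>arith_F4\<close> settles the entries in the equations at \<open>x\<close> and
  \<open>z\<close>; the remaining ones follow because \<open>l\<close> and \<open>m\<close> have the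
  same coordinates at all objects.\<close>

lemma F4_bond:
  assumes "frame x y z i j" "l \<in> I" "is_id_on (\<rho> l) A" "n y l j \<noteq> 0"
    and "m \<in> I" "is_id_on (\<rho> m) A" "l \<noteq> m"
    and "\<And>a. a \<in> A \<Longrightarrow> n a m i = 0 \<and> n a m j = 0 \<and> n a m l \<noteq> 0" "a \<in> A"
  shows "n a l m = 1" "n a m l = 1"
proof -
  note f = frame_facts[OF assms(1)] and l = frame_id[OF assms(1,3)] and m = frame_id[OF assms(1,6)]
  note L = id_bond[OF assms(1-4)]
  have z: "n b m i = 0" "n b m j = 0" "n b i m = 0" "n b j m = 0" "1 \<le> n b m l" "1 \<le> n b l m" if b: "b \<in> A" for b
  proof -
    show 0: "n b m i = 0" "n b m j = 0" using assms(8)[OF b] by simp_all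
    then show "n b i m = 0" "n b j m = 0"
      using id_nonneg(3,6)[OF assms(1,5,6) b] by simp_all
    have "n b m l \<noteq> 0" using assms(8)[OF b] by simp
    moreover from this have "n b l m \<noteq> 0" using n_zero_sym[OF assms(2,5) b] by blast
    ultimately show "1 \<le> n b m l" "1 \<le> n b l m"
      using n_nonneg[OF assms(5,2) b] n_nonneg[OF assms(2,5) b] assms(7) by force+
  qed
  let ?J = "{i, j, l, m}"
  let ?d = "d ?J"
  have J: "?J \<subseteq> I" "?J = {j, i, l, m}" "?J = {l, i, j, m}" "?J = {m, i, j, l}" using f(7,8) assms(2,5) by auto
  have yx: "?d y j = ?d x j" "?d y l = ?d x l" "?d z i = ?d y i" "?d z l = ?d x l" "?d y m = ?d x m" "?d z m = ?d x m"
    using frame_d[OF assms(1) J(1)] by (simp_all add: l m f(15) f(15)[symmetric])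
  note e = d_eq4[OF _ refl J(1)] d_eq4[OF _ J(2,1)] d_eq4[OF _ J(3,1)] d_eq4[OF _ J(4,1)]
  note s = f l m yx f(15)[symmetric] l(4,5)[symmetric] m(4,5)[symmetric] assms(7) assms(7)[symmetric]
    L(1-6)[OF f(1)] L(1-4)[OF f(2)] L(1-6)[OF f(3)] z(1-4)[OF f(1)] z(1-4)[OF f(2)] z(1-4)[OF f(3)]
  have e1: "?d x i + ?d y i = 2 + ?d x j" using e(1)[of x] by (simp add: s)
  have e2: "2 * ?d y i = 2 + ?d z j" using e(1)[of z] by (simp add: s)
  have e3: "?d x j + ?d z j = 2 + ?d y i + n y j l * ?d x l" using e(2)[of y] by (simp add: s)
  have e4: "2 * ?d x l = 2 + n y l j * ?d x j + n x l m * ?d x m" using e(3)[of x] by (simp add: s)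
  have e4y: "2 * ?d x l = 2 + n y l j * ?d x j + n y l m * ?d x m" using e(3)[of y] by (simp add: s)
  have e5: "2 * ?d x l = 2 + n y l j * ?d z j + n z l m * ?d x m" using e(3)[of z] by (simp add: s)
  have e6: "2 * ?d x m = 2 + n x m l * ?d x l" using e(4)[of x] by (simp add: s)
  have e6y: "2 * ?d x m = 2 + n y m l * ?d x l" using e(4)[of y] by (simp add: s)
  have e6z: "2 * ?d x m = 2 + n z m l * ?d x l" using e(4)[of z] by (simp add: s)
  have pos: "1 \<le> ?d x i" "1 \<le> ?d y i" "1 \<le> ?d z j" "1 \<le> ?d x j" "1 \<le> ?d x l" "1 \<le> ?d x m"
    using d_pos[OF _ _ J(1)] by (simp_all add: f)
  have *: "n x m l = 1 \<and> n x l m = 1 \<and> n z l m = 1"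
    by (rule arith_F4[OF pos L(8,9)[OF f(1)] z(5,6)[OF f(1)] z(6)[OF f(3)] L(7)[OF f(1)] e1 e2 e3 e4 e5 e6])
  have "n y l m * ?d x m = n x l m * ?d x m" using e4 e4y by linarith
  then have y: "n y l m = 1" using pos(6) * by simp
  have "n y m l * ?d x l = n x m l * ?d x l" "n z m l * ?d x l = n x m l * ?d x l" using e6 e6y e6z by linarith+
  then have "n y m l = 1" "n z m l = 1" using pos(5) * by simp_all
  then show "n a l m = 1" "n a m l = 1" using * y by (cases rule: frame_cases[OF assms(1,9)]; simp)+
qed

lemma bond_pos:
  assumes "a \<in> A" "l \<in> I" "m \<in> I" "l \<noteq> m" "n a m l \<noteq> 0"
  shows "1 \<le> n a m l" "1 \<le> n a l m"
proof -
  have "n a l m \<noteq> 0" using n_zero_sym[OF assms(2,3,1)] assms(5) by blast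
  then show "1 \<le> n a m l" "1 \<le> n a l m"
    using n_nonneg[OF assms(3,2,1)] n_nonneg[OF assms(2,3,1)] assms(4,5) by force+
qed

text \<open>Two double bonds at \<open>j\<close>, or double bonds at both ends of the chain
  \<open>m\<close>, \<open>i\<close>, \<open>j\<close>, \<open>l\<close>, contain affine diagrams.
  \<open>id_bond\<close>, also for the reversed frame, supplies the entries at
  \<open>x\<close>.\<close>

lemma two_ids:
  assumes "frame x y z i j" "l \<in> I" "is_id_on (\<rho> l) A" "n y l j \<noteq> 0"
    and "m \<in> I" "is_id_on (\<rho> m) A" "l \<noteq> m"
  shows "n y m j = 0" "n y m i = 0"
proof -
  note f = frame_facts[OF assms(1)] and l = frame_id[OF assms(1,3)] and m = frame_id[OF assms(1,6)]
  note L = id_bond[OF assms(1-4)]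
  let ?J = "{i, j, l, m}"
  let ?d = "d ?J"
  have J: "?J \<subseteq> I" "?J = {j, i, l, m}" "?J = {l, i, j, m}" "?J = {m, i, j, l}" using f(7,8) assms(2,5) by auto
  have yx: "?d y j = ?d x j" "?d y l = ?d x l" "?d y m = ?d x m"
    using frame_d[OF assms(1) J(1)] by (simp_all add: l m f(15) f(15)[symmetric])
  note e = d_eq4[OF _ refl J(1)] d_eq4[OF _ J(2,1)] d_eq4[OF _ J(3,1)] d_eq4[OF _ J(4,1)]
  note s = f l m yx f(15)[symmetric] l(4,5)[symmetric] m(4,5)[symmetric] assms(7) assms(7)[symmetric]
    L(1-6)[OF f(1)] L(1-4)[OF f(2)]
  have e1: "?d x i + ?d y i = 2 + ?d x j + n x i m * ?d x m" using e(1)[of x] by (simp add: s)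
  have e2: "2 * ?d x j = 2 + ?d x i + n y j l * ?d x l + n x j m * ?d x m" using e(2)[of x] by (simp add: s)
  have e3: "2 * ?d x l = 2 + n y l j * ?d x j + n x l m * ?d x m" using e(3)[of x] by (simp add: s)
  have e4: "2 * ?d x m = 2 + n x m i * ?d x i + n x m j * ?d x j + n x m l * ?d x l" using e(4)[of x] by (simp add: s)
  have e5: "2 * ?d x m = 2 + n y m i * ?d y i + n y m j * ?d x j + n y m l * ?d x l" using e(4)[of y] by (simp add: s)
  have pos: "1 \<le> ?d x i" "1 \<le> ?d y i" "1 \<le> ?d x j" "1 \<le> ?d x l" "1 \<le> ?d x m"
    using d_pos[OF _ _ J(1)] by (simp_all add: f)
  note nx = id_nonneg[OF assms(1,5,6) f(1)] and ny = id_nonneg[OF assms(1,5,6) f(2)]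
  have t: "0 \<le> n x i m * ?d x m" "0 \<le> n x j m * ?d x m" "0 \<le> n x m i * ?d x i" "0 \<le> n x m j * ?d x j"
    "0 \<le> n y m i * ?d y i" "0 \<le> n y m j * ?d x j"
    "0 \<le> n x l m * ?d x m" "0 \<le> n x m l * ?d x l" "0 \<le> n y m l * ?d x l"
    using nx ny pos n_nonneg[OF assms(2,5) f(1)] n_nonneg[OF assms(5,2) f(1)] n_nonneg[OF assms(5,2) f(2)] assms(7)
    by (simp_all add: assms(7)[symmetric])
  have b: "n y j l * 2 + 2 * ?d x j \<le> 2 * (n y j l * ?d x l)"
    by (rule double_bond[OF L(8,9)[OF f(1)]]) (use L(7)[OF f(1)] in simp, use e3 t pos in linarith, use pos in linarith)
  show "n y m j = 0"
  proof (rule ccontr)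
    assume mj: "n y m j \<noteq> 0"
    note M = id_bond[OF assms(1,5,6) mj f(1)]
    have "n y j m * 2 + 2 * ?d x j \<le> 2 * (n y j m * ?d x m)"
      by (rule double_bond[OF M(8,9)]) (use M(7) in simp, use e5 t pos in linarith, use pos in linarith)
    moreover have "n x j m * ?d x m = n y j m * ?d x m" using M(5) by simp
    ultimately show False using b e2 L(8)[OF f(1)] M(8) pos by linarith
  qed
  show "n y m i = 0"
  proof (rule ccontr)
    assume mi: "n y m i \<noteq> 0"
    note M = id_bond[OF frame_sym[OF assms(1)] assms(5,6) mi f(1)]
    have "n y i m * 2 + 2 * ?d y i \<le> 2 * (n y i m * ?d x m)"
      by (rule double_bond[OF M(8,9)]) (use M(7) in simp, use e5 t pos in linarith, use pos in linarith)
    moreover have "n x i m * ?d x m = n y i m * ?d x m" using M(5) by simp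
    ultimately show False using b e1 e2 t L(8)[OF f(1)] M(8) pos by linarith
  qed
qed

text \<open>A fork at \<open>l\<close> next to the double bond to \<open>j\<close> is at least as
  heavy as an affine diagram.\<close>

lemma no_branch:
  assumes "frame x y z i j" "l \<in> I" "is_id_on (\<rho> l) A" "n y l j \<noteq> 0"
    and "m \<in> I" "is_id_on (\<rho> m) A" "m' \<in> I" "is_id_on (\<rho> m') A" "distinct [l, m, m']"
    and "n x m l \<noteq> 0" "n x m' l \<noteq> 0"
  shows False
proof -
  note f = frame_facts[OF assms(1)] and l = frame_id[OF assms(1,3)] and m = frame_id[OF assms(1,6)]
    and m' = frame_id[OF assms(1,8)]
  note L = id_bond[OF assms(1-4) f(1)]
  let ?J = "{i, j, l, m, m'}"
  let ?d = "d ?J"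
  have J: "?J \<subseteq> I" "?J = {j, i, l, m, m'}" "?J = {l, i, j, m, m'}" "?J = {m, i, j, l, m'}" "?J = {m', i, j, l, m}"
    using f(7,8) assms(2,5,7) by auto
  have dd: "l \<noteq> m" "l \<noteq> m'" "m \<noteq> m'" using assms(9) by auto
  note s = f l m m' dd dd[symmetric] f(15)[symmetric] l(4,5)[symmetric] m(4,5)[symmetric] m'(4,5)[symmetric] L(1-6)
  note bm = bond_pos[OF f(1) assms(2,5) dd(1) assms(10)] and bm' = bond_pos[OF f(1) assms(2,7) dd(2) assms(11)]
  note ge = term_ge[OF f(1) J(1)] and nn = term_nonneg[OF f(1) J(1)]
  have t: "?d x l \<le> n x m l * ?d x l" "?d x m \<le> n x l m * ?d x m" "?d x l \<le> n x m' l * ?d x l" "?d x m' \<le> n x l m' * ?d x m'"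
    "0 \<le> n x j m * ?d x m" "0 \<le> n x j m' * ?d x m'" "0 \<le> n x m i * ?d x i" "0 \<le> n x m j * ?d x j"
    "0 \<le> n x m m' * ?d x m'" "0 \<le> n x m' i * ?d x i" "0 \<le> n x m' j * ?d x j" "0 \<le> n x m' m * ?d x m"
    using ge[of l m] ge[of m l] ge[of l m'] ge[of m' l] bm bm'
      nn[of j m] nn[of j m'] nn[of m i] nn[of m j] nn[of m m'] nn[of m' i] nn[of m' j] nn[of m' m]
    by (simp_all add: s assms(5,7))
  have e2: "2 * ?d x j = 2 + ?d x i + n y j l * ?d x l + n x j m * ?d x m + n x j m' * ?d x m'"
    using d_eq5[OF f(1) J(2,1)] by (simp add: s)
  have e3: "2 * ?d x l = 2 + n y l j * ?d x j + n x l m * ?d x m + n x l m' * ?d x m'"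
    using d_eq5[OF f(1) J(3,1)] by (simp add: s)
  have e4: "2 * ?d x m = 2 + n x m i * ?d x i + n x m j * ?d x j + n x m l * ?d x l + n x m m' * ?d x m'"
    using d_eq5[OF f(1) J(4,1)] by (simp add: s)
  have e5: "2 * ?d x m' = 2 + n x m' i * ?d x i + n x m' j * ?d x j + n x m' l * ?d x l + n x m' m * ?d x m"
    using d_eq5[OF f(1) J(5,1)] by (simp add: s)
  have pos: "1 \<le> ?d x i" "1 \<le> ?d x j" using d_pos[OF f(1) _ J(1)] by simp_all
  \<comment> \<open>Twice the equation of \<open>l\<close> plus those of \<open>m\<close> and
    \<open>m'\<close> eliminates the two leaves.\<close>
  have "8 + 2 * (n y l j * ?d x j) \<le> 2 * ?d x l" using e3 e4 e5 t by linarith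
  then have "n y j l * 8 + 2 * (2 * ?d x j) \<le> 2 * (n y j l * ?d x l)"
    by (intro double_bond[OF L(8,9)]) (use L(7) pos in simp_all)
  then show False using e2 t pos L(8) by linarith
qed

text \<open>A chain of five indices with the double bond second is the affine extension of F4 or its
  twisted form. The coordinate of \<open>j\<close> may differ at \<open>x\<close> and
  \<open>z\<close>, so bounds at both objects are combined.\<close>

lemma no_long_chain:
  assumes "frame x y z i j" "l \<in> I" "is_id_on (\<rho> l) A" "n y l j \<noteq> 0"
    and "m \<in> I" "is_id_on (\<rho> m) A" "m' \<in> I" "is_id_on (\<rho> m') A" "distinct [l, m, m']"
    and "\<And>a. a \<in> A \<Longrightarrow> n a m l \<noteq> 0" "\<And>a. a \<in> A \<Longrightarrow> n a m' m \<noteq> 0"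
  shows False
proof -
  note f = frame_facts[OF assms(1)] and l = frame_id[OF assms(1,3)] and m = frame_id[OF assms(1,6)]
    and m' = frame_id[OF assms(1,8)]
  note L = id_bond[OF assms(1-4)]
  let ?J = "{i, j, l, m, m'}"
  let ?d = "d ?J"
  have J: "?J \<subseteq> I" "?J = {j, i, l, m, m'}" "?J = {l, i, j, m, m'}" "?J = {m, i, j, l, m'}" "?J = {m', i, j, l, m}"
    using f(7,8) assms(2,5,7) by auto
  have dd: "l \<noteq> m" "l \<noteq> m'" "m \<noteq> m'" using assms(9) by auto
  have yx: "?d y j = ?d x j" "?d y l = ?d x l" "?d y m = ?d x m" "?d y m' = ?d x m'"
    "?d z i = ?d y i" "?d z l = ?d x l" "?d z m = ?d x m" "?d z m' = ?d x m'"
    using frame_d[OF assms(1) J(1)] by (simp_all add: l m m' f(15) f(15)[symmetric])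
  note s = f l m m' dd dd[symmetric] f(15)[symmetric] l(4,5)[symmetric] m(4,5)[symmetric] m'(4,5)[symmetric] yx
    L(1-6)[OF f(1)] L(1-4)[OF f(2)] L(1-6)[OF f(3)]
  have t: "?d a l \<le> n a m l * ?d a l" "?d a m \<le> n a l m * ?d a m" "?d a m \<le> n a m' m * ?d a m" "?d a m' \<le> n a m m' * ?d a m'"
    "0 \<le> n a i m * ?d a m" "0 \<le> n a i m' * ?d a m'" "0 \<le> n a j m * ?d a m" "0 \<le> n a j m' * ?d a m'"
    "0 \<le> n a l m' * ?d a m'" "0 \<le> n a m i * ?d a i" "0 \<le> n a m j * ?d a j"
    "0 \<le> n a m' i * ?d a i" "0 \<le> n a m' j * ?d a j" "0 \<le> n a m' l * ?d a l" if a: "a \<in> A" for a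
  proof -
    note bm = bond_pos[OF a assms(2,5) dd(1) assms(10)[OF a]] and bm' = bond_pos[OF a assms(5,7) dd(3) assms(11)[OF a]]
    note ge = term_ge[OF a J(1)] and nn = term_nonneg[OF a J(1)]
    show "?d a l \<le> n a m l * ?d a l" "?d a m \<le> n a l m * ?d a m" "?d a m \<le> n a m' m * ?d a m" "?d a m' \<le> n a m m' * ?d a m'"
      using ge bm bm' by simp_all
    show "0 \<le> n a i m * ?d a m" "0 \<le> n a i m' * ?d a m'" "0 \<le> n a j m * ?d a m" "0 \<le> n a j m' * ?d a m'"
      "0 \<le> n a l m' * ?d a m'" "0 \<le> n a m i * ?d a i" "0 \<le> n a m j * ?d a j"
      "0 \<le> n a m' i * ?d a i" "0 \<le> n a m' j * ?d a j" "0 \<le> n a m' l * ?d a l"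
      using nn[of i m] nn[of i m'] nn[of j m] nn[of j m'] nn[of l m'] nn[of m i] nn[of m j] nn[of m' i] nn[of m' j] nn[of m' l]
      by (simp_all add: s assms(2,5,7))
  qed
  have e1: "2 * ?d y i = 2 + ?d z j + n z i m * ?d x m + n z i m' * ?d x m'"
    using d_eq5[OF f(3) refl J(1)] by (simp add: s)
  have e2: "?d x j + ?d z j = 2 + ?d y i + n y j l * ?d x l + n y j m * ?d x m + n y j m' * ?d x m'"
    using d_eq5[OF f(2) J(2,1)] by (simp add: s)
  have e3: "2 * ?d x l = 2 + n y l j * ?d x j + n x l m * ?d x m + n x l m' * ?d x m'"
    using d_eq5[OF f(1) J(3,1)] by (simp add: s)
  have e4: "2 * ?d x l = 2 + n y l j * ?d z j + n z l m * ?d x m + n z l m' * ?d x m'"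
    using d_eq5[OF f(3) J(3,1)] by (simp add: s)
  have e5: "2 * ?d x m = 2 + n x m i * ?d x i + n x m j * ?d x j + n x m l * ?d x l + n x m m' * ?d x m'"
    using d_eq5[OF f(1) J(4,1)] by (simp add: s)
  have e6: "2 * ?d x m' = 2 + n x m' i * ?d x i + n x m' j * ?d x j + n x m' l * ?d x l + n x m' m * ?d x m"
    using d_eq5[OF f(1) J(5,1)] by (simp add: s)
  have pos: "1 \<le> ?d x j" "1 \<le> ?d z j" using d_pos[OF _ _ J(1)] by (simp_all add: f)
  note tx = t[OF f(1)] and ty = t[OF f(2), unfolded yx] and tz = t[OF f(3), unfolded yx]
  note LL = L[OF f(1)]
  \<comment> \<open>The equations of \<open>l\<close>, \<open>m\<close>, \<open>m'\<close> with the
    weights 3, 2, 1 eliminate \<open>m\<close> and \<open>m'\<close>.\<close>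
  have "12 + 3 * (n y l j * ?d x j) \<le> 4 * ?d x l" using e3 e5 e6 tx by linarith
  then have b: "n y j l * 12 + 2 * (3 * ?d x j) \<le> 2 * (n y j l * (2 * ?d x l))"
    by (intro double_bond[OF LL(8,9)]) (use LL(7) pos in simp_all)
  have "12 + 3 * (n y l j * ?d z j) \<le> 4 * ?d x l" using e4 e5 e6 tx tz by linarith
  then have w: "n y j l * 12 + 2 * (3 * ?d z j) \<le> 2 * (n y j l * (2 * ?d x l))"
    by (intro double_bond[OF LL(8,9)]) (use LL(7) pos in simp_all)
  have "n y j l * (2 * ?d x l) = 2 * (n y j l * ?d x l)" by simp
  then show False using b w e1 e2 ty tz LL(8) by linarith
qed

text \<open>If \<open>p\<close> is the only possible neighbour of \<open>k\<close>, losing it at one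
  object would isolate \<open>k\<close> there, hence everywhere.\<close>

lemma attached_everywhere:
  assumes "frame x y z i j" "i \<in> J" "j \<in> J" "J \<subseteq> I" "k \<in> J" "p \<in> J" "p \<noteq> k"
    and "\<And>b q. b \<in> A \<Longrightarrow> q \<in> J \<Longrightarrow> q \<noteq> k \<Longrightarrow> q \<noteq> p \<Longrightarrow> n b k q = 0"
    and "a \<in> A" "n a k p \<noteq> 0" "b \<in> A"
  shows "n b k p \<noteq> 0"
proof
  assume "n b k p = 0"
  then have "\<And>q. q \<in> J \<Longrightarrow> q \<noteq> k \<Longrightarrow> n b k q = 0" using assms(8)[OF assms(11)] by metis
  then show False
    using isolated_everywhere[OF assms(1-5) assms(11,9) _ assms(6,7)] assms(10) by blast
qed

text \<open>Serves to enlarge the diagram. The object of the new bond is arbitrary, which is why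
  attachment has to be carried between objects.\<close>

lemma irreducible_attached:
  assumes "rs_irreducible I A R" "S \<subseteq> I" "S \<noteq> {}" "S \<noteq> I"
  shows "\<exists>a s l. a \<in> A \<and> s \<in> S \<and> l \<in> I \<and> l \<notin> S \<and> n a l s \<noteq> 0"
proof (rule ccontr)
  assume c: "\<not> ?thesis"
  have "n a s l = 0" if "a \<in> A" "s \<in> S" "l \<in> I - S" for a s l
    using that n_zero_sym[of l s a] assms(2) c by blast
  moreover have "S \<union> (I - S) = I" "S \<inter> (I - S) = {}" "I - S \<noteq> {}" using assms by auto
  ultimately have "rs_reducible I A R" using reducible_of_blocks[of S "I - S"] assms(3) by blast
  then show False using assms(1) by (simp add: rs_irreducible_def)
qed

section \<open>Classification\<close>

text \<open>The type is demanded at every object, so standardness can be read off.\<close>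

definition classified :: "'a \<Rightarrow> 'a \<Rightarrow> 'a \<Rightarrow> (nat \<Rightarrow> nat) \<Rightarrow> bool" where
  "classified x y z p \<longleftrightarrow> objs x y z \<and> bij_betw p {1..4} I \<and>
     (let is_type = (\<lambda>M. \<forall>a\<in>A. mat_eq4 (\<lambda>i j. C a (p i) (p j)) M); r = (\<lambda>i. \<rho> (p i)) in
       ((is_type cartan_B4 \<or> is_type cartan_C4) \<and>
          swaps_fixes (r 1) x y z \<and> swaps_fixes (r 3) x y z \<and>
          swaps_fixes (r 2) y z x \<and> is_id_on (r 4) A)
     \<or> (is_type cartan_D4 \<and>
          swaps_fixes (r 1) x y z \<and> swaps_fixes (r 3) x y z \<and> swaps_fixes (r 4) x y z \<and>
          swaps_fixes (r 2) y z x)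
     \<or> ((is_type cartan_F4 \<or> is_type cartan_F4') \<and>
          swaps_fixes (r 1) x y z \<and> swaps_fixes (r 2) y z x \<and>
          is_id_on (r 3) A \<and> is_id_on (r 4) A))"

definition enum4 :: "nat \<Rightarrow> nat \<Rightarrow> nat \<Rightarrow> nat \<Rightarrow> nat \<Rightarrow> nat" where
  "enum4 i j k l s = [i, j, k, l] ! (s - 1)"

lemma enum4_simps [simp]:
  "enum4 i j k l 1 = i" "enum4 i j k l (Suc 0) = i" "enum4 i j k l 2 = j" "enum4 i j k l 3 = k" "enum4 i j k l 4 = l"
  by (simp_all add: enum4_def)

lemma one_to_four: "{1..4::nat} = {1, 2, 3, 4}"
  by auto

lemma enum4_bij:
  assumes "distinct [i, j, k, l]" "I = {i, j, k, l}"
  shows "bij_betw (enum4 i j k l) {1..4} I"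
proof -
  have "enum4 i j k l ` {1..4} = I" unfolding one_to_four assms(2) by simp
  moreover have "inj_on (enum4 i j k l) {1..4}" unfolding one_to_four using assms(1) by simp
  ultimately show ?thesis by (simp add: bij_betw_def)
qed

lemma mat_eq4_enum4:
  assumes "a \<in> A" "i \<in> I" "j \<in> I" "k \<in> I" "l \<in> I"
    and "M 1 1 = 2" "M 2 2 = 2" "M 3 3 = 2" "M 4 4 = 2"
    and "n a i j = - M 1 2" "n a i k = - M 1 3" "n a i l = - M 1 4"
      "n a j i = - M 2 1" "n a j k = - M 2 3" "n a j l = - M 2 4"
      "n a k i = - M 3 1" "n a k j = - M 3 2" "n a k l = - M 3 4"
      "n a l i = - M 4 1" "n a l j = - M 4 2" "n a l k = - M 4 3"
  shows "mat_eq4 (\<lambda>s t. C a (enum4 i j k l s) (enum4 i j k l t)) M"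
  using assms(6-) C_diag[OF _ assms(1)] assms(2-5)
  unfolding mat_eq4_def one_to_four n_def by simp

section \<open>Two transpositions, each occurring once: type F4\<close>

lemma single_case_aux:
  assumes irr: "rs_irreducible I A R" and card: "4 \<le> card I"
    and fr: "frame x y z i j"
    and ids: "\<And>l. l \<in> I \<Longrightarrow> l \<noteq> i \<Longrightarrow> l \<noteq> j \<Longrightarrow> is_id_on (\<rho> l) A"
    and l: "l \<in> I" "l \<noteq> i" "l \<noteq> j" "n y l j \<noteq> 0"
  shows "\<exists>p. classified x y z p"
proof -
  note f = frame_facts[OF fr]
  note lid = ids[OF l(1-3)]
  have unattached: "n b m i = 0" "n b m j = 0" if m: "m \<in> I" "m \<notin> {i, j, l}" and b: "b \<in> A" for m b
  proof -
    have mid: "is_id_on (\<rho> m) A" using ids m by simp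
    have "n y m j = 0" "n y m i = 0" using two_ids[OF fr l(1) lid l(4) m(1) mid] m(2) by auto
    then show "n b m i = 0" "n b m j = 0" using id_attached[OF fr m(1) mid b] by auto
  qed
  have S3: "{i, j, l} \<subseteq> I" using f(7,8) l(1) by auto
  have ne3: "{i, j, l} \<noteq> I" using card l f(15) by auto
  obtain a s m where m: "a \<in> A" "s \<in> {i, j, l}" "m \<in> I" "m \<notin> {i, j, l}" "n a m s \<noteq> 0"
    using irreducible_attached[OF irr S3 _ ne3] by blast
  then have "s = l" using unattached[OF m(3,4,1)] by auto
  then have ml: "n a m l \<noteq> 0" using m(5) by simp
  have mid: "is_id_on (\<rho> m) A" using ids m by simp
  have ml_all: "n b m l \<noteq> 0" if "b \<in> A" for b
    by (rule attached_everywhere[OF fr, of "{i, j, l, m}" m l a b])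
      (use m ml S3 unattached[OF m(3,4)] that in auto)
  \<comment> \<open>A fifth index \<open>e\<close> would be attached to \<open>l\<close>, creating a
    branch, or only to \<open>m\<close>, lengthening the chain.\<close>
  have "I = {i, j, l, m}"
  proof (rule ccontr)
    assume ne: "I \<noteq> {i, j, l, m}"
    have S4: "{i, j, l, m} \<subseteq> I" using S3 m(3) by auto
    obtain b s' e where e: "b \<in> A" "s' \<in> {i, j, l, m}" "e \<in> I" "e \<notin> {i, j, l, m}" "n b e s' \<noteq> 0"
      using irreducible_attached[OF irr S4 _ ne[symmetric]] by blast
    have e': "e \<notin> {i, j, l}" using e(4) by simp
    have eid: "is_id_on (\<rho> e) A" using ids e by simp
    have dist: "distinct [l, m, e]" using m(4) e(4) by auto
    have el: "n c e l = 0" if c: "c \<in> A" for c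
    proof (rule ccontr)
      assume "n c e l \<noteq> 0"
      then have "n x e l \<noteq> 0"
        by (intro attached_everywhere[OF fr, of "{i, j, l, e}" e l c x])
          (use e e' S3 unattached[OF e(3) e'] c f(1) in auto)
      then show False
        using no_branch[OF fr l(1) lid l(4) m(3) mid e(3) eid dist] ml_all[OF f(1)] by blast
    qed
    have "s' = m" using unattached[OF e(3) e' e(1)] el[OF e(1)] e(2,5) by auto
    then have em: "n b e m \<noteq> 0" using e(5) by simp
    have "n c e m \<noteq> 0" if "c \<in> A" for c
      by (rule attached_everywhere[OF fr, of "{i, j, l, m, e}" e m b c])
        (use e e' m S3 em unattached[OF e(3) e'] el that in auto)
    then show False
      using no_long_chain[OF fr l(1) lid l(4) m(3) mid e(3) eid dist] ml_all by blast
  qed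
  moreover have dist: "distinct [i, j, l, m]" using f(15) l m(4) by auto
  ultimately have bij: "bij_betw (enum4 i j l m) {1..4} I" using enum4_bij by blast
  note L = id_bond[OF fr l(1) lid l(4)]
  have lm: "l \<noteq> m" using m by auto
  have M: "n b l m = 1" "n b m l = 1" if b: "b \<in> A" for b
    using F4_bond[OF fr l(1) lid l(4) m(3) mid lm _ b] unattached[OF m(3,4)] ml_all by blast+
  have Z: "n b m i = 0" "n b m j = 0" "n b i m = 0" "n b j m = 0" if b: "b \<in> A" for b
    using unattached[OF m(3,4) b] id_nonneg(3,6)[OF fr m(3) mid b] by simp_all
  consider "n y j l = 1" "n y l j = 2" | "n y j l = 2" "n y l j = 1"
    using prod_eq_2[OF L(8,9,7)[OF f(1)]] by blast
  then have "(\<forall>b\<in>A. mat_eq4 (\<lambda>s t. C b (enum4 i j l m s) (enum4 i j l m t)) cartan_F4) \<or>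
    (\<forall>b\<in>A. mat_eq4 (\<lambda>s t. C b (enum4 i j l m s) (enum4 i j l m t)) cartan_F4')"
  proof cases
    case 1
    have "mat_eq4 (\<lambda>s t. C b (enum4 i j l m s) (enum4 i j l m t)) cartan_F4" if b: "b \<in> A" for b
      by (rule mat_eq4_enum4[OF b f(7,8) l(1) m(3)])
        (simp_all add: cartan_F4_def mat4_def L(1-6)[OF b] M[OF b] Z[OF b] 1)
    then show ?thesis by blast
  next
    case 2
    have "mat_eq4 (\<lambda>s t. C b (enum4 i j l m s) (enum4 i j l m t)) cartan_F4'" if b: "b \<in> A" for b
      by (rule mat_eq4_enum4[OF b f(7,8) l(1) m(3)])
        (simp_all add: cartan_F4'_def mat4_def L(1-6)[OF b] M[OF b] Z[OF b] 2)
    then show ?thesis by blast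
  qed
  moreover have "objs x y z" "swaps_fixes (\<rho> i) x y z" "swaps_fixes (\<rho> j) y z x"
    using fr by (simp_all add: frame_def)
  ultimately have "classified x y z (enum4 i j l m)"
    unfolding classified_def Let_def enum4_simps using bij lid mid by blast
  then show ?thesis by blast
qed

lemma single_case:
  assumes irr: "rs_irreducible I A R" and card: "4 \<le> card I"
    and fr: "frame x y z i j"
    and ids: "\<And>l. l \<in> I \<Longrightarrow> l \<noteq> i \<Longrightarrow> l \<noteq> j \<Longrightarrow> is_id_on (\<rho> l) A"
  shows "\<exists>x y z p. classified x y z p"
proof -
  note f = frame_facts[OF fr]
  have S: "{i, j} \<subseteq> I" using f(7,8) by auto
  have ne: "{i, j} \<noteq> I" using card f(15) by auto
  obtain a s l where l: "a \<in> A" "s \<in> {i, j}" "l \<in> I" "l \<notin> {i, j}" "n a l s \<noteq> 0"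
    using irreducible_attached[OF irr S _ ne] by blast
  have "is_id_on (\<rho> l) A" using ids l by simp
  then have "n y l i \<noteq> 0 \<or> n y l j \<noteq> 0" using id_attached[OF fr l(3) _ l(1)] l(2,5) by blast
  then show ?thesis
  proof
    assume "n y l i \<noteq> 0"
    then show ?thesis using single_case_aux[OF irr card frame_sym[OF fr], of l] ids l(3,4) by blast
  next
    assume "n y l j \<noteq> 0"
    then show ?thesis using single_case_aux[OF irr card fr, of l] ids l(3,4) by blast
  qed
qed

section \<open>A repeated transposition: types B4, C4 and D4\<close>

lemma double_case_aux:
  assumes irr: "rs_irreducible I A R"
    and fr: "frame x y z i j" "frame x y z k j" "i \<noteq> k"
    and ids: "\<And>l. l \<in> I \<Longrightarrow> l \<notin> {i, k, j} \<Longrightarrow> is_id_on (\<rho> l) A"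
    and l: "l \<in> I" "l \<notin> {i, k, j}" "n x k l \<noteq> 0"
  shows "\<exists>p. classified x y z p"
proof -
  note f = frame_facts[OF fr(1)] and fk = frame_facts[OF fr(2)]
  note lid = ids[OF l(1,2)]
  note L = A3_id_end[OF fr l(1) lid l(3)]
  have S3: "{i, k, j} \<subseteq> I" using f(7,8) fk(7) by auto
  have "I = {i, k, j, l}"
  proof (rule ccontr)
    assume ne: "I \<noteq> {i, k, j, l}"
    have S4: "{i, k, j, l} \<subseteq> I" using S3 l(1) by auto
    obtain b s e where e: "b \<in> A" "s \<in> {i, k, j, l}" "e \<in> I" "e \<notin> {i, k, j, l}" "n b e s \<noteq> 0"
      using irreducible_attached[OF irr S4 _ ne[symmetric]] by blast
    have eid: "is_id_on (\<rho> e) A" using ids e by simp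
    have le: "l \<noteq> e" using e(4) by auto
    note T = A3_two_ids[OF fr l(1) lid e(3) eid le l(3)]
    have un: "n c e i = 0" "n c e k = 0" "n c e j = 0" if "c \<in> A" for c
      using A3_id_attached[OF fr e(3) eid that] T(1,2) by blast+
    then have "s = l" using e(1,2,5) by auto
    then have el: "n b e l \<noteq> 0" using e(5) by simp
    have "n x e l \<noteq> 0"
      by (rule attached_everywhere[OF fr(1), of "{i, k, j, l, e}" e l b x])
        (use e S4 el un f(1) in auto)
    then show False using T(3) bond_pos[OF f(1) l(1) e(3) le] by blast
  qed
  then have "I = {i, j, k, l}" by blast
  moreover have dist: "distinct [i, j, k, l]" using f(15) fk(15) l(2) fr(3) by auto
  ultimately have bij: "bij_betw (enum4 i j k l) {1..4} I" using enum4_bij by blast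
  note A = frame_A3[OF fr]
  consider "n x k l = 1" "n x l k = 2" | "n x k l = 2" "n x l k = 1"
    using prod_eq_2[OF L(8,9,7)[OF f(1)]] by blast
  then have "(\<forall>b\<in>A. mat_eq4 (\<lambda>s t. C b (enum4 i j k l s) (enum4 i j k l t)) cartan_B4) \<or>
    (\<forall>b\<in>A. mat_eq4 (\<lambda>s t. C b (enum4 i j k l s) (enum4 i j k l t)) cartan_C4)"
  proof cases
    case 1
    have "mat_eq4 (\<lambda>s t. C b (enum4 i j k l s) (enum4 i j k l t)) cartan_B4" if b: "b \<in> A" for b
      by (rule mat_eq4_enum4[OF b f(7,8) fk(7) l(1)])
        (simp_all add: cartan_B4_def mat4_def L(1-6)[OF b] A[OF b] 1)
    then show ?thesis by blast
  next
    case 2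
    have "mat_eq4 (\<lambda>s t. C b (enum4 i j k l s) (enum4 i j k l t)) cartan_C4" if b: "b \<in> A" for b
      by (rule mat_eq4_enum4[OF b f(7,8) fk(7) l(1)])
        (simp_all add: cartan_C4_def mat4_def L(1-6)[OF b] A[OF b] 2)
    then show ?thesis by blast
  qed
  moreover have "objs x y z" "swaps_fixes (\<rho> i) x y z" "swaps_fixes (\<rho> k) x y z" "swaps_fixes (\<rho> j) y z x"
    using fr by (simp_all add: frame_def)
  ultimately have "classified x y z (enum4 i j k l)"
    unfolding classified_def Let_def enum4_simps using bij lid by blast
  then show ?thesis by blast
qed

lemma triple_case:
  assumes irr: "rs_irreducible I A R"
    and fr: "frame x y z i j" "frame x y z k j" "frame x y z m j" "i \<noteq> k" "i \<noteq> m" "k \<noteq> m"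
    and other: "\<And>l. l \<in> I \<Longrightarrow> l \<noteq> j \<Longrightarrow> frame x y z l j \<or> is_id_on (\<rho> l) A"
  shows "\<exists>p. classified x y z p"
proof -
  note f = frame_facts[OF fr(1)] and fk = frame_facts[OF fr(2)] and fm = frame_facts[OF fr(3)]
  have "I = {i, j, k, m}"
  proof (rule ccontr)
    assume ne: "I \<noteq> {i, j, k, m}"
    have S: "{i, j, k, m} \<subseteq> I" using f(7,8) fk(7) fm(7) by auto
    obtain a s l where l: "a \<in> A" "s \<in> {i, j, k, m}" "l \<in> I" "l \<notin> {i, j, k, m}" "n a l s \<noteq> 0"
      using irreducible_attached[OF irr S _ ne[symmetric]] by blast
    have "\<not> frame x y z l j"
    proof
      assume "frame x y z l j"
      then show False using no_four_leaves[OF fr(1-3)] fr(4-6) l(4) by auto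
    qed
    then have lid: "is_id_on (\<rho> l) A" using other[OF l(3)] l(4) by auto
    \<comment> \<open>Each of the three leaves takes the place of \<open>k\<close> in
      \<open>D4_id\<close> in turn.\<close>
    have "n x k l = 0" "n x i l = 0" "n x m l = 0"
      using D4_id[OF fr l(3) lid] D4_id[OF fr(2,1,3) fr(4)[symmetric] fr(6,5) l(3) lid]
        D4_id[OF fr(1,3,2) fr(5,4) fr(6)[symmetric] l(3) lid] by simp_all
    then show False
      using A3_id_attached[OF fr(1,2,4) l(3) lid l(1)] A3_id_attached[OF fr(1,3,5) l(3) lid l(1)] l(2,5) by auto
  qed
  moreover have "distinct [i, j, k, m]" using f(15) fk(15) fm(15) fr(4-6) by auto
  ultimately have bij: "bij_betw (enum4 i j k m) {1..4} I" using enum4_bij by blast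
  have "mat_eq4 (\<lambda>s t. C b (enum4 i j k m s) (enum4 i j k m t)) cartan_D4" if b: "b \<in> A" for b
    by (rule mat_eq4_enum4[OF b f(7,8) fk(7) fm(7)])
      (simp_all add: cartan_D4_def mat4_def frame_A3[OF fr(1,2,4) b] frame_A3[OF fr(1,3,5) b] frame_A3[OF fr(2,3,6) b])
  moreover have "objs x y z" "swaps_fixes (\<rho> i) x y z" "swaps_fixes (\<rho> k) x y z" "swaps_fixes (\<rho> m) x y z"
    "swaps_fixes (\<rho> j) y z x"
    using fr by (simp_all add: frame_def)
  ultimately have "classified x y z (enum4 i j k m)"
    unfolding classified_def Let_def enum4_simps using bij by blast
  then show ?thesis by blast
qed

section \<open>Involutions on three objects and the case distinction\<close>

lemma rho_cases:
  assumes "objs x y z" "k \<in> I"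
  shows "is_id_on (\<rho> k) A \<or> swaps_fixes (\<rho> k) x y z \<or> swaps_fixes (\<rho> k) y z x \<or> swaps_fixes (\<rho> k) x z y"
proof -
  have A: "A = {x, y, z}" and ne: "x \<noteq> y" "y \<noteq> z" "x \<noteq> z" using assms(1) by (simp_all add: objs_def)
  have xA: "x \<in> A" "y \<in> A" "z \<in> A" unfolding A by blast+
  have r: "\<rho> k x = x \<or> \<rho> k x = y \<or> \<rho> k x = z" "\<rho> k y = x \<or> \<rho> k y = y \<or> \<rho> k y = z"
    "\<rho> k z = x \<or> \<rho> k z = y \<or> \<rho> k z = z"
    using rho_in[OF assms(2) xA(1)] rho_in[OF assms(2) xA(2)] rho_in[OF assms(2) xA(3)] A by blast+
  have rr: "\<rho> k (\<rho> k x) = x" "\<rho> k (\<rho> k y) = y" "\<rho> k (\<rho> k z) = z"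
    using rho_rho[OF assms(2)] xA by simp_all
  have id: "is_id_on (\<rho> k) A \<longleftrightarrow> \<rho> k x = x \<and> \<rho> k y = y \<and> \<rho> k z = z"
    unfolding is_id_on_def A by blast
  show ?thesis unfolding id swaps_fixes_def using r rr ne by metis
qed

lemma frame_cases_rho:
  assumes "frame x y z i j" "k \<in> I"
  shows "is_id_on (\<rho> k) A \<or> frame x y z k j \<or> frame x y z i k"
proof -
  have "objs x y z" using assms(1) by (simp add: frame_def)
  then show ?thesis
    using rho_cases[of x y z k] assms no_transposition_triangle[OF assms] unfolding frame_def by blast
qed

text \<open>By \<open>no_transposition_square\<close> no second index acts like \<open>j\<close>. So
  there is a third index acting like \<open>i\<close> and \<open>k\<close>, or all remaining ones
  are identities.\<close>

lemma double_case:
  assumes irr: "rs_irreducible I A R" and card: "4 \<le> card I"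
    and fr: "frame x y z i j" "frame x y z k j" "i \<noteq> k"
  shows "\<exists>p. classified x y z p"
proof -
  note f = frame_facts[OF fr(1)] and fk = frame_facts[OF fr(2)]
  have other: "frame x y z l j \<or> is_id_on (\<rho> l) A" if "l \<in> I" "l \<noteq> j" for l
    using frame_cases_rho[OF fr(1) that(1)] no_transposition_square[OF fr(1,2) _ fr(3)] that(2) by blast
  show ?thesis
  proof (cases "\<exists>m. m \<noteq> i \<and> m \<noteq> k \<and> frame x y z m j")
    case True
    then obtain m where "m \<noteq> i" "m \<noteq> k" "frame x y z m j" by blast
    then show ?thesis using triple_case[OF irr fr(1,2)] fr(3) other by metis
  next
    case False
    then have ids: "is_id_on (\<rho> l) A" if "l \<in> I" "l \<notin> {i, k, j}" for l using other that by blast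
    have S: "{i, k, j} \<subseteq> I" using f(7,8) fk(7) by auto
    have ne: "{i, k, j} \<noteq> I" using card f(15) fk(15) fr(3) by auto
    obtain a s l where l: "a \<in> A" "s \<in> {i, k, j}" "l \<in> I" "l \<notin> {i, k, j}" "n a l s \<noteq> 0"
      using irreducible_attached[OF irr S _ ne] by blast
    have "n x i l \<noteq> 0 \<or> n x k l \<noteq> 0"
      using A3_id_attached[OF fr l(3) ids[OF l(3,4)] l(1)] l(2,5) by blast
    then show ?thesis
    proof
      assume "n x k l \<noteq> 0"
      then show ?thesis using double_case_aux[OF irr fr ids l(3,4)] by blast
    next
      assume *: "n x i l \<noteq> 0"
      have "{i, k, j} = {k, i, j}" by blast
      then show ?thesis using double_case_aux[OF irr fr(2,1) fr(3)[symmetric] _ l(3) _ *] ids l(4) by metis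
    qed
  qed
qed

text \<open>By connectedness every object is moved by some index: one index gives a transposition,
  and an index moving the object fixed by it gives a different one.\<close>

lemma exists_frame:
  assumes "cs_connected I A \<rho>" "card A = 3"
  shows "\<exists>x y z i j. frame x y z i j"
proof -
  obtain u v w where A: "A = {u, v, w}" and ne: "u \<noteq> v" "v \<noteq> w" "u \<noteq> w"
    using assms(2) by (auto simp: card_3_iff)
  have o: "objs u v w" unfolding objs_def using A ne by blast
  have fixed: "foldr \<rho> ws a = a" if "\<And>k. k \<in> I \<Longrightarrow> \<rho> k a = a" "set ws \<subseteq> I" for ws a
    using that(2) by (induction ws) (auto simp: that(1))
  have moves: "\<exists>k\<in>I. \<rho> k a \<noteq> a" if a: "a \<in> A" for a
  proof (rule ccontr)
    assume c: "\<not> ?thesis"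
    obtain b where "b \<in> A" "b \<noteq> a" using A ne a by blast
    then obtain ws where "set ws \<subseteq> I" "foldr \<rho> ws a = b"
      using assms(1) a unfolding cs_connected_def by blast
    then show False using fixed[of a ws] c \<open>b \<noteq> a\<close> by blast
  qed
  have "u \<in> A" unfolding A by blast
  then obtain k where k: "k \<in> I" "\<rho> k u \<noteq> u" using moves by blast
  obtain p q r where pqr: "objs p q r" "swaps_fixes (\<rho> k) p q r"
  proof -
    have id: "\<not> is_id_on (\<rho> k) A" using k(2) \<open>u \<in> A\<close> unfolding is_id_on_def by blast
    have "{u, v, w} = {v, w, u}" "{u, v, w} = {u, w, v}" by blast+
    then have "objs v w u" "objs u w v" unfolding objs_def using A ne by metis+
    then show ?thesis using rho_cases[OF o k(1)] id o that by blast
  qed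
  have rA: "r \<in> A" using pqr(1) unfolding objs_def by blast
  obtain m where m: "m \<in> I" "\<rho> m r \<noteq> r" using moves[OF rA] by blast
  have "\<not> is_id_on (\<rho> m) A" "\<not> swaps_fixes (\<rho> m) p q r"
    using m(2) rA unfolding is_id_on_def swaps_fixes_def by blast+
  then consider "swaps_fixes (\<rho> m) q r p" | "swaps_fixes (\<rho> m) p r q"
    using rho_cases[OF pqr(1) m(1)] by blast
  then show ?thesis
  proof cases
    case 1
    then have "frame p q r k m" using pqr k m by (simp add: frame_def)
    then show ?thesis by blast
  next
    case 2
    have "{p, q, r} = {q, p, r}" by blast
    then have "objs q p r" using pqr(1) unfolding objs_def by metis
    moreover have "swaps_fixes (\<rho> k) q p r" using pqr(2) by (simp add: swaps_fixes_def)
    ultimately have "frame q p r k m" using 2 k m by (simp add: frame_def)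
    then show ?thesis by blast
  qed
qed

lemma classification:
  assumes "cs_connected I A \<rho>" "card A = 3" "rs_irreducible I A R" "4 \<le> card I"
  shows "\<exists>x y z p. classified x y z p"
proof -
  obtain x y z i j where fr: "frame x y z i j" using exists_frame[OF assms(1,2)] by blast
  consider k where "k \<noteq> i" "frame x y z k j" | k where "k \<noteq> j" "frame x y z i k"
    | "\<And>l. l \<in> I \<Longrightarrow> l \<noteq> i \<Longrightarrow> l \<noteq> j \<Longrightarrow> is_id_on (\<rho> l) A"
    using frame_cases_rho[OF fr] by blast
  then show ?thesis
  proof cases
    case 1
    then show ?thesis using double_case[OF assms(3,4) fr] by blast
  next
    case 2
    \<comment> \<open>Reversing the frame puts the repeated transposition first.\<close>
    then show ?thesis using double_case[OF assms(3,4) frame_sym[OF fr] frame_sym] by blast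
  next
    case 3
    then show ?thesis using single_case[OF assms(3,4) fr] by blast
  qed
qed

section \<open>Standardness and indecomposability\<close>

lemma classified_type:
  assumes "classified x y z p"
  shows "\<exists>M. \<forall>a\<in>A. mat_eq4 (\<lambda>i j. C a (p i) (p j)) M"
  using assms unfolding classified_def Let_def by blast

lemma classified_standard:
  assumes "classified x y z p"
  shows "cs_standard I A C"
proof -
  obtain M where M: "\<And>a. a \<in> A \<Longrightarrow> mat_eq4 (\<lambda>i j. C a (p i) (p j)) M"
    using classified_type[OF assms] by blast
  have p: "p ` {1..4} = I" using assms by (auto simp: classified_def bij_betw_def)
  have "C a i j = C b i j" if ab: "a \<in> A" "b \<in> A" and ij: "i \<in> I" "j \<in> I" for a b i j
  proof -
    obtain s t where "s \<in> {1..4}" "t \<in> {1..4}" "i = p s" "j = p t" using ij unfolding p[symmetric] by blast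
    then show ?thesis using M[OF ab(1)] M[OF ab(2)] unfolding mat_eq4_def by metis
  qed
  then show ?thesis unfolding cs_standard_def by blast
qed

lemma irreducible_indecomposable:
  assumes "rs_irreducible I A R" "cs_standard I A C" "x \<in> A"
  shows "indecomposable I (C x)"
  unfolding indecomposable_def
proof
  assume "\<exists>I1 I2. I1 \<noteq> {} \<and> I2 \<noteq> {} \<and> I1 \<inter> I2 = {} \<and> I = I1 \<union> I2 \<and> (\<forall>i\<in>I1. \<forall>j\<in>I2. C x i j = 0)"
  then obtain I1 I2 where I12: "I1 \<noteq> {}" "I2 \<noteq> {}" "I1 \<inter> I2 = {}" "I1 \<union> I2 = I" "\<forall>i\<in>I1. \<forall>j\<in>I2. C x i j = 0"
    by blast
  have "n a i j = 0" if "a \<in> A" "i \<in> I1" "j \<in> I2" for a i j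
  proof -
    have "i \<in> I" "j \<in> I" using that I12 by blast+
    then have "C a i j = C x i j" using assms(2,3) that unfolding cs_standard_def by blast
    then show ?thesis using I12 that by (simp add: n_def)
  qed
  then have "rs_reducible I A R" using reducible_of_blocks[OF I12(4,3,1,2)] by blast
  then show False using assms(1) by (simp add: rs_irreducible_def)
qed

end

theorem theorem6p5:
  fixes \<theta> :: nat and A :: "'a set" and \<rho> :: "nat \<Rightarrow> 'a \<Rightarrow> 'a"
    and C :: "'a \<Rightarrow> nat \<Rightarrow> nat \<Rightarrow> int" and R :: "'a \<Rightarrow> (nat \<Rightarrow> int) set"
  assumes "\<theta> \<ge> 4"
    and "cartan_scheme {1..\<theta>} A \<rho> C"
    and "cs_connected {1..\<theta>} A \<rho>"
    and "card A = 3"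
    and "root_system {1..\<theta>} A \<rho> C R"
    and "rs_finite A R"
    and "rs_irreducible {1..\<theta>} A R"
  shows "cs_standard {1..\<theta>} A C \<and>
    (\<exists>\<pi> x y z. bij_betw \<pi> {1..4} {1..\<theta>} \<and> A = {x, y, z} \<and>
       x \<noteq> y \<and> y \<noteq> z \<and> x \<noteq> z \<and>
       indecomposable {1..\<theta>} (C x) \<and>
       (let M = (\<lambda>i j. C x (\<pi> i) (\<pi> j)); r = (\<lambda>i. \<rho> (\<pi> i)) in
         ((mat_eq4 M cartan_B4 \<or> mat_eq4 M cartan_C4) \<and>
            swaps_fixes (r 1) x y z \<and> swaps_fixes (r 3) x y z \<and>
            swaps_fixes (r 2) y z x \<and> is_id_on (r 4) A)
       \<or> (mat_eq4 M cartan_D4 \<and>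
            swaps_fixes (r 1) x y z \<and> swaps_fixes (r 3) x y z \<and> swaps_fixes (r 4) x y z \<and>
            swaps_fixes (r 2) y z x)
       \<or> ((mat_eq4 M cartan_F4 \<or> mat_eq4 M cartan_F4') \<and>
            swaps_fixes (r 1) x y z \<and> swaps_fixes (r 2) y z x \<and>
            is_id_on (r 3) A \<and> is_id_on (r 4) A)))"
proof -
  interpret finite_root_system "{1..\<theta>}" A \<rho> C R
    by unfold_locales (fact assms)+
  obtain x y z \<pi> where c: "classified x y z \<pi>"
    using classification[OF assms(3,4,7)] assms(1) by auto
  have std: "cs_standard {1..\<theta>} A C" using classified_standard[OF c] .
  have o: "A = {x, y, z}" "x \<noteq> y" "y \<noteq> z" "x \<noteq> z" using c unfolding classified_def objs_def by blast+
  have xA: "x \<in> A" unfolding o by blast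
  have ind: "indecomposable {1..\<theta>} (C x)" using irreducible_indecomposable[OF assms(7) std xA] .
  have bij: "bij_betw \<pi> {1..4} {1..\<theta>}" using c unfolding classified_def by blast
  show ?thesis
    by (intro conjI std exI[of _ \<pi>] exI[of _ x] exI[of _ y] exI[of _ z] bij o ind)
      (use c xA in \<open>unfold classified_def Let_def, blast\<close>)
qed

end
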